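(* Let $0<r<n$, $n\le 2r$, $J=I_r\oplus -I_{n-r}$, and let $$A=\begin{bmatrix}\alpha I_r & C\\ D & \beta I_{n-r}\end{bmatrix}\in M_n,\qquad \alpha,\beta\in\mathbb{C},\ \alpha\ne\beta,$$ with at least one nonzero off-diagonal entry, and suppose that $A$ belongs to the class $\mathcal{J}$ (defined in the context). Assume that $DC$ is normal and commutes with $C^*C+DD^*$. Let $U\in M_{n-r}$ be a unitary matrix that simultaneously diagonalizes these two matrices, and let $z_j$ and $h_j$, $j=1,\dots,n-r$, be the $j$-th diagonal entries of $U^*DCU$ and $U^*(C^*C+DD^* )U$, respectively. Put $\Delta_j=(\alpha-\beta)^2+4z_j$, and let $\hat{\mathcal H}_j$ denote the hyperbola with foci $$f_{j,\pm}=\tfrac12(\alpha+\beta)\pm\tfrac12\sqrt{\Delta_j},$$ with transverse axis of length $N_j=\left(\tfrac12|\Delta_j|+\tfrac12|\alpha-\beta|^2-h_j\right)^{1/2}$ and non-transverse axis of length $M_j=\left(\tfrac12|\Delta_j|-\tfrac12|\alpha-\beta|^2+h_j\right)^{1/2}$. The following conditions are equivalent: (a) $C^J(A)=\{\hat{\mathcal H}_1,\dots,\hat{\mathcal H}_{n-r},\alpha\}$ if $n<2r$, or $C^J(A)=\{\hat{\mathcal H}_1,\dots,\hat{\mathcal H}_{n/2}\}$ if $n=2r$ (that is, these are the components of $C^J(A)$); (b) for $j=1,\dots,n-r$, $$|\alpha-\beta|^2-|\Delta_j|\ \le\ 2h_j\ <\ |\alpha-\beta|^2+|\Delta_j|.$$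 In this case, $W^J(A)$ is the pseudo-convex hull of $\hat{\mathcal H}_1\cup\cdots\cup\hat{\mathcal H}_{n-r}$. Moreover, each hyperbola $\hat{\mathcal H}_j$ is nondegenerate if and only if the corresponding left-hand inequality in (b) is strict.
   Context: $M_n$ is the algebra of $n\times n$ complex matrices. For $J=I_r\oplus -I_{n-r}$ let $[x,y]_J=y^*Jx$ on $\mathbb{C}^n$. The Krein space (indefinite) numerical range of $A\in M_n$ is $W^J(A)=-W^J_-(A)\cup W^J_+(A)$, where $W^J_\pm(A)=\{[Ax,x]_J: x\in\mathbb{C}^n,\ [x,x]_J=\pm1\}$. The $J$-adjoint is $A^\#=JA^*J$; $\Re^J(A)=\frac{A+A^\#}{2}$, $\Im^J(A)=\frac{A-A^\#}{2i}$, and $H_\theta(A)=\Re^J(A)\cos\theta+\Im^J(A)\sin\theta$ for $\theta\in\mathbb{R}$. For a matrix $B$, $\sigma^J_\pm(B)=\{\lambda\in\mathbb{C}:\exists x\in\mathbb{C}^n,\ [x,x]_J=\pm1,\ Bx=\lambda x\}$. Class $\mathcal{J}$: the matrices $A\in M_n$ such that, for $\theta$ in some real interval, $H_\theta(A)$ has real eigenvalues with $\sigma^J_+(H_\theta(A))=\{\lambda_1(\theta),\dots,\lambda_r(\theta)\}$, $\lambda_1(\theta)\ge\cdots\ge\lambda_r(\theta)$, and $\sigma^J_-(H_\theta(A))=\{\lambda_{r+1}(\theta),\dots,\lambda_n(\theta)\}$, $\lambda_{r+1}(\theta)\ge\cdots\ge\lambda_n(\theta)$ (counting multiplicities), and the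 two families do not interlace, i.e. either $\lambda_r(\theta)>\lambda_{r+1}(\theta)$ or $\lambda_n(\theta)>\lambda_1(\theta)$. The indefinite boundary generating curve (indefinite Kippenhahn curve) $C^J(A)$ is the real part of the algebraic curve of class $n$ given in homogeneous line coordinates $(u,v,w)$ by $\det(u\,\Re^J(A)+v\,\Im^J(A)+w\,I_n)=0$ (the curve whose tangent lines are $ux+vy+w=0$), with $\mathbb{R}^2$ identified with $\mathbb{C}$; a point is a possible (class one) component. Pseudo-convex hull: points of the curve have the form $w=[Ax,x]_J/[x,x]_J$ with $[x,x]_J=\pm1$. The pseudo-convex hull is generated by taking, for any two points $w_1,w_2$ corresponding to $x,y$, the line segment joining them if $[x,x]_J[y,y]_J>0$, and the union of the two half-lines $\{tw_1+(1-t)w_2: t\le0 \text{ or } t\ge1\}$ if $[x,x]_J[y,y]_J<0$. The hyperbola $\hat{\mathcal H}_j$ makes sense when the quantities under the roots defining $N_j,M_j$ are respectively positive and nonnegative; when $M_j=0$ it is degenerate and reduces to its two foci $f_{j,\pm}$. Hyperbolas for different $j$ may coincide. *)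

theory Defs
  imports
    "HOL-Analysis.Elementary_Topology"
    "Jordan_Normal_Form.Schur_Decomposition"
begin

section \<open>Krein space notions\<close>

definition J_mat :: "nat \<Rightarrow> nat \<Rightarrow> complex mat" where
  "J_mat n r = four_block_mat (1\<^sub>m r) (0\<^sub>m r (n - r)) (0\<^sub>m (n - r) r) (- 1\<^sub>m (n - r))"

definition J_prod :: "nat \<Rightarrow> nat \<Rightarrow> complex vec \<Rightarrow> complex vec \<Rightarrow> complex" where
  "J_prod n r x y = (J_mat n r *\<^sub>v x) \<bullet>c y"

definition J_adjoint :: "nat \<Rightarrow> nat \<Rightarrow> complex mat \<Rightarrow> complex mat" where
  "J_adjoint n r A = J_mat n r * mat_adjoint A * J_mat n r"

definition J_Re :: "nat \<Rightarrow> nat \<Rightarrow> complex mat \<Rightarrow> complex mat" where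
  "J_Re n r A = (1 / 2) \<cdot>\<^sub>m (A + J_adjoint n r A)"

definition J_Im :: "nat \<Rightarrow> nat \<Rightarrow> complex mat \<Rightarrow> complex mat" where
  "J_Im n r A = (1 / (2 * \<i>)) \<cdot>\<^sub>m (A - J_adjoint n r A)"

definition J_H :: "nat \<Rightarrow> nat \<Rightarrow> complex mat \<Rightarrow> real \<Rightarrow> complex mat" where
  "J_H n r A \<theta> =
     complex_of_real (cos \<theta>) \<cdot>\<^sub>m J_Re n r A + complex_of_real (sin \<theta>) \<cdot>\<^sub>m J_Im n r A"

definition J_spectrum :: "nat \<Rightarrow> nat \<Rightarrow> real \<Rightarrow> complex mat \<Rightarrow> complex set" where
  "J_spectrum n r s B =
     {\<mu>. \<exists>x \<in> carrier_vec n. J_prod n r x x = complex_of_real s \<and> B *\<^sub>v x = \<mu> \<cdot>\<^sub>v x}"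

definition J_num_range_sgn :: "nat \<Rightarrow> nat \<Rightarrow> real \<Rightarrow> complex mat \<Rightarrow> complex set" where
  "J_num_range_sgn n r s A =
     {J_prod n r (A *\<^sub>v x) x | x. x \<in> carrier_vec n \<and> J_prod n r x x = complex_of_real s}"

definition J_num_range :: "nat \<Rightarrow> nat \<Rightarrow> complex mat \<Rightarrow> complex set" where
  "J_num_range n r A = uminus ` J_num_range_sgn n r (- 1) A \<union> J_num_range_sgn n r 1 A"

text \<open>The eigenvalues \<open>ev 1, \<dots>, ev n\<close> are counted with algebraic multiplicity, through the
  characteristic polynomial. The interval of angles is required to be nondegenerate.\<close>

definition class_J :: "nat \<Rightarrow> nat \<Rightarrow> complex mat \<Rightarrow> bool" where
  "class_J n r A \<longleftrightarrow> A \<in> carrier_mat n n \<and>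
     (\<exists>a b :: real. a < b \<and> (\<forall>\<theta> \<in> {a<..<b}. \<exists>ev :: nat \<Rightarrow> real.
        char_poly (J_H n r A \<theta>) = (\<Prod>i = 1..n. [:- complex_of_real (ev i), 1:]) \<and>
        J_spectrum n r 1 (J_H n r A \<theta>) = (\<lambda>i. complex_of_real (ev i)) ` {1..r} \<and>
        J_spectrum n r (- 1) (J_H n r A \<theta>) = (\<lambda>i. complex_of_real (ev i)) ` {r+1..n} \<and>
        antimono_on {1..r} ev \<and> antimono_on {r+1..n} ev \<and>
        (ev r > ev (r + 1) \<or> ev n > ev 1)))"

definition unitary_matrix :: "nat \<Rightarrow> complex mat \<Rightarrow> bool" where
  "unitary_matrix m U \<longleftrightarrow> U \<in> carrier_mat m m \<and> mat_adjoint U * U = 1\<^sub>m m \<and> U * mat_adjoint U = 1\<^sub>m m"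

definition normal_matrix :: "complex mat \<Rightarrow> bool" where
  "normal_matrix B \<longleftrightarrow> B * mat_adjoint B = mat_adjoint B * B"

section \<open>Curves given in homogeneous line coordinates\<close>

text \<open>Polynomials in the line coordinates \<open>(u, v, w)\<close> are iterated univariate polynomials; the
  innermost indeterminate is \<open>u\<close>, the outermost one is \<open>w\<close>.\<close>

type_synonym line_poly = "complex poly poly poly"

definition lp_const :: "complex \<Rightarrow> line_poly" where "lp_const c = [:[:[:c:]:]:]"
definition lp_u :: line_poly where "lp_u = [:[:[:0, 1:]:]:]"
definition lp_v :: line_poly where "lp_v = [:[:0, 1:]:]"
definition lp_w :: line_poly where "lp_w = [:0, 1:]"

definition lp_eval :: "line_poly \<Rightarrow> complex \<times> complex \<times> complex \<Rightarrow> complex" where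
  "lp_eval G = (\<lambda>(u, v, w). poly (poly (poly G [:[:w:]:]) [:v:]) u)"

definition lp_grad :: "line_poly \<Rightarrow> complex \<times> complex \<times> complex \<Rightarrow> complex \<times> complex \<times> complex" where
  "lp_grad G l =
     (lp_eval (map_poly (map_poly pderiv) G) l, lp_eval (map_poly pderiv G) l, lp_eval (pderiv G) l)"

text \<open>The tangent line \<open>u x + v y + w = 0\<close> with \<open>G (u, v, w) = 0\<close> touches the envelope at the
  point with homogeneous coordinates \<open>grad G (u, v, w)\<close>. For irreducible \<open>G\<close> the
  complex envelope (dual curve) is therefore the projective closure of the set of these points,
  which is formed here on the cone over it; its real part consists of the real points
  \<open>(x : y : 1)\<close>. For linear \<open>G\<close> the gradient is constant and the envelope is a point.\<close>

definition envelope_real_part :: "line_poly \<Rightarrow> complex set" where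
  "envelope_real_part G =
     {Complex x y | x y. (complex_of_real x, complex_of_real y, 1) \<in>
        closure {(c * p, c * q, c * s) | c p q s. \<exists>l. lp_eval G l = 0 \<and> lp_grad G l = (p, q, s)}}"

definition kippenhahn_poly :: "nat \<Rightarrow> nat \<Rightarrow> complex mat \<Rightarrow> line_poly" where
  "kippenhahn_poly n r A =
     Determinant.det (lp_u \<cdot>\<^sub>m map_mat lp_const (J_Re n r A) + lp_v \<cdot>\<^sub>m map_mat lp_const (J_Im n r A)
          + lp_w \<cdot>\<^sub>m 1\<^sub>m n)"

text \<open>The components of the indefinite Kippenhahn curve, as subsets of the plane. Components
  of higher multiplicity are listed once.\<close>

definition kippenhahn_components :: "nat \<Rightarrow> nat \<Rightarrow> complex mat \<Rightarrow> complex set set" where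
  "kippenhahn_components n r A =
     {envelope_real_part G | G. irreducible G \<and> G dvd kippenhahn_poly n r A}"

section \<open>Hyperbolas\<close>

text \<open>\<open>N\<close> and \<open>M\<close> are the full lengths of the transverse and the non-transverse axis; it is
  understood that \<open>N\<^sup>2 + M\<^sup>2 = |f\<^sub>1 - f\<^sub>2|\<^sup>2\<close>. A degenerate hyperbola
  consists of its two foci, each of them a component.\<close>

definition hyperbola_components :: "complex \<Rightarrow> complex \<Rightarrow> real \<Rightarrow> real \<Rightarrow> complex set set" where
  "hyperbola_components f1 f2 N M =
     (if M = 0 then {{f1}, {f2}} else {{p. \<bar>dist p f1 - dist p f2\<bar> = N}})"

definition hyperbola :: "complex \<Rightarrow> complex \<Rightarrow> real \<Rightarrow> real \<Rightarrow> complex set" where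
  "hyperbola f1 f2 N M = \<Union> (hyperbola_components f1 f2 N M)"

text \<open>The real \<^const>\<open>sqrt\<close> is an odd strictly increasing function, so when \<open>N\<close> and \<open>M\<close> are given
  as square roots this says that the radicands are positive and nonnegative, respectively.\<close>

definition hyperbola_makes_sense :: "real \<Rightarrow> real \<Rightarrow> bool" where
  "hyperbola_makes_sense N M \<longleftrightarrow> 0 < N \<and> 0 \<le> M"

definition hyperbola_nondegenerate :: "real \<Rightarrow> real \<Rightarrow> bool" where
  "hyperbola_nondegenerate N M \<longleftrightarrow> hyperbola_makes_sense N M \<and> M \<noteq> 0"

section \<open>Pseudo-convex hulls\<close>

text \<open>A pair \<open>(w, s)\<close> stands for a point \<open>w = [Ax,x]/[x,x]\<close> with \<open>[x,x]\<close> of sign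
  \<open>s = \<plusminus>1\<close>. Points of the half-line issuing from \<open>w1\<close> away from \<open>w2\<close>
  are \<open>(|a|\<^sup>2 w1 - |b|\<^sup>2 w2) / (|a|\<^sup>2 - |b|\<^sup>2)\<close> with \<open>|a| > |b|\<close>, hence carry the
  sign of \<open>w1\<close>; the half-line \<open>t \<le> 0\<close> arises by exchanging the roles of \<open>w1\<close> and \<open>w2\<close>.\<close>

inductive_set signed_hull :: "(complex \<times> real) set \<Rightarrow> (complex \<times> real) set"
  for S :: "(complex \<times> real) set" where
  base: "p \<in> S \<Longrightarrow> p \<in> signed_hull S"
| segment: "(w1, s) \<in> signed_hull S \<Longrightarrow> (w2, s) \<in> signed_hull S \<Longrightarrow> 0 \<le> t \<Longrightarrow> t \<le> 1 \<Longrightarrow>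
     (complex_of_real t * w1 + complex_of_real (1 - t) * w2, s) \<in> signed_hull S"
| half_line: "(w1, s) \<in> signed_hull S \<Longrightarrow> (w2, - s) \<in> signed_hull S \<Longrightarrow> 1 \<le> t \<Longrightarrow>
     (complex_of_real t * w1 + complex_of_real (1 - t) * w2, s) \<in> signed_hull S"

text \<open>The set \<open>X\<close> itself is included so that points of \<open>X\<close> which do not correspond to any vector
  would not be silently dropped.\<close>

definition pseudo_convex_hull :: "nat \<Rightarrow> nat \<Rightarrow> complex mat \<Rightarrow> complex set \<Rightarrow> complex set" where
  "pseudo_convex_hull n r A X = X \<union> fst ` signed_hull
     {(w, s). w \<in> X \<and> s \<in> {1, - 1} \<and>
        (\<exists>x \<in> carrier_vec n. J_prod n r x x = complex_of_real s \<and>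
           w = J_prod n r (A *\<^sub>v x) x / J_prod n r x x)}"

end

theory Submission
  imports Defs "HOL-Analysis.Starlike"
    "HOL-Computational_Algebra.Polynomial_Factorial" "HOL-Computational_Algebra.Field_as_Ring"
begin

text \<open>Put $c = (\<alpha> + \<beta>)/2$, $\<delta> = (\<alpha> - \<beta>)/2$, $F_j = \<Delta>_j/4$ and $k_j = |\<delta>|^2 - h_j/2$. Then
$N_j^2 = 2(|F_j| + k_j)$ and $M_j^2 = 2(|F_j| - k_j)$, so the inequalities in (b) say exactly that all the
hyperbolas make sense, which is the first half of (a), and $M_j \<noteq> 0$ is the strict form of the left-hand
inequality. The substance of the theorem is that (b) forces the shape of the curve and of the numerical range.

The curve: the matrix $u \<Re>^J(A) + v \<Im>^J(A) + w I$ has scalar diagonal blocks, hence block elimination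
expresses its determinant through the product of its off-diagonal blocks. That product is a combination of
$DC$, $(DC)^*$ and $C^*C + DD^*$, and $U$ diagonalizes all three. The determinant therefore is a power of the
pencil of lines through $\<alpha>$ times one central conic for each $j$ (\<open>kippenhahn_poly_factorization\<close>). By unique
factorization the components may be computed factor by factor (\<open>lp_components_mult\<close>); a conic with $M_j \<noteq> 0$
is irreducible and its envelope is the hyperbola, and for $M_j = 0$ it splits into the pencils through the two
foci (\<open>lp_components_conic\<close>).

The numerical range: assign to a vector $x$ the point $([Ax,x] - c[x,x],\ [x,x])$ of $\<complex> \<times> \<real>$. These points form a
convex cone $K$, because three Hermitian forms have a convex joint range on all of $\<complex>^n$
(\<open>krein_cone_add\<close>). The numerical range is $K$ seen in the two charts $s = \<plusminus>1$, and the segments and half-lines of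
the pseudo-convex hull are sums in $K$. A linear functional $(w, s) \<mapsto> \<Re>(g w) - \<mu> s$ pulls back to a
Hermitian form in $x$; completing the square splits it into the index-$j$ contributions
(\<open>pairing_square\<close>). It follows that the functional is nonnegative on $K$ as soon as it is nonnegative on the
finite points of all hyperbolas (\<open>dual_nonneg\<close>), and that a point of $K$ on which a nonnegative functional
vanishes is a sum of tangency points, all of them with the same sign of $s$ (\<open>kernel_decomposition\<close>,
\<open>kernel_uncoupled\<close>). Consequently a point of $K$ with $s \<noteq> 0$ cannot be separated from the cone generated by the
finite points of the hyperbolas, not even weakly (\<open>finite_point_in_hull_cone\<close>). Weak separation matters
because that cone need not be closed: the asymptotic directions of the hyperbolas are missing from it.

Membership in class $\<J>$ enters through an angle at which every $H_\<theta>(A)$-block has two different real eigenvalues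
(\<open>class_J_separating\<close>). It gives a functional that is nonnegative on $K$ and strictly separates the two branches
of each hyperbola, and so decides which sign a point of a hyperbola carries.\<close>

(* The dot and the dollar sign denote the operations on matrix vectors below. *)
no_notation inner (infix "\<bullet>" 70)
no_notation vec_nth (infixl "$" 90)

section \<open>Central hyperbolas in line coordinates\<close>

text \<open>For $g = u - \<i> v$ the equation \<open>w\<^sup>2 = line_form F k g\<close> describes, for $|k| < |F|$, the tangents $ux + vy + w = 0$ of the
hyperbola that is centred at $0$, has its foci at the square roots of $F$ and semi-axes whose squares are $(|F| + k)/2$
and $(|F| - k)/2$.\<close>
definition line_form :: "complex \<Rightarrow> real \<Rightarrow> complex \<Rightarrow> real" where
  "line_form F k g = (Re (F * g\<^sup>2) + k * (cmod g)\<^sup>2) / 2"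

text \<open>The gradient of \<open>line_form\<close> with respect to the pairing $\<Re>(g w)$; up to a real factor it is the point in which
the tangent belonging to $g$ touches the hyperbola.\<close>
definition polar :: "complex \<Rightarrow> real \<Rightarrow> complex \<Rightarrow> complex" where
  "polar F k g = F * g + complex_of_real k * cnj g"

lemma Re_mult_polar: "Re (g * polar F k g) = 2 * line_form F k g"
  unfolding line_form_def polar_def cmod_power2
  by (simp add: power2_eq_square algebra_simps)

lemma line_form_add: "line_form F k (g + g') = line_form F k g + Re (g' * polar F k g) + line_form F k g'"
  unfolding line_form_def polar_def cmod_power2
  by (simp add: power2_eq_square field_simps)

lemma line_form_scale: "line_form F k (complex_of_real t * g) = t\<^sup>2 * line_form F k g"
  unfolding line_form_def cmod_power2
  by (simp add: power2_eq_square algebra_simps)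

lemma polar_scale: "polar F k (complex_of_real t * g) = complex_of_real t * polar F k g"
  unfolding polar_def by (simp add: algebra_simps)

lemma line_form_square: "line_form (\<phi>\<^sup>2) ((cmod \<phi>)\<^sup>2) g = (Re (\<phi> * g))\<^sup>2"
  unfolding line_form_def cmod_power2
  by (simp add: power2_eq_square field_simps)

lemma polar_square: "polar (\<phi>\<^sup>2) ((cmod \<phi>)\<^sup>2) g = complex_of_real (2 * Re (\<phi> * g)) * \<phi>"
  unfolding polar_def cmod_power2
  by (simp add: complex_eq_iff power2_eq_square algebra_simps)

text \<open>Up to sign and a constant factor the adjugate of \<open>line_form\<close>, that is, the point equation of the hyperbola.\<close>
definition point_form :: "complex \<Rightarrow> real \<Rightarrow> complex \<Rightarrow> real" where
  "point_form F k w = Re (cnj F * w\<^sup>2) - k * (cmod w)\<^sup>2"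

lemma point_form_polar: "point_form F k (polar F k g) = 2 * ((cmod F)\<^sup>2 - k\<^sup>2) * line_form F k g"
  unfolding line_form_def polar_def point_form_def cmod_power2
  by (simp add: power2_eq_square algebra_simps)

text \<open>Cramer's rule for the real-linear map \<open>polar F k\<close>, whose determinant is $|F|^2 - k^2$.\<close>
lemma polar_inverse:
  assumes "(cmod F)\<^sup>2 \<noteq> k\<^sup>2"
  shows "polar F k ((cnj F * w - complex_of_real k * cnj w) / complex_of_real ((cmod F)\<^sup>2 - k\<^sup>2)) = w"
proof -
  have ne: "complex_of_real ((cmod F)\<^sup>2 - k\<^sup>2) \<noteq> 0"
    using assms by (metis of_real_eq_0_iff right_minus_eq)
  have FF: "F * cnj F = complex_of_real ((cmod F)\<^sup>2)"
    by (simp only: complex_norm_square)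
  have "F * (cnj F * w - complex_of_real k * cnj w) +
      complex_of_real k * (F * cnj w - complex_of_real k * w)
      = (F * cnj F - complex_of_real (k\<^sup>2)) * w"
    by (simp add: power2_eq_square algebra_simps)
  also have "\<dots> = complex_of_real ((cmod F)\<^sup>2 - k\<^sup>2) * w" by (simp add: FF)
  finally have eq: "F * (cnj F * w - complex_of_real k * cnj w) +
      complex_of_real k * (F * cnj w - complex_of_real k * w)
      = complex_of_real ((cmod F)\<^sup>2 - k\<^sup>2) * w" .
  have "polar F k ((cnj F * w - complex_of_real k * cnj w) / complex_of_real ((cmod F)\<^sup>2 - k\<^sup>2))
      = (F * (cnj F * w - complex_of_real k * cnj w) +
      complex_of_real k * (F * cnj w - complex_of_real k * w)) / complex_of_real ((cmod F)\<^sup>2 - k\<^sup>2)"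
    unfolding polar_def by (simp add: add_divide_distrib)
  then show ?thesis unfolding eq using ne by simp
qed

text \<open>Let $a$ and $b$ be the focal distances. Since $a^2 + b^2 = 2|w|^2 + 2|\<phi>|^2$, squaring the equation $|a - b| = N$
leaves $ab = |w|^2 - k$. As $ab = |w^2 - \<phi>^2|$, another squaring makes the fourth powers cancel, and the quadratic
equation of the hyperbola remains.\<close>
lemma focal_distances_iff:
  fixes w \<phi> :: complex and k :: real
  assumes "0 < (cmod \<phi>)\<^sup>2 + k" and "k < (cmod \<phi>)\<^sup>2"
  shows "\<bar>dist (c + w) (c + \<phi>) - dist (c + w) (c - \<phi>)\<bar> = sqrt (2 * ((cmod \<phi>)\<^sup>2 + k))
    \<longleftrightarrow> 2 * point_form (\<phi>\<^sup>2) k w = (cmod (\<phi>\<^sup>2))\<^sup>2 - k\<^sup>2"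
proof -
  define a where "a = cmod (w - \<phi>)"
  define b where "b = cmod (w + \<phi>)"
  define P where "P = (cmod \<phi>)\<^sup>2"
  have P: "0 < P + k" "k < P" "0 \<le> P" using assms by (auto simp: P_def)
  have d: "dist (c + w) (c + \<phi>) = a" "dist (c + w) (c - \<phi>) = b"
    by (auto simp: dist_norm a_def b_def algebra_simps)
  have ab2: "a\<^sup>2 + b\<^sup>2 = 2 * (cmod w)\<^sup>2 + 2 * P"
    unfolding a_def b_def P_def cmod_power2 by (simp add: power2_eq_square algebra_simps)
  have ab: "a * b = cmod (w\<^sup>2 - \<phi>\<^sup>2)"
    unfolding a_def b_def by (simp add: norm_mult[symmetric] power2_eq_square algebra_simps)
  have abs: "(a * b)\<^sup>2 = (cmod w)^4 - 2 * Re (cnj (\<phi>\<^sup>2) * w\<^sup>2) + P\<^sup>2"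
  proof -
    have "(cmod w)^4 = ((cmod w)\<^sup>2)\<^sup>2" by simp
    then show ?thesis unfolding ab P_def cmod_power2
      by (simp add: power2_eq_square algebra_simps)
  qed
  have P2: "cmod (\<phi>\<^sup>2) = P" by (simp add: P_def norm_power)
  have "\<bar>a - b\<bar> = sqrt (2 * (P + k)) \<longleftrightarrow> (a - b)\<^sup>2 = 2 * (P + k)"
    using P by (metis abs_ge_zero power2_abs real_sqrt_abs real_sqrt_pow2 less_eq_real_def
      mult_nonneg_nonneg zero_le_numeral)
  also have "\<dots> \<longleftrightarrow> a * b = (cmod w)\<^sup>2 - k"
    using ab2 by (auto simp: power2_eq_square algebra_simps)
  also have "\<dots> \<longleftrightarrow> (a * b)\<^sup>2 = ((cmod w)\<^sup>2 - k)\<^sup>2 \<and> k \<le> (cmod w)\<^sup>2"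
  proof -
    have "0 \<le> a * b" by (simp add: a_def b_def)
    then show ?thesis by (auto intro: power2_eq_imp_eq)
  qed
  also have "\<dots> \<longleftrightarrow> 2 * point_form (\<phi>\<^sup>2) k w = P\<^sup>2 - k\<^sup>2 \<and> k \<le> (cmod w)\<^sup>2"
    unfolding abs point_form_def by (auto simp: power2_eq_square power4_eq_xxxx algebra_simps)
  also have "\<dots> \<longleftrightarrow> 2 * point_form (\<phi>\<^sup>2) k w = P\<^sup>2 - k\<^sup>2"
  proof -
    \<comment> \<open>The branches stay outside the circle of radius \<open>sqrt k\<close>.\<close>
    have "k \<le> (cmod w)\<^sup>2" if h: "2 * point_form (\<phi>\<^sup>2) k w = P\<^sup>2 - k\<^sup>2"
    proof (rule ccontr)
      assume n: "\<not> k \<le> (cmod w)\<^sup>2"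
      have "Re (cnj (\<phi>\<^sup>2) * w\<^sup>2) \<le> cmod (cnj (\<phi>\<^sup>2) * w\<^sup>2)" by (rule complex_Re_le_cmod)
      also have "\<dots> = P * (cmod w)\<^sup>2" by (simp add: norm_mult norm_power P_def)
      finally have "P\<^sup>2 - k\<^sup>2 \<le> 2 * ((P - k) * (cmod w)\<^sup>2)"
        using h by (simp add: point_form_def algebra_simps)
      also have "\<dots> < 2 * ((P - k) * k)" using n P by simp
      finally have "(P - k) * (P - k) < 0" by (simp add: power2_eq_square algebra_simps)
      then show False using zero_le_square[of "P - k"] by linarith
    qed
    then show ?thesis by blast
  qed
  finally show ?thesis unfolding d P2 P_def .
qed

text \<open>The parametrization of a hyperbola by its tangents. If $k < |\<phi>|^2$, the map \<open>polar\<close> is invertible and carries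
the line equation to the point equation. If $k = |\<phi>|^2$, the tangents are the lines through one of the foci, all
values of \<open>polar\<close> are real multiples of $\<phi>$, and the normalization $1/4$ singles out $\<plusminus>\<phi>$.\<close>
lemma hyperbola_iff_polar:
  fixes c \<phi> :: complex and k :: real
  assumes N: "0 < cmod (\<phi>\<^sup>2) + k" and M: "k \<le> cmod (\<phi>\<^sup>2)"
  shows "w \<in> hyperbola (c + \<phi>) (c - \<phi>) (sqrt (2 * (cmod (\<phi>\<^sup>2) + k))) (sqrt (2 * (cmod (\<phi>\<^sup>2) - k)))
    \<longleftrightarrow> (\<exists>g. line_form (\<phi>\<^sup>2) k g = 1/4 \<and> w = c + polar (\<phi>\<^sup>2) k g)"
proof (cases "k = cmod (\<phi>\<^sup>2)")
  case True
  then have k: "k = (cmod \<phi>)\<^sup>2" by (simp add: norm_power)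
  have \<phi>: "\<phi> \<noteq> 0" using N True by auto
  have hyp: "w \<in> hyperbola (c + \<phi>) (c - \<phi>) (sqrt (2 * (cmod (\<phi>\<^sup>2) + k))) (sqrt (2 * (cmod (\<phi>\<^sup>2) - k)))
    \<longleftrightarrow> w = c + \<phi> \<or> w = c - \<phi>"
    by (auto simp: hyperbola_def hyperbola_components_def True)
  show ?thesis unfolding hyp unfolding k line_form_square polar_square
  proof (intro iffI)
    assume "w = c + \<phi> \<or> w = c - \<phi>"
    then show "\<exists>g. (Re (\<phi> * g))\<^sup>2 = 1/4 \<and> w = c + complex_of_real (2 * Re (\<phi> * g)) * \<phi>"
    proof
      assume "w = c + \<phi>"
      then show ?thesis using \<phi> by (intro exI[of _ "1 / (2 * \<phi>)"]) (simp add: power2_eq_square)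
    next
      assume "w = c - \<phi>"
      then show ?thesis using \<phi> by (intro exI[of _ "-1 / (2 * \<phi>)"]) (simp add: power2_eq_square)
    qed
  next
    assume "\<exists>g. (Re (\<phi> * g))\<^sup>2 = 1/4 \<and> w = c + complex_of_real (2 * Re (\<phi> * g)) * \<phi>"
    then obtain g where g: "(Re (\<phi> * g))\<^sup>2 = 1/4" "w = c + complex_of_real (2 * Re (\<phi> * g)) * \<phi>" by blast
    from g(1) have "(2 * Re (\<phi> * g))\<^sup>2 = 1" unfolding power_mult_distrib by simp
    then have "2 * Re (\<phi> * g) = 1 \<or> 2 * Re (\<phi> * g) = -1" by (simp only: power2_eq_1_iff)
    then show "w = c + \<phi> \<or> w = c - \<phi>" using g(2) by (metis add_uminus_conv_diff mult_1 mult_minus1 of_real_1 of_real_minus)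
  qed
next
  case False
  then have kl: "k < (cmod \<phi>)\<^sup>2" using M by (simp add: norm_power)
  have Np: "0 < (cmod \<phi>)\<^sup>2 + k" using N by (simp add: norm_power)
  define d where "d = (cmod (\<phi>\<^sup>2))\<^sup>2 - k\<^sup>2"
  have d: "d = (cmod (\<phi>\<^sup>2) - k) * (cmod (\<phi>\<^sup>2) + k)" by (simp add: d_def power2_eq_square algebra_simps)
  have d0: "d \<noteq> 0" using kl Np unfolding d by (simp add: norm_power)
  have "w \<in> hyperbola (c + \<phi>) (c - \<phi>) (sqrt (2 * (cmod (\<phi>\<^sup>2) + k))) (sqrt (2 * (cmod (\<phi>\<^sup>2) - k)))
    \<longleftrightarrow> \<bar>dist w (c + \<phi>) - dist w (c - \<phi>)\<bar> = sqrt (2 * ((cmod \<phi>)\<^sup>2 + k))"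
    using False by (auto simp: hyperbola_def hyperbola_components_def norm_power)
  also have "\<dots> \<longleftrightarrow> 2 * point_form (\<phi>\<^sup>2) k (w - c) = d"
    using focal_distances_iff[OF Np kl, of c "w - c"] by (simp add: d_def)
  also have "\<dots> \<longleftrightarrow> (\<exists>g. line_form (\<phi>\<^sup>2) k g = 1/4 \<and> w = c + polar (\<phi>\<^sup>2) k g)"
  proof
    assume h: "2 * point_form (\<phi>\<^sup>2) k (w - c) = d"
    have ne: "(cmod (\<phi>\<^sup>2))\<^sup>2 \<noteq> k\<^sup>2" using d0 by (simp add: d_def)
    obtain g where g: "polar (\<phi>\<^sup>2) k g = w - c" using polar_inverse[OF ne] by blast
    have "2 * (2 * d * line_form (\<phi>\<^sup>2) k g) = d"
      using h point_form_polar[of "\<phi>\<^sup>2" k g] by (simp add: g d_def)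
    then have "line_form (\<phi>\<^sup>2) k g = 1/4" using d0 by simp
    then show "\<exists>g. line_form (\<phi>\<^sup>2) k g = 1/4 \<and> w = c + polar (\<phi>\<^sup>2) k g"
      using g by (intro exI[of _ g]) simp
  next
    assume "\<exists>g. line_form (\<phi>\<^sup>2) k g = 1/4 \<and> w = c + polar (\<phi>\<^sup>2) k g"
    then obtain g where "line_form (\<phi>\<^sup>2) k g = 1/4" "w = c + polar (\<phi>\<^sup>2) k g" by blast
    then show "2 * point_form (\<phi>\<^sup>2) k (w - c) = d"
      using point_form_polar[of "\<phi>\<^sup>2" k g] unfolding d_def[symmetric] by simp
  qed
  finally show ?thesis .
qed

section \<open>Line polynomials and their envelopes\<close>

text \<open>The pencil of lines through the point $f$.\<close>
definition lp_line :: "complex \<Rightarrow> line_poly" where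
  "lp_line f = lp_w + lp_const (complex_of_real (Re f)) * lp_u + lp_const (complex_of_real (Im f)) * lp_v"

text \<open>The form \<open>line_form\<close> written in the coordinates of $g = u - \<i> v$.\<close>
definition lp_quad :: "complex \<Rightarrow> real \<Rightarrow> line_poly" where
  "lp_quad F k = lp_const (complex_of_real ((k + Re F) / 2)) * lp_u\<^sup>2
     + lp_const (complex_of_real (Im F)) * lp_u * lp_v
     + lp_const (complex_of_real ((k - Re F) / 2)) * lp_v\<^sup>2"

definition lp_conic :: "complex \<Rightarrow> complex \<Rightarrow> real \<Rightarrow> line_poly" where
  "lp_conic c F k = (lp_line c)\<^sup>2 - lp_quad F k"

lemma lp_eval_hom [simp]:
  "lp_eval (G + H) l = lp_eval G l + lp_eval H l"
  "lp_eval (G - H) l = lp_eval G l - lp_eval H l"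
  "lp_eval (- G) l = - lp_eval G l"
  "lp_eval (G * H) l = lp_eval G l * lp_eval H l"
  "lp_eval (G ^ e) l = lp_eval G l ^ e"
  "lp_eval 0 l = 0" "lp_eval 1 l = 1" "lp_eval 2 l = 2"
  "lp_eval (lp_const a) l = a"
  "lp_eval lp_u l = fst l" "lp_eval lp_v l = fst (snd l)" "lp_eval lp_w l = snd (snd l)"
  by (auto simp: lp_eval_def lp_const_def lp_u_def lp_v_def lp_w_def split: prod.split)

lemma map_poly_pderiv_sum:
  "map_poly pderiv (sum f A) = (\<Sum>x\<in>A. map_poly pderiv (f x :: complex poly poly))"
  by (rule poly_eqI) (simp add: coeff_map_poly coeff_sum pderiv_sum)

text \<open>Differentiation with respect to an inner indeterminate acts on coefficients and is again a derivation.\<close>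
lemma map_poly_pderiv_mult:
  fixes p q :: "'a :: {comm_ring_1, semiring_no_zero_divisors} poly poly"
  shows "map_poly pderiv (p * q) = p * map_poly pderiv q + map_poly pderiv p * q"
proof (rule poly_eqI)
  fix n
  have "coeff (map_poly pderiv (p * q)) n = (\<Sum>i\<le>n. pderiv (coeff p i * coeff q (n - i)))"
    by (simp only: coeff_map_poly pderiv_0 coeff_mult pderiv_sum)
  also have "\<dots> = (\<Sum>i\<le>n. coeff p i * pderiv (coeff q (n - i)) + pderiv (coeff p i) * coeff q (n - i))"
    by (simp only: pderiv_mult mult.commute[of "coeff q _" "pderiv (coeff p _)"])
  finally show "coeff (map_poly pderiv (p * q)) n = coeff (p * map_poly pderiv q + map_poly pderiv p * q) n"
    by (simp only: coeff_add coeff_mult coeff_map_poly pderiv_0 sum.distrib)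
qed

definition pd_u :: "line_poly \<Rightarrow> line_poly" where "pd_u = map_poly (map_poly pderiv)"
definition pd_v :: "line_poly \<Rightarrow> line_poly" where "pd_v = map_poly pderiv"

lemma coeff_pd_u: "coeff (pd_u p) i = map_poly pderiv (coeff p i)"
  by (simp add: pd_u_def coeff_map_poly)

lemma coeff_pd_v: "coeff (pd_v p) i = pderiv (coeff p i)"
  by (simp add: pd_v_def coeff_map_poly)

lemma pd_v_add: "pd_v (G + H) = pd_v G + pd_v H"
  by (rule poly_eqI) (simp add: coeff_pd_v pderiv_add)
lemma pd_v_diff: "pd_v (G - H) = pd_v G - pd_v H"
  by (rule poly_eqI) (simp add: coeff_pd_v pderiv_diff)
lemma pd_v_mult: "pd_v (G * H) = G * pd_v H + pd_v G * H"
  unfolding pd_v_def by (rule map_poly_pderiv_mult)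
lemma pd_u_add: "pd_u (G + H) = pd_u G + pd_u H"
  by (intro poly_eqI) (simp add: coeff_pd_u coeff_map_poly pderiv_add)
lemma pd_u_diff: "pd_u (G - H) = pd_u G - pd_u H"
  by (intro poly_eqI) (simp add: coeff_pd_u coeff_map_poly pderiv_diff)
lemma pd_u_mult: "pd_u (G * H) = G * pd_u H + pd_u G * H"
proof (rule poly_eqI)
  fix n
  show "coeff (pd_u (G * H)) n = coeff (G * pd_u H + pd_u G * H) n"
    by (simp only: coeff_add coeff_mult coeff_pd_u map_poly_pderiv_sum map_poly_pderiv_mult sum.distrib)
qed

lemma pd_basic:
  "pd_u (lp_const a) = 0" "pd_u lp_u = 1" "pd_u lp_v = 0" "pd_u lp_w = 0"
  "pd_v (lp_const a) = 0" "pd_v lp_u = 0" "pd_v lp_v = 1" "pd_v lp_w = 0"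
  "pderiv (lp_const a) = 0" "pderiv lp_u = 0" "pderiv lp_v = 0" "pderiv lp_w = (1::line_poly)"
  by (cases "a = 0"; simp add: pd_u_def pd_v_def lp_const_def lp_u_def lp_v_def lp_w_def map_poly_pCons
      pderiv_pCons one_pCons)+

lemma lp_grad_alt: "lp_grad G l = (lp_eval (pd_u G) l, lp_eval (pd_v G) l, lp_eval (pderiv G) l)"
  by (simp add: lp_grad_def pd_u_def pd_v_def)

lemmas pd_rules = pd_u_add pd_u_diff pd_u_mult pd_v_add pd_v_diff pd_v_mult pderiv_add pderiv_diff pderiv_mult pd_basic

lemma lp_grad_line: "lp_grad (lp_line f) l = (complex_of_real (Re f), complex_of_real (Im f), 1)"
  by (simp add: lp_grad_alt lp_line_def pd_rules)

lemma pd_line: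
  "pd_u (lp_line f) = lp_const (complex_of_real (Re f))"
  "pd_v (lp_line f) = lp_const (complex_of_real (Im f))"
  "pderiv (lp_line f) = 1"
  by (simp_all add: lp_line_def pd_rules)

lemma pd_quad:
  "lp_eval (pd_u (lp_quad F k)) (u, v, w) = complex_of_real (k + Re F) * u + complex_of_real (Im F) * v"
  "lp_eval (pd_v (lp_quad F k)) (u, v, w) = complex_of_real (Im F) * u + complex_of_real (k - Re F) * v"
  "pderiv (lp_quad F k) = 0"
  by (simp_all add: lp_quad_def pd_rules power2_eq_square)

lemma lp_eval_line: "lp_eval (lp_line f) (u, v, w) = w + complex_of_real (Re f) * u + complex_of_real (Im f) * v"
  by (simp add: lp_line_def)

lemma lp_eval_quad: "lp_eval (lp_quad F k) (u, v, w) =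
   complex_of_real ((k + Re F) / 2) * u\<^sup>2 + complex_of_real (Im F) * u * v + complex_of_real ((k - Re F) / 2) * v\<^sup>2"
  by (simp add: lp_quad_def)

lemma lp_grad_conic:
  fixes u v w c F k
  defines "w' \<equiv> lp_eval (lp_line c) (u, v, w)"
  shows "lp_grad (lp_conic c F k) (u, v, w) =
     (2 * complex_of_real (Re c) * w' - (complex_of_real (k + Re F) * u + complex_of_real (Im F) * v),
      2 * complex_of_real (Im c) * w' - (complex_of_real (Im F) * u + complex_of_real (k - Re F) * v), 2 * w')"
  by (simp add: lp_grad_alt lp_conic_def pd_u_diff pd_v_diff pderiv_diff pd_u_mult pd_v_mult pderiv_mult
      power2_eq_square pd_line pd_quad w'_def)

lemma lp_unit_iff: "(e :: line_poly) dvd 1 \<longleftrightarrow> (\<exists>a. a \<noteq> 0 \<and> e = lp_const a)"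
proof
  assume "e dvd 1"
  then obtain d where d: "e = [:d:]" "d dvd 1" by (metis is_unit_poly_iff)
  then obtain d' where d': "d = [:d':]" "d' dvd 1" by (metis is_unit_poly_iff)
  then obtain a where a: "d' = [:a:]" "a dvd 1" by (metis is_unit_poly_iff)
  then have "a \<noteq> 0" by auto
  then show "\<exists>a. a \<noteq> 0 \<and> e = lp_const a" by (auto simp: lp_const_def d(1) d'(1) a(1))
next
  assume "\<exists>a. a \<noteq> 0 \<and> e = lp_const a"
  then show "e dvd 1" by (auto simp: lp_const_def is_unit_const_poly_iff dvd_field_iff)
qed

text \<open>Multiplying $G$ by a constant rescales its gradient, which the cone over the envelope absorbs.\<close>
lemma envelope_real_part_const_mult:
  assumes "a \<noteq> 0"
  shows "envelope_real_part (lp_const a * G) = envelope_real_part G"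
proof -
  have ev: "lp_eval (lp_const a * G) l = 0 \<longleftrightarrow> lp_eval G l = 0" for l using assms by simp
  have gr: "lp_grad (lp_const a * G) l = (a * p, a * q, a * s) \<longleftrightarrow> lp_grad G l = (p, q, s)" for l p q s
    using assms by (auto simp: lp_grad_alt pd_rules)
  have "{(c * p, c * q, c * s) | c p q s. \<exists>l. lp_eval (lp_const a * G) l = 0 \<and> lp_grad (lp_const a * G) l = (p, q, s)}
      = {(c * p, c * q, c * s) | c p q s. \<exists>l. lp_eval G l = 0 \<and> lp_grad G l = (p, q, s)}" (is "?L = ?R")
  proof (intro equalityI subsetI)
    fix t assume "t \<in> ?L"
    then obtain c p q s l where t: "t = (c * p, c * q, c * s)" and l: "lp_eval (lp_const a * G) l = 0"
      "lp_grad (lp_const a * G) l = (p, q, s)" by blast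
    have "lp_grad G l = (p / a, q / a, s / a)" using gr[of l "p / a" "q / a" "s / a"] l assms by simp
    moreover have "t = ((c * a) * (p / a), (c * a) * (q / a), (c * a) * (s / a))" using t assms by simp
    ultimately show "t \<in> ?R" using l(1) ev by blast
  next
    fix t assume "t \<in> ?R"
    then obtain c p q s l where t: "t = (c * p, c * q, c * s)" and l: "lp_eval G l = 0"
      "lp_grad G l = (p, q, s)" by blast
    have "lp_grad (lp_const a * G) l = (a * p, a * q, a * s)" using gr l by blast
    moreover have "t = ((c / a) * (a * p), (c / a) * (a * q), (c / a) * (a * s))" using t assms by simp
    ultimately show "t \<in> ?L" using l(1) ev by blast
  qed
  then show ?thesis by (simp add: envelope_real_part_def)
qed

definition lp_components :: "line_poly \<Rightarrow> complex set set" where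
  "lp_components P = {envelope_real_part G | G. irreducible G \<and> G dvd P}"

lemma lp_components_irreducible:
  assumes "irreducible P" shows "lp_components P = {envelope_real_part P}"
proof -
  have "envelope_real_part G = envelope_real_part P" if G: "irreducible G" "G dvd P" for G
  proof -
    from G(2) obtain e where e: "P = G * e" by (auto elim: dvdE)
    have "e dvd 1" using irreducibleD[OF assms e] G(1) by (auto simp: irreducible_def)
    then obtain a where "a \<noteq> 0" "e = lp_const a" by (auto simp: lp_unit_iff)
    then show ?thesis using envelope_real_part_const_mult[of a G] by (simp add: e mult.commute)
  qed
  then have "lp_components P \<subseteq> {envelope_real_part P}" unfolding lp_components_def by blast
  moreover have "envelope_real_part P \<in> lp_components P"
    unfolding lp_components_def mem_Collect_eq by (intro exI[of _ P] conjI refl assms dvd_refl)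
  ultimately show ?thesis by (intro subset_antisym) simp_all
qed

text \<open>Unique factorization in $\<complex>[u][v][w]$: irreducible polynomials are prime.\<close>
lemma lp_components_mult: "lp_components (P * Q) = lp_components P \<union> lp_components Q"
proof -
  have "G dvd P * Q \<longleftrightarrow> G dvd P \<or> G dvd Q" if "irreducible G" for G :: line_poly
    using irreducible_imp_prime_elem[OF that] by (rule prime_elem_dvd_mult_iff)
  then show ?thesis unfolding lp_components_def by blast
qed

lemma lp_components_1: "lp_components 1 = {}"
  by (auto simp: lp_components_def irreducible_def)

lemma lp_components_power: "lp_components (P ^ e) = (if e = 0 then {} else lp_components P)"
  by (induction e) (auto simp: lp_components_1 lp_components_mult)

lemma lp_components_prod: "finite A \<Longrightarrow> lp_components (prod P A) = (\<Union>j\<in>A. lp_components (P j))"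
  by (induction A rule: finite_induct) (auto simp: lp_components_1 lp_components_mult)

lemma lp_line_alt: "lp_line f = [:[:[:0, complex_of_real (Re f):], [:complex_of_real (Im f):]:], 1:]"
  by (simp add: lp_line_def lp_w_def lp_const_def lp_u_def lp_v_def)

lemma unit_of_lead_coeff:
  fixes a :: "'a :: idom poly"
  assumes "degree a = 0" "lead_coeff a * y = 1"
  shows "a dvd 1"
proof -
  obtain e where e: "a = [:e:]" using assms(1) by (rule degree_eq_zeroE)
  then have "e dvd 1" using assms(2) by (metis degree_pCons_0 dvd_triv_left coeff_pCons_0)
  then show ?thesis by (simp add: e is_unit_const_poly_iff)
qed

lemma irreducible_lp_line: "irreducible (lp_line f)"
proof (rule irreducibleI)
  show "lp_line f \<noteq> 0" "\<not> lp_line f dvd 1"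
    by (auto simp: lp_line_alt is_unit_poly_iff)
  fix a b assume ab: "lp_line f = a * b"
  have nz: "a \<noteq> 0" "b \<noteq> 0" using ab by (auto simp: lp_line_alt)
  have "degree a + degree b = 1" using arg_cong[OF ab, of degree] nz by (simp add: degree_mult_eq lp_line_alt)
  moreover have "lead_coeff a * lead_coeff b = 1"
    using arg_cong[OF ab, of lead_coeff] unfolding lead_coeff_mult by (simp add: lp_line_alt)
  ultimately show "a dvd 1 \<or> b dvd 1"
    using unit_of_lead_coeff[of a "lead_coeff b"] unit_of_lead_coeff[of b "lead_coeff a"]
    by (auto simp: add_is_1 mult.commute)
qed

text \<open>The gradient of a pencil is constant, and the cone over a point is closed.\<close>
lemma envelope_lp_line: "envelope_real_part (lp_line f) = {f}"
proof -
  define S where "S = {(c * p, c * q, c * s) | c p q s. \<exists>l. lp_eval (lp_line f) l = 0 \<and> lp_grad (lp_line f) l = (p, q, s)}"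
  define T where "T = {t :: complex \<times> complex \<times> complex. fst t = snd (snd t) * complex_of_real (Re f)
      \<and> fst (snd t) = snd (snd t) * complex_of_real (Im f)}"
  have "closed T" unfolding T_def by (intro closed_Collect_conj closed_Collect_eq continuous_intros)
  moreover have "S \<subseteq> T" by (auto simp: S_def T_def lp_grad_line)
  ultimately have ST: "closure S \<subseteq> T" by (simp add: closure_minimal)
  have "lp_eval (lp_line f) (0, 0, 0) = 0" by (simp add: lp_eval_line)
  moreover have "lp_grad (lp_line f) (0, 0, 0) = (complex_of_real (Re f), complex_of_real (Im f), 1)" by (rule lp_grad_line)
  ultimately have "(1 * complex_of_real (Re f), 1 * complex_of_real (Im f), 1 * 1) \<in> S" unfolding S_def by blast
  then have mem: "(complex_of_real (Re f), complex_of_real (Im f), 1) \<in> closure S"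
    using closure_subset[of S] by auto
  have "(complex_of_real x, complex_of_real y, 1) \<in> closure S \<longleftrightarrow> x = Re f \<and> y = Im f" for x y
    using ST mem by (auto simp: T_def)
  then have "envelope_real_part (lp_line f) = {Complex x y | x y. x = Re f \<and> y = Im f}"
    unfolding envelope_real_part_def S_def by simp
  then show ?thesis by simp
qed

lemma lp_conic_alt:
  "lp_conic c F k = (lp_line c)\<^sup>2 - [:[:[:0, 0, complex_of_real ((k + Re F) / 2):], [:0, complex_of_real (Im F):],
      [:complex_of_real ((k - Re F) / 2):]:]:]"
  unfolding lp_conic_def lp_quad_def by (simp add: lp_const_def lp_u_def lp_v_def power2_eq_square)

text \<open>At a root of $p$ the derivative of $p^2$ vanishes as well, so the quadratic polynomial has a double root.\<close>
lemma binary_form_not_square: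
  fixes p :: "complex poly"
  assumes "p\<^sup>2 = [:d, 2 * b, a:]" shows "a * d = b\<^sup>2"
proof (rule ccontr)
  assume n: "a * d \<noteq> b\<^sup>2"
  have der: "2 * poly p x * poly (pderiv p) x = 2 * b + 2 * a * x" for x
    using arg_cong[OF assms, of "\<lambda>q. poly (pderiv q) x"] by (simp add: power2_eq_square pderiv_mult pderiv_pCons algebra_simps)
  have val: "(poly p x)\<^sup>2 = d + 2 * b * x + a * x\<^sup>2" for x
    using arg_cong[OF assms, of "\<lambda>q. poly q x"] by (simp add: power2_eq_square algebra_simps)
  show False
  proof (cases "a = 0")
    case True
    then have b: "b \<noteq> 0" using n by auto
    then have "poly p (- d / (2 * b)) = 0" using val[of "- d / (2 * b)"] True by simp
    then show False using der[of "- d / (2 * b)"] b True by simp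
  next
    case False
    define x where "x = (- b + csqrt (b\<^sup>2 - a * d)) / a"
    have ax: "a * x = - b + csqrt (b\<^sup>2 - a * d)" using False by (simp add: x_def)
    have "a * (d + 2 * b * x + a * x\<^sup>2) = (a * x + b)\<^sup>2 - (b\<^sup>2 - a * d)" by (simp add: power2_eq_square algebra_simps)
    also have "\<dots> = 0" by (simp add: ax)
    finally have "poly p x = 0" using val[of x] False by simp
    then have "2 * (b + a * x) = 0" using der[of x] by (simp add: algebra_simps)
    then have "b + a * x = 0" by (simp only: mult_eq_0_iff) simp
    then show False using ax n by simp
  qed
qed

lemma expand_monic_square:
  fixes p q :: "'a :: idom"
  shows "[:p, 1:]\<^sup>2 - [:q:] = [:p\<^sup>2 - q, 2 * p, 1:]"
  unfolding power2_eq_square mult_2 by simp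

lemma monic_quadratic:
  fixes p q :: "'a :: idom"
  shows "degree [:p, q, 1:] = 2" "lead_coeff [:p, q, 1:] = 1"
  by simp_all

text \<open>The polynomial is monic and quadratic in $w$, so a proper factorization yields a root in $\<complex>[u][v]$. Then the binary
form \<open>lp_quad F k\<close> is a square, which for $v = 1$ contradicts its discriminant $|F|^2 - k^2$ being different from $0$.\<close>
lemma irreducible_lp_conic:
  assumes "cmod F \<noteq> \<bar>k\<bar>"
  shows "irreducible (lp_conic c F k)"
proof (rule irreducibleI)
  define L where "L = [:[:0, complex_of_real (Re c):], [:complex_of_real (Im c):]:]"
  define Q where "Q = [:[:0, 0, complex_of_real ((k + Re F) / 2):], [:0, complex_of_real (Im F):],
      [:complex_of_real ((k - Re F) / 2):]:]"
  have G: "lp_conic c F k = [:L\<^sup>2 - Q, 2 * L, 1:]"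
    unfolding lp_conic_alt Q_def[symmetric] lp_line_alt L_def[symmetric] by (rule expand_monic_square)
  have deg: "degree (lp_conic c F k) = 2" "lead_coeff (lp_conic c F k) = 1"
    unfolding G using monic_quadratic by auto
  show "lp_conic c F k \<noteq> 0" using deg by auto
  show "\<not> lp_conic c F k dvd 1" using deg(1) by (auto simp: is_unit_poly_iff)
  fix a b assume ab: "lp_conic c F k = a * b"
  have nz: "a \<noteq> 0" "b \<noteq> 0" using ab deg by auto
  have d: "degree a + degree b = 2" using arg_cong[OF ab, of degree] nz by (simp add: degree_mult_eq deg)
  have l: "lead_coeff a * lead_coeff b = 1"
    using deg(2) unfolding ab lead_coeff_mult .
  have "degree a \<noteq> 1"
  proof
    assume da: "degree a = 1"
    then obtain a0 a1 where a: "a = [:a0, a1:]" by (metis degree1_coeffs)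
    have u: "a1 * lead_coeff b = 1" using l da by (simp add: a)
    define e where "e = - a0 * lead_coeff b"
    have "poly a e = a0 * (1 - a1 * lead_coeff b)" by (simp add: a e_def algebra_simps)
    then have "poly (lp_conic c F k) e = 0" by (simp add: u ab)
    then have "(e + L)\<^sup>2 = Q" by (simp add: G power2_eq_square algebra_simps)
    then have "(poly (e + L) [:1:])\<^sup>2 = poly Q [:1:]" by (metis poly_power)
    also have "\<dots> = [:complex_of_real ((k - Re F) / 2), 2 * complex_of_real (Im F / 2), complex_of_real ((k + Re F) / 2):]"
      by (simp add: Q_def)
    finally have "complex_of_real ((k + Re F) / 2) * complex_of_real ((k - Re F) / 2) = (complex_of_real (Im F / 2))\<^sup>2"
      by (rule binary_form_not_square)
    then have "(k + Re F) / 2 * ((k - Re F) / 2) = (Im F / 2)\<^sup>2"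
      by (metis of_real_eq_iff of_real_mult of_real_power)
    then have "k\<^sup>2 = (cmod F)\<^sup>2" unfolding cmod_power2 by (simp add: power2_eq_square field_simps)
    then show False using assms by (metis abs_norm_cancel power2_eq_iff_nonneg abs_ge_zero power2_abs norm_ge_zero)
  qed
  then have "degree a = 0 \<or> degree b = 0" using d by linarith
  then show "a dvd 1 \<or> b dvd 1"
    using unit_of_lead_coeff[of a "lead_coeff b"] unit_of_lead_coeff[of b "lead_coeff a"] l
    by (auto simp: mult.commute)
qed

text \<open>The gradients at zeros of the polynomial satisfy the point equation of the conic. This is a closed condition,
hence it passes to the closure, and at a real point with last coordinate $1$ it can be solved for a real tangent by
inverting \<open>polar\<close>.\<close>
lemma envelope_lp_conic:
  assumes ne: "(cmod F)\<^sup>2 \<noteq> k\<^sup>2"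
  shows "envelope_real_part (lp_conic c F k) = {c + polar F k g | g. line_form F k g = 1/4}"
proof -
  define G where "G = lp_conic c F k"
  define S where "S = {(c * p, c * q, c * s) | c p q s. \<exists>l. lp_eval G l = 0 \<and> lp_grad G l = (p, q, s)}"
  define A B D where ABD: "A = complex_of_real (k + Re F)" "B = complex_of_real (Im F)" "D = complex_of_real (k - Re F)"
  define c1 c2 where c12: "c1 = complex_of_real (Re c)" "c2 = complex_of_real (Im c)"
  define T where "T = {t. 2 * (D * (fst t - snd (snd t) * c1)\<^sup>2
       - 2 * B * (fst t - snd (snd t) * c1) * (fst (snd t) - snd (snd t) * c2)
       + A * (fst (snd t) - snd (snd t) * c2)\<^sup>2) = (A * D - B\<^sup>2) * (snd (snd t))\<^sup>2}"
  have "closed T" unfolding T_def by (intro closed_Collect_eq continuous_intros)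
  moreover have "S \<subseteq> T"
  proof
    fix t assume "t \<in> S"
    then obtain a p q s u v w where t: "t = (a * p, a * q, a * s)" and l: "lp_eval G (u, v, w) = 0"
      "lp_grad G (u, v, w) = (p, q, s)" unfolding S_def by auto
    define w' where "w' = lp_eval (lp_line c) (u, v, w)"
    have pqs: "p = 2 * c1 * w' - (A * u + B * v)" "q = 2 * c2 * w' - (B * u + D * v)" "s = 2 * w'"
      using l(2) unfolding G_def lp_grad_conic by (auto simp: ABD c12 w'_def)
    have "lp_eval G (u, v, w) = w'\<^sup>2 - lp_eval (lp_quad F k) (u, v, w)"
      by (simp add: G_def lp_conic_def w'_def)
    then have "w'\<^sup>2 = lp_eval (lp_quad F k) (u, v, w)" using l(1) by simp
    then have w2: "2 * w'\<^sup>2 = A * u\<^sup>2 + 2 * B * u * v + D * v\<^sup>2"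
      by (simp add: lp_eval_quad ABD field_simps)
    have X: "a * p - a * s * c1 = - a * (A * u + B * v)" "a * q - a * s * c2 = - a * (B * u + D * v)"
      by (simp_all add: pqs algebra_simps)
    have "2 * (D * (- a * (A * u + B * v))\<^sup>2 - 2 * B * (- a * (A * u + B * v)) * (- a * (B * u + D * v))
       + A * (- a * (B * u + D * v))\<^sup>2) = (A * D - B\<^sup>2) * (2 * (A * u\<^sup>2 + 2 * B * u * v + D * v\<^sup>2)) * a\<^sup>2"
      by (simp add: power2_eq_square algebra_simps)
    also have "\<dots> = (A * D - B\<^sup>2) * (a * s)\<^sup>2"
      unfolding w2[symmetric] by (simp add: pqs power2_eq_square algebra_simps)
    finally show "t \<in> T" unfolding T_def mem_Collect_eq t fst_conv snd_conv X .
  qed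
  ultimately have ST: "closure S \<subseteq> T" by (simp add: closure_minimal)
  have "(complex_of_real x, complex_of_real y, 1) \<in> closure S \<longleftrightarrow> (\<exists>g. line_form F k g = 1/4 \<and> Complex x y = c + polar F k g)"
    (is "?L \<longleftrightarrow> ?R") for x y
  proof
    assume ?L
    then have tT: "(complex_of_real x, complex_of_real y, 1) \<in> T" using ST by blast
    define X Y where XY: "X = x - Re c" "Y = y - Im c"
    have "complex_of_real (2 * ((k - Re F) * X\<^sup>2 - 2 * Im F * X * Y + (k + Re F) * Y\<^sup>2))
       = complex_of_real ((k + Re F) * (k - Re F) - (Im F)\<^sup>2)"
      using tT unfolding T_def ABD c12 XY by simp
    then have e: "2 * ((k - Re F) * X\<^sup>2 - 2 * Im F * X * Y + (k + Re F) * Y\<^sup>2) = (k + Re F) * (k - Re F) - (Im F)\<^sup>2"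
      by (simp only: of_real_eq_iff)
    have "2 * point_form F k (Complex X Y) = (cmod F)\<^sup>2 - k\<^sup>2"
      using e unfolding point_form_def cmod_power2 by (simp add: power2_eq_square algebra_simps)
    moreover obtain g where g: "polar F k g = Complex X Y" using polar_inverse[OF ne] by blast
    ultimately have "2 * (2 * ((cmod F)\<^sup>2 - k\<^sup>2) * line_form F k g) = (cmod F)\<^sup>2 - k\<^sup>2"
      using point_form_polar[of F k g] by simp
    then have "((cmod F)\<^sup>2 - k\<^sup>2) * (4 * line_form F k g) = ((cmod F)\<^sup>2 - k\<^sup>2) * 1" by (simp only: mult_ac) simp
    then have "line_form F k g = 1/4" using ne by simp
    then show ?R using g by (intro exI[of _ g]) (simp add: XY complex_eq_iff)
  next
    assume ?R
    then obtain g where g: "line_form F k g = 1/4" "Complex x y = c + polar F k g" by blast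
    define u v where uv: "u = Re g" "v = - Im g"
    \<comment> \<open>The line is normalized so that the gradient has the last coordinate $-1$.\<close>
    define w where "w = - 1 / 2 - c1 * u - c2 * v"
    have w': "lp_eval (lp_line c) (complex_of_real u, complex_of_real v, w) = - 1 / 2" by (simp add: lp_eval_line w_def c12)
    have q: "(k + Re F) / 2 * u\<^sup>2 + Im F * u * v + (k - Re F) / 2 * v\<^sup>2 = line_form F k g"
      unfolding line_form_def cmod_power2 uv by (simp add: power2_eq_square field_simps)
    have "lp_eval (lp_quad F k) (complex_of_real u, complex_of_real v, w) = complex_of_real ((k + Re F) / 2 * u\<^sup>2 + Im F * u * v + (k - Re F) / 2 * v\<^sup>2)"
      by (simp only: lp_eval_quad of_real_add of_real_mult of_real_power)
    then have "lp_eval (lp_quad F k) (complex_of_real u, complex_of_real v, w) = 1 / 4" unfolding q g(1) by simp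
    then have "lp_eval G (complex_of_real u, complex_of_real v, w) = 0" by (simp add: G_def lp_conic_def w' power2_eq_square)
    moreover have "lp_grad G (complex_of_real u, complex_of_real v, w) = (- complex_of_real x, - complex_of_real y, - 1)"
      using g(2) unfolding G_def lp_grad_conic w' by (auto simp: polar_def uv complex_eq_iff algebra_simps)
    ultimately have "((-1) * - complex_of_real x, (-1) * - complex_of_real y, (-1) * - 1) \<in> S"
      unfolding S_def by blast
    then show ?L using closure_subset[of S] by auto
  qed
  then have "envelope_real_part (lp_conic c F k)
     = {Complex x y | x y. \<exists>g. line_form F k g = 1/4 \<and> Complex x y = c + polar F k g}"
    unfolding envelope_real_part_def S_def G_def by simp
  also have "\<dots> = {c + polar F k g | g. line_form F k g = 1/4}"
    by (auto intro: complex.collapse[symmetric]) (metis complex.collapse)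
  finally show ?thesis .
qed

lemma lp_const_hom:
  "lp_const (a + b) = lp_const a + lp_const b" "lp_const (a * b) = lp_const a * lp_const b"
  "lp_const 1 = 1" "lp_const 0 = 0" "lp_const (- a) = - lp_const a" "lp_const (a - b) = lp_const a - lp_const b"
  by (simp_all add: lp_const_def one_pCons)

lemma lp_line_add: "lp_line (c + \<phi>) = lp_line c + (lp_const (complex_of_real (Re \<phi>)) * lp_u + lp_const (complex_of_real (Im \<phi>)) * lp_v)"
   "lp_line (c - \<phi>) = lp_line c - (lp_const (complex_of_real (Re \<phi>)) * lp_u + lp_const (complex_of_real (Im \<phi>)) * lp_v)"
  by (simp_all add: lp_line_def lp_const_hom algebra_simps)

text \<open>For $k = |F|$ the form \<open>line_form F k\<close> is the square of the linear form $\<Re>(\<phi> g)$.\<close>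
lemma lp_conic_degenerate:
  "lp_conic c (\<phi>\<^sup>2) (cmod (\<phi>\<^sup>2)) = lp_line (c + \<phi>) * lp_line (c - \<phi>)"
proof -
  have n: "cmod (\<phi>\<^sup>2) = (Re \<phi>)\<^sup>2 + (Im \<phi>)\<^sup>2" by (simp add: norm_power cmod_power2)
  have r: "(cmod (\<phi>\<^sup>2) + Re (\<phi>\<^sup>2)) / 2 = Re \<phi> * Re \<phi>" "Im (\<phi>\<^sup>2) = Re \<phi> * Im \<phi> + Re \<phi> * Im \<phi>"
    "(cmod (\<phi>\<^sup>2) - Re (\<phi>\<^sup>2)) / 2 = Im \<phi> * Im \<phi>"
    unfolding n by (simp_all add: power2_eq_square)
  have q: "lp_quad (\<phi>\<^sup>2) (cmod (\<phi>\<^sup>2)) = (lp_const (complex_of_real (Re \<phi>)) * lp_u + lp_const (complex_of_real (Im \<phi>)) * lp_v)\<^sup>2"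
    unfolding lp_quad_def r unfolding of_real_add of_real_mult lp_const_hom power2_eq_square by (simp only: algebra_simps)
  show ?thesis unfolding lp_conic_def q lp_line_add by (simp add: power2_eq_square algebra_simps)
qed

lemma lp_components_conic:
  assumes N: "0 < cmod (\<phi>\<^sup>2) + k" and M: "k \<le> cmod (\<phi>\<^sup>2)"
  shows "lp_components (lp_conic c (\<phi>\<^sup>2) k)
    = hyperbola_components (c + \<phi>) (c - \<phi>) (sqrt (2 * (cmod (\<phi>\<^sup>2) + k))) (sqrt (2 * (cmod (\<phi>\<^sup>2) - k)))"
proof (cases "k = cmod (\<phi>\<^sup>2)")
  case True
  then show ?thesis unfolding True lp_conic_degenerate lp_components_mult
      lp_components_irreducible[OF irreducible_lp_line] envelope_lp_line
    by (auto simp: hyperbola_components_def)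
next
  case False
  then have kl: "k < cmod (\<phi>\<^sup>2)" using M by simp
  then have "cmod (\<phi>\<^sup>2) \<noteq> \<bar>k\<bar>" using N by linarith
  then have irr: "irreducible (lp_conic c (\<phi>\<^sup>2) k)" by (rule irreducible_lp_conic)
  have "0 < (cmod (\<phi>\<^sup>2) + k) * (cmod (\<phi>\<^sup>2) - k)" using kl N by simp
  then have ne: "(cmod (\<phi>\<^sup>2))\<^sup>2 \<noteq> k\<^sup>2" by (simp add: power2_eq_square algebra_simps)
  define H where "H = hyperbola_components (c + \<phi>) (c - \<phi>) (sqrt (2 * (cmod (\<phi>\<^sup>2) + k))) (sqrt (2 * (cmod (\<phi>\<^sup>2) - k)))"
  have "H = {hyperbola (c + \<phi>) (c - \<phi>) (sqrt (2 * (cmod (\<phi>\<^sup>2) + k))) (sqrt (2 * (cmod (\<phi>\<^sup>2) - k)))}"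
    using kl by (simp add: H_def hyperbola_def hyperbola_components_def)
  also have "hyperbola (c + \<phi>) (c - \<phi>) (sqrt (2 * (cmod (\<phi>\<^sup>2) + k))) (sqrt (2 * (cmod (\<phi>\<^sup>2) - k)))
     = {c + polar (\<phi>\<^sup>2) k g | g. line_form (\<phi>\<^sup>2) k g = 1/4}"
    using hyperbola_iff_polar[OF N M] by blast
  finally show ?thesis
    unfolding lp_components_irreducible[OF irr] envelope_lp_conic[OF ne] H_def[symmetric] by simp
qed

section \<open>Factorization of the Kippenhahn polynomial\<close>

lemma index_mat_adjoint [simp]:
  fixes A :: "complex mat"
  shows "i < dim_col A \<Longrightarrow> j < dim_row A \<Longrightarrow> mat_adjoint A $$ (i, j) = cnj (A $$ (j, i))"
    "dim_row (mat_adjoint A) = dim_col A" "dim_col (mat_adjoint A) = dim_row A"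
  by (auto simp: mat_adjoint_def mat_of_rows_def)

lemma mat_adjoint_carrier [simp]:
  fixes A :: "complex mat"
  shows "A \<in> carrier_mat p q \<Longrightarrow> mat_adjoint A \<in> carrier_mat q p"
  by (auto intro: carrier_matI)

lemma mat_adjoint_adjoint: "mat_adjoint (mat_adjoint A) = (A :: complex mat)"
  by (rule eq_matI) auto

lemma mat_adjoint_mult:
  fixes A B :: "complex mat"
  assumes "A \<in> carrier_mat p q" "B \<in> carrier_mat q s"
  shows "mat_adjoint (A * B) = mat_adjoint B * mat_adjoint A"
  using assms by (intro eq_matI) (auto simp: scalar_prod_def mult.commute)

lemma mat_adjoint_four_block:
  fixes A B C D :: "complex mat"
  assumes "A \<in> carrier_mat p p'" "B \<in> carrier_mat p q'" "C \<in> carrier_mat q p'" "D \<in> carrier_mat q q'"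
  shows "mat_adjoint (four_block_mat A B C D)
    = four_block_mat (mat_adjoint A) (mat_adjoint C) (mat_adjoint B) (mat_adjoint D)"
  using assms by (intro eq_matI) auto

text \<open>Right multiplication by the block triangular matrix with rows $(I, -X)$ and $(0, P I)$ clears the upper right
block; the power of $P$ that this introduces is cancelled afterwards.\<close>
lemma det_scalar_block:
  fixes P Q :: "'a :: idom"
  assumes X: "X \<in> carrier_mat p m" and Y: "Y \<in> carrier_mat m p" and P: "P \<noteq> 0" and mp: "m \<le> p"
  shows "Determinant.det (four_block_mat (P \<cdot>\<^sub>m 1\<^sub>m p) X Y (Q \<cdot>\<^sub>m 1\<^sub>m m))
    = P ^ (p - m) * Determinant.det ((P * Q) \<cdot>\<^sub>m 1\<^sub>m m - Y * X)"
proof -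
  let ?K = "four_block_mat (P \<cdot>\<^sub>m 1\<^sub>m p) X Y (Q \<cdot>\<^sub>m 1\<^sub>m m)"
  let ?E = "four_block_mat (1\<^sub>m p) (- X) (0\<^sub>m m p) (P \<cdot>\<^sub>m 1\<^sub>m m)"
  have "?K * ?E = four_block_mat (P \<cdot>\<^sub>m 1\<^sub>m p * 1\<^sub>m p + X * 0\<^sub>m m p) (P \<cdot>\<^sub>m 1\<^sub>m p * (- X) + X * (P \<cdot>\<^sub>m 1\<^sub>m m))
      (Y * 1\<^sub>m p + Q \<cdot>\<^sub>m 1\<^sub>m m * 0\<^sub>m m p) (Y * (- X) + Q \<cdot>\<^sub>m 1\<^sub>m m * (P \<cdot>\<^sub>m 1\<^sub>m m))"
    by (rule mult_four_block_mat) (use X Y in auto)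
  also have "P \<cdot>\<^sub>m 1\<^sub>m p * 1\<^sub>m p + X * 0\<^sub>m m p = P \<cdot>\<^sub>m 1\<^sub>m p" using X by auto
  also have "P \<cdot>\<^sub>m 1\<^sub>m p * (- X) + X * (P \<cdot>\<^sub>m 1\<^sub>m m) = 0\<^sub>m p m"
  proof -
    have "P \<cdot>\<^sub>m 1\<^sub>m p * (- X) = P \<cdot>\<^sub>m (- X)" using X
      by (metis left_mult_one_mat mult_smult_assoc_mat one_carrier_mat uminus_carrier_iff_mat)
    moreover have "X * (P \<cdot>\<^sub>m 1\<^sub>m m) = P \<cdot>\<^sub>m X" using X
      by (metis mult_smult_distrib one_carrier_mat right_mult_one_mat)
    ultimately show ?thesis using X by (auto intro!: eq_matI)
  qed
  also have "Y * 1\<^sub>m p + Q \<cdot>\<^sub>m 1\<^sub>m m * 0\<^sub>m m p = Y" using Y by auto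
  also have "Y * (- X) + Q \<cdot>\<^sub>m 1\<^sub>m m * (P \<cdot>\<^sub>m 1\<^sub>m m) = (P * Q) \<cdot>\<^sub>m 1\<^sub>m m - Y * X"
  proof -
    have "Q \<cdot>\<^sub>m 1\<^sub>m m * (P \<cdot>\<^sub>m 1\<^sub>m m) = (P * Q) \<cdot>\<^sub>m 1\<^sub>m m"
      by (subst mult_smult_distrib[of _ m m _ m]) (auto intro!: eq_matI)
    moreover have "Y * (- X) = - (Y * X)" using X Y by simp
    ultimately show ?thesis using X Y by (auto intro!: eq_matI)
  qed
  finally have "Determinant.det (?K * ?E) = Determinant.det (four_block_mat (P \<cdot>\<^sub>m 1\<^sub>m p) (0\<^sub>m p m) Y ((P * Q) \<cdot>\<^sub>m 1\<^sub>m m - Y * X))"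
    by simp
  also have "\<dots> = P ^ p * Determinant.det ((P * Q) \<cdot>\<^sub>m 1\<^sub>m m - Y * X)"
    using X Y by (subst det_four_block_mat_upper_right_zero[of _ p _ m]) auto
  finally have 1: "Determinant.det (?K * ?E) = P ^ p * Determinant.det ((P * Q) \<cdot>\<^sub>m 1\<^sub>m m - Y * X)" .
  have "Determinant.det (?K * ?E) = Determinant.det ?K * Determinant.det ?E"
    by (rule det_mult[of _ "p + m"]) (use X Y in auto)
  also have "Determinant.det ?E = P ^ m"
    using X by (subst det_four_block_mat_lower_left_zero[of _ p _ m]) auto
  finally have "Determinant.det ?K * P ^ m = P ^ m * (P ^ (p - m) * Determinant.det ((P * Q) \<cdot>\<^sub>m 1\<^sub>m m - Y * X))"
    using 1 mp by (simp add: mult.assoc[symmetric] power_add[symmetric])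
  then show ?thesis using P by (simp add: mult.commute[of _ "P ^ m"])
qed

interpretation lp_const: comm_ring_hom lp_const
  by unfold_locales (simp_all add: lp_const_hom)

lemma J_adjoint_block:
  assumes r: "r < n" and C: "C \<in> carrier_mat r (n - r)" and D: "D \<in> carrier_mat (n - r) r"
    and A: "A = four_block_mat (\<alpha> \<cdot>\<^sub>m 1\<^sub>m r) C D (\<beta> \<cdot>\<^sub>m 1\<^sub>m (n - r))"
  shows "J_adjoint n r A = four_block_mat (cnj \<alpha> \<cdot>\<^sub>m 1\<^sub>m r) (- mat_adjoint D) (- mat_adjoint C) (cnj \<beta> \<cdot>\<^sub>m 1\<^sub>m (n - r))"
proof -
  define m where "m = n - r"
  have C': "C \<in> carrier_mat r m" and D': "D \<in> carrier_mat m r" using C D by (auto simp: m_def)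
  have sc: "mat_adjoint (a \<cdot>\<^sub>m 1\<^sub>m l) = cnj a \<cdot>\<^sub>m 1\<^sub>m l" for a :: complex and l
    by (intro eq_matI) auto
  have "mat_adjoint A = four_block_mat (cnj \<alpha> \<cdot>\<^sub>m 1\<^sub>m r) (mat_adjoint D) (mat_adjoint C) (cnj \<beta> \<cdot>\<^sub>m 1\<^sub>m m)"
    unfolding A m_def[symmetric] by (subst mat_adjoint_four_block[of _ r r _ m _ m]) (use C' D' in \<open>auto simp: sc\<close>)
  moreover have "J_mat n r * four_block_mat (cnj \<alpha> \<cdot>\<^sub>m 1\<^sub>m r) (mat_adjoint D) (mat_adjoint C) (cnj \<beta> \<cdot>\<^sub>m 1\<^sub>m m)
     = four_block_mat (cnj \<alpha> \<cdot>\<^sub>m 1\<^sub>m r) (mat_adjoint D) (- mat_adjoint C) (- (cnj \<beta> \<cdot>\<^sub>m 1\<^sub>m m))"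
    unfolding J_mat_def m_def[symmetric]
    by (subst mult_four_block_mat[of _ r r _ m _ m _ _ r _ m])
      (use C' D' in \<open>auto intro!: cong_four_block_mat simp: uminus_mult_left_mat[symmetric]\<close>)
  moreover have "four_block_mat (cnj \<alpha> \<cdot>\<^sub>m 1\<^sub>m r) (mat_adjoint D) (- mat_adjoint C) (- (cnj \<beta> \<cdot>\<^sub>m 1\<^sub>m m)) * J_mat n r
     = four_block_mat (cnj \<alpha> \<cdot>\<^sub>m 1\<^sub>m r) (- mat_adjoint D) (- mat_adjoint C) (cnj \<beta> \<cdot>\<^sub>m 1\<^sub>m m)"
    unfolding J_mat_def m_def[symmetric]
    by (subst mult_four_block_mat[of _ r r _ m _ m _ _ r _ m])
      (use C' D' in \<open>auto intro!: cong_four_block_mat simp: uminus_mult_right_mat[symmetric]\<close>)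
  ultimately show ?thesis by (simp add: J_adjoint_def m_def[symmetric])
qed

lemma det_unitary_conjugation:
  fixes K V W :: "'a :: comm_ring_1 mat"
  assumes K: "K \<in> carrier_mat m m" and V: "V \<in> carrier_mat m m" and W: "W \<in> carrier_mat m m"
    and WV: "W * V = 1\<^sub>m m"
  shows "Determinant.det (W * K * V) = Determinant.det K"
proof -
  have "Determinant.det (W * K * V) = Determinant.det W * Determinant.det K * Determinant.det V"
    using assms by (simp add: det_mult[of _ m])
  also have "\<dots> = Determinant.det (W * V) * Determinant.det K"
    using det_mult[OF W V] by (simp add: mult_ac)
  finally show ?thesis by (simp add: WV)
qed

text \<open>The ring homomorphism transports $U$ and its adjoint, so that they also conjugate matrices whose entries are
polynomials.\<close>
lemma diagonalize_linear_combination: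
  fixes U Z H Y :: "complex mat" and \<phi> :: "complex \<Rightarrow> 'a :: idom" and R a b d :: 'a
  assumes hom: "comm_ring_hom \<phi>"
    and U: "unitary_matrix m U"
    and car: "Z \<in> carrier_mat m m" "H \<in> carrier_mat m m" "Y \<in> carrier_mat m m"
    and Zd: "mat_adjoint U * Z * U = Matrix.mat m m (\<lambda>(i,j). if i = j then z i else 0)"
    and Hd: "mat_adjoint U * H * U = Matrix.mat m m (\<lambda>(i,j). if i = j then h i else 0)"
    and Yd: "mat_adjoint U * Y * U = Matrix.mat m m (\<lambda>(i,j). if i = j then y i else 0)"
  shows "Determinant.det (R \<cdot>\<^sub>m 1\<^sub>m m - (a \<cdot>\<^sub>m map_mat \<phi> Z + b \<cdot>\<^sub>m map_mat \<phi> H + d \<cdot>\<^sub>m map_mat \<phi> Y))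
    = (\<Prod>j<m. R - (a * \<phi> (z j) + b * \<phi> (h j) + d * \<phi> (y j)))"
proof -
  interpret comm_ring_hom \<phi> by (rule hom)
  define V W where VW: "V = map_mat \<phi> U" "W = map_mat \<phi> (mat_adjoint U)"
  have Uc: "U \<in> carrier_mat m m" using U by (simp add: unitary_matrix_def)
  have Vc: "V \<in> carrier_mat m m" "W \<in> carrier_mat m m" using Uc by (simp_all add: VW)
  have WV: "W * V = 1\<^sub>m m"
  proof -
    have "W * V = map_mat \<phi> (mat_adjoint U * U)"
      unfolding VW by (rule mat_hom_mult[symmetric]) (use Uc in auto)
    also have "\<dots> = 1\<^sub>m m" using U by (auto simp: unitary_matrix_def intro!: eq_matI)
    finally show ?thesis .
  qed
  define Z' H' Y' where d: "Z' = map_mat \<phi> Z" "H' = map_mat \<phi> H" "Y' = map_mat \<phi> Y"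
  have c: "Z' \<in> carrier_mat m m" "H' \<in> carrier_mat m m" "Y' \<in> carrier_mat m m" using car by (simp_all add: d)
  have conj: "W * map_mat \<phi> B * V = map_mat \<phi> (mat_adjoint U * B * U)" if "B \<in> carrier_mat m m" for B
  proof -
    have "map_mat \<phi> (mat_adjoint U * B * U) = map_mat \<phi> (mat_adjoint U * B) * V"
      unfolding VW by (rule mat_hom_mult) (use that Uc in auto)
    also have "map_mat \<phi> (mat_adjoint U * B) = W * map_mat \<phi> B"
      unfolding VW by (rule mat_hom_mult) (use that Uc in auto)
    finally show ?thesis by simp
  qed
  let ?K = "R \<cdot>\<^sub>m 1\<^sub>m m - (a \<cdot>\<^sub>m Z' + b \<cdot>\<^sub>m H' + d \<cdot>\<^sub>m Y')"
  have Kc: "?K \<in> carrier_mat m m" using c by auto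
  have s: "W * (e \<cdot>\<^sub>m B) * V = e \<cdot>\<^sub>m (W * B * V)" if "B \<in> carrier_mat m m" for e B
    using that Vc by (simp add: mult_smult_distrib[of _ m m _ m] mult_smult_assoc_mat[of _ m m _ m])
  have "W * ?K * V = W * (R \<cdot>\<^sub>m 1\<^sub>m m) * V - (W * (a \<cdot>\<^sub>m Z') * V + W * (b \<cdot>\<^sub>m H') * V + W * (d \<cdot>\<^sub>m Y') * V)"
    using c Vc by (simp add: mult_minus_distrib_mat[of _ m m _ m] minus_mult_distrib_mat[of _ m m _ _ m]
       mult_add_distrib_mat[of _ m m _ m] add_mult_distrib_mat[of _ m m _ _ m])
  also have "\<dots> = R \<cdot>\<^sub>m (W * 1\<^sub>m m * V) - (a \<cdot>\<^sub>m (W * Z' * V) + b \<cdot>\<^sub>m (W * H' * V) + d \<cdot>\<^sub>m (W * Y' * V))"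
    using c by (simp add: s)
  also have "\<dots> = Matrix.mat m m (\<lambda>(i,j). if i = j then R - (a * \<phi> (z i) + b * \<phi> (h i) + d * \<phi> (y i)) else 0)"
  proof -
    have "W * 1\<^sub>m m * V = 1\<^sub>m m" using Vc WV by simp
    then show ?thesis unfolding d conj[OF car(1)] conj[OF car(2)] conj[OF car(3)] Zd Hd Yd
      by (intro eq_matI) auto
  qed
  finally have e: "W * ?K * V = Matrix.mat m m (\<lambda>(i,j). if i = j then R - (a * \<phi> (z i) + b * \<phi> (h i) + d * \<phi> (y i)) else 0)"
    (is "_ = ?D") .
  have "Determinant.det ?K = Determinant.det ?D"
    using det_unitary_conjugation[OF Kc Vc WV] by (simp add: e)
  also have "\<dots> = prod_list (diag_mat ?D)"
    by (rule det_upper_triangular[of _ m]) auto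
  also have "\<dots> = (\<Prod>j<m. R - (a * \<phi> (z j) + b * \<phi> (h j) + d * \<phi> (y j)))"
    by (simp add: diag_mat_def prod.list_conv_set_nth atLeast0LessThan)
  finally show ?thesis unfolding d .
qed

text \<open>Here $s = (u - \<i> v)/2$ and $t = (u + \<i> v)/2$. With $\<alpha> = c + \<delta>$ and $\<beta> = c - \<delta>$ the product of the two pencils is the
square of the pencil through $c$ minus the square of a linear form given by $\<delta>$; the terms in $u^2$, $uv$ and $v^2$ add up to
\<open>lp_quad\<close>.\<close>
lemma line_product_conic:
  fixes \<alpha> \<beta> z :: complex and h :: real
  defines "s \<equiv> lp_const (1/2) * (lp_u - lp_const \<i> * lp_v)" and "t \<equiv> lp_const (1/2) * (lp_u + lp_const \<i> * lp_v)"
  shows "lp_line \<alpha> * lp_line \<beta> - (s\<^sup>2 * lp_const z + (- (s * t)) * lp_const (complex_of_real h) + t\<^sup>2 * lp_const (cnj z))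
    = lp_conic ((\<alpha> + \<beta>) / 2) (((\<alpha> - \<beta>) / 2)\<^sup>2 + z) ((cmod ((\<alpha> - \<beta>) / 2))\<^sup>2 - h / 2)"
proof -
  define c \<delta> where cd: "c = (\<alpha> + \<beta>) / 2" "\<delta> = (\<alpha> - \<beta>) / 2"
  have ab: "\<alpha> = c + \<delta>" "\<beta> = c - \<delta>" by (simp_all add: cd field_simps)
  define x y where xy: "x = complex_of_real (Re \<delta>)" "y = complex_of_real (Im \<delta>)"
  have st: "s\<^sup>2 = lp_const (1/4) * lp_u\<^sup>2 + lp_const (- \<i> / 2) * lp_u * lp_v + lp_const (- 1/4) * lp_v\<^sup>2"
    "t\<^sup>2 = lp_const (1/4) * lp_u\<^sup>2 + lp_const (\<i> / 2) * lp_u * lp_v + lp_const (- 1/4) * lp_v\<^sup>2"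
    "s * t = lp_const (1/4) * lp_u\<^sup>2 + lp_const (1/4) * lp_v\<^sup>2"
    unfolding s_def t_def lp_const_def lp_u_def lp_v_def power2_eq_square by simp_all
  have "lp_line \<alpha> * lp_line \<beta> = (lp_line c)\<^sup>2 - (lp_const x * lp_u + lp_const y * lp_v)\<^sup>2"
    unfolding ab lp_line_add xy by (simp add: power2_eq_square algebra_simps)
  also have "(lp_const x * lp_u + lp_const y * lp_v)\<^sup>2
     = lp_const (x * x) * lp_u\<^sup>2 + lp_const (x * y + x * y) * lp_u * lp_v + lp_const (y * y) * lp_v\<^sup>2"
    unfolding lp_const_hom power2_eq_square by (simp only: algebra_simps)
  finally have prod: "lp_line \<alpha> * lp_line \<beta> = (lp_line c)\<^sup>2 - (lp_const (x * x) * lp_u\<^sup>2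
     + lp_const (x * y + x * y) * lp_u * lp_v + lp_const (y * y) * lp_v\<^sup>2)" .
  have "lp_line \<alpha> * lp_line \<beta> - (s\<^sup>2 * lp_const z + (- (s * t)) * lp_const (complex_of_real h) + t\<^sup>2 * lp_const (cnj z))
    = (lp_line c)\<^sup>2 - (lp_const (x * x + 1/4 * z - 1/4 * complex_of_real h + 1/4 * cnj z) * lp_u\<^sup>2
       + lp_const (x * y + x * y + (- \<i> / 2) * z + \<i> / 2 * cnj z) * lp_u * lp_v
       + lp_const (y * y + (- 1/4) * z - 1/4 * complex_of_real h + (- 1/4) * cnj z) * lp_v\<^sup>2)"
    unfolding st prod unfolding lp_const_hom(1,2,6)
    by (simp only: algebra_simps mult_minus_left mult_minus_right minus_add_distrib diff_minus_eq_add add_uminus_conv_diff)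
  also have "x * x + 1/4 * z - 1/4 * complex_of_real h + 1/4 * cnj z
     = complex_of_real (((cmod \<delta>)\<^sup>2 - h / 2 + Re (\<delta>\<^sup>2 + z)) / 2)"
    unfolding cmod_power2 xy by (simp add: complex_eq_iff power2_eq_square field_simps)
  also have "x * y + x * y + (- \<i> / 2) * z + \<i> / 2 * cnj z = complex_of_real (Im (\<delta>\<^sup>2 + z))"
    unfolding xy by (simp add: complex_eq_iff power2_eq_square field_simps)
  also have "y * y + (- 1/4) * z - 1/4 * complex_of_real h + (- 1/4) * cnj z
     = complex_of_real (((cmod \<delta>)\<^sup>2 - h / 2 - Re (\<delta>\<^sup>2 + z)) / 2)"
    unfolding cmod_power2 xy by (simp add: complex_eq_iff power2_eq_square field_simps)
  finally show ?thesis unfolding lp_conic_def lp_quad_def cd .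
qed

text \<open>The off-diagonal blocks of $\<Re>^J(A)$ and $\<Im>^J(A)$ combine the block $C$ with $-D^*$ and the block $D$ with $-C^*$.\<close>
lemma J_line_matrix_block:
  assumes r: "r < n" and C: "C \<in> carrier_mat r (n - r)" and D: "D \<in> carrier_mat (n - r) r"
    and A: "A = four_block_mat (\<alpha> \<cdot>\<^sub>m 1\<^sub>m r) C D (\<beta> \<cdot>\<^sub>m 1\<^sub>m (n - r))"
  defines "s \<equiv> lp_const (1/2) * (lp_u - lp_const \<i> * lp_v)" and "t \<equiv> lp_const (1/2) * (lp_u + lp_const \<i> * lp_v)"
  shows "lp_u \<cdot>\<^sub>m map_mat lp_const (J_Re n r A) + lp_v \<cdot>\<^sub>m map_mat lp_const (J_Im n r A) + lp_w \<cdot>\<^sub>m 1\<^sub>m n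
    = four_block_mat (lp_line \<alpha> \<cdot>\<^sub>m 1\<^sub>m r)
        (s \<cdot>\<^sub>m map_mat lp_const C - t \<cdot>\<^sub>m map_mat lp_const (mat_adjoint D))
        (s \<cdot>\<^sub>m map_mat lp_const D - t \<cdot>\<^sub>m map_mat lp_const (mat_adjoint C))
        (lp_line \<beta> \<cdot>\<^sub>m 1\<^sub>m (n - r))" (is "?L = ?R")
proof -
  have dims: "dim_row C = r" "dim_col C = n - r" "dim_row D = n - r" "dim_col D = r" using C D by auto
  have n: "r + (n - r) = n" using r by simp
  have line: "lp_u * lp_const (1 / 2 * (a + cnj a)) + lp_v * lp_const (1 / (2 * \<i>) * (a - cnj a)) + lp_w = lp_line a" for a
  proof -
    have "1 / 2 * (a + cnj a) = complex_of_real (Re a)" "1 / (2 * \<i>) * (a - cnj a) = complex_of_real (Im a)"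
      by (simp_all add: complex_eq_iff)
    then show ?thesis unfolding lp_line_def by (simp only: ac_simps)
  qed
  have i2: "1 / (2 * \<i>) = - \<i> / 2" by (simp add: divide_simps)
  have off: "lp_u * lp_const (1 / 2 * (a + - b)) + lp_v * lp_const (1 / (2 * \<i>) * (a - - b)) = s * lp_const a - t * lp_const b" for a b
    unfolding s_def t_def lp_const_def lp_u_def lp_v_def i2 by (simp add: field_simps)
  note Jb = J_adjoint_block[OF r C D A]
  have cn: "carrier_mat n n = carrier_mat (r + (n - r)) (r + (n - r))" using n by simp
  have Ac: "A \<in> carrier_mat n n" "J_adjoint n r A \<in> carrier_mat n n"
    unfolding Jb unfolding A cn by (intro four_block_carrier_mat; simp)+
  have Re_entry: "J_Re n r A $$ (i, j) = 1 / 2 * (A $$ (i, j) + J_adjoint n r A $$ (i, j))"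
    and Im_entry: "J_Im n r A $$ (i, j) = 1 / (2 * \<i>) * (A $$ (i, j) - J_adjoint n r A $$ (i, j))"
    if "i < n" "j < n" for i j
    using that Ac unfolding J_Re_def J_Im_def by auto
  have dimRe: "dim_row (J_Re n r A) = n" "dim_col (J_Re n r A) = n" "dim_row (J_Im n r A) = n" "dim_col (J_Im n r A) = n"
    using Ac unfolding J_Re_def J_Im_def by auto
  show ?thesis
  proof (rule eq_matI)
    show "dim_row ?L = dim_row ?R" "dim_col ?L = dim_col ?R" using n by (auto simp: dimRe dims)
    fix i j assume "i < dim_row ?R" "j < dim_col ?R"
    then have ij: "i < n" "j < n" using n by auto
    have L: "?L $$ (i, j) = lp_u * lp_const (1 / 2 * (A $$ (i, j) + J_adjoint n r A $$ (i, j)))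
        + lp_v * lp_const (1 / (2 * \<i>) * (A $$ (i, j) - J_adjoint n r A $$ (i, j))) + (if i = j then lp_w else 0)"
      using ij by (simp add: dimRe Re_entry Im_entry)
    consider (a) "i < r" "j < r" | (b) "i < r" "r \<le> j" | (c) "r \<le> i" "j < r" | (d) "r \<le> i" "r \<le> j" by linarith
    then show "?L $$ (i, j) = ?R $$ (i, j)"
    proof cases
      case a
      then have e: "A $$ (i, j) = (if i = j then \<alpha> else 0)" "J_adjoint n r A $$ (i, j) = (if i = j then cnj \<alpha> else 0)"
        "?R $$ (i, j) = (if i = j then lp_line \<alpha> else 0)"
        unfolding Jb unfolding A by simp_all
      show ?thesis unfolding L e using line[of \<alpha>] by (auto simp: lp_const_hom)
    next
      case b
      have e: "A $$ (i, j) = C $$ (i, j - r)" "J_adjoint n r A $$ (i, j) = - mat_adjoint D $$ (i, j - r)"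
        "?R $$ (i, j) = s * lp_const (C $$ (i, j - r)) - t * lp_const (mat_adjoint D $$ (i, j - r))"
        unfolding Jb unfolding A using b ij by (simp_all add: dims)
      show ?thesis unfolding L e using off[of "C $$ (i, j - r)" "mat_adjoint D $$ (i, j - r)"] b by simp
    next
      case c
      have e: "A $$ (i, j) = D $$ (i - r, j)" "J_adjoint n r A $$ (i, j) = - mat_adjoint C $$ (i - r, j)"
        "?R $$ (i, j) = s * lp_const (D $$ (i - r, j)) - t * lp_const (mat_adjoint C $$ (i - r, j))"
        unfolding Jb unfolding A using c ij by (simp_all add: dims)
      show ?thesis unfolding L e using off[of "D $$ (i - r, j)" "mat_adjoint C $$ (i - r, j)"] c by simp
    next
      case d
      then have e: "A $$ (i, j) = (if i = j then \<beta> else 0)" "J_adjoint n r A $$ (i, j) = (if i = j then cnj \<beta> else 0)"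
        "?R $$ (i, j) = (if i = j then lp_line \<beta> else 0)"
        unfolding Jb unfolding A using ij by auto
      show ?thesis unfolding L e using line[of \<beta>] by (auto simp: lp_const_hom)
    qed
  qed
qed

text \<open>The product of the two off-diagonal blocks is $s^2 DC - st(C^*C + DD^*) + t^2(DC)^*$ with $s = (u - \<i> v)/2$ and
$t = (u + \<i> v)/2$. The unitary matrix diagonalizes the last summand because it diagonalizes its adjoint.\<close>
lemma kippenhahn_poly_factorization:
  fixes \<alpha> \<beta> :: complex and C D U A :: "complex mat" and z :: "nat \<Rightarrow> complex" and h :: "nat \<Rightarrow> real"
  assumes r: "r < n" "n \<le> 2 * r" and C: "C \<in> carrier_mat r (n - r)" and D: "D \<in> carrier_mat (n - r) r"
    and A: "A = four_block_mat (\<alpha> \<cdot>\<^sub>m 1\<^sub>m r) C D (\<beta> \<cdot>\<^sub>m 1\<^sub>m (n - r))"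
    and U: "unitary_matrix (n - r) U"
    and Zd: "mat_adjoint U * (D * C) * U = Matrix.mat (n - r) (n - r) (\<lambda>(i,j). if i = j then z i else 0)"
    and Hd: "mat_adjoint U * (mat_adjoint C * C + D * mat_adjoint D) * U
       = Matrix.mat (n - r) (n - r) (\<lambda>(i,j). if i = j then complex_of_real (h i) else 0)"
  shows "kippenhahn_poly n r A = lp_line \<alpha> ^ (2 * r - n) *
    (\<Prod>j<n - r. lp_conic ((\<alpha> + \<beta>) / 2) (((\<alpha> - \<beta>) / 2)\<^sup>2 + z j) ((cmod ((\<alpha> - \<beta>) / 2))\<^sup>2 - h j / 2))"
proof -
  define m where "m = n - r"
  have Cm: "C \<in> carrier_mat r m" and Dm: "D \<in> carrier_mat m r" using C D by (auto simp: m_def)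
  define s t where st: "s = lp_const (1/2) * (lp_u - lp_const \<i> * lp_v)" "t = lp_const (1/2) * (lp_u + lp_const \<i> * lp_v)"
  let ?f = "map_mat lp_const"
  let ?X = "s \<cdot>\<^sub>m ?f C - t \<cdot>\<^sub>m ?f (mat_adjoint D)"
  let ?Y = "s \<cdot>\<^sub>m ?f D - t \<cdot>\<^sub>m ?f (mat_adjoint C)"
  let ?Z = "D * C" and ?H = "mat_adjoint C * C + D * mat_adjoint D" and ?Z' = "mat_adjoint (D * C)"
  have Uc: "U \<in> carrier_mat m m" using U by (simp add: unitary_matrix_def m_def)
  have XY: "?X \<in> carrier_mat r m" "?Y \<in> carrier_mat m r" using Cm Dm by auto
  have P: "lp_line \<alpha> \<noteq> 0" by (auto simp: lp_line_alt)
  have "kippenhahn_poly n r A = lp_line \<alpha> ^ (r - m) * Determinant.det ((lp_line \<alpha> * lp_line \<beta>) \<cdot>\<^sub>m 1\<^sub>m m - ?Y * ?X)"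
    unfolding kippenhahn_poly_def J_line_matrix_block[OF r(1) C D A, folded st] m_def[symmetric]
    by (rule det_scalar_block[OF XY P]) (use r in \<open>simp add: m_def\<close>)
  also have "?Y * ?X = (s * s) \<cdot>\<^sub>m ?f ?Z + (- (s * t)) \<cdot>\<^sub>m ?f ?H + (t * t) \<cdot>\<^sub>m ?f ?Z'"
  proof -
    have c: "?f C \<in> carrier_mat r m" "?f D \<in> carrier_mat m r" "?f (mat_adjoint C) \<in> carrier_mat m r"
      "?f (mat_adjoint D) \<in> carrier_mat r m" using Cm Dm by auto
    have h: "?f ?Z = ?f D * ?f C" "?f ?H = ?f (mat_adjoint C) * ?f C + ?f D * ?f (mat_adjoint D)"
      "?f ?Z' = ?f (mat_adjoint C) * ?f (mat_adjoint D)"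
      unfolding mat_adjoint_mult[OF Dm Cm]
      using Cm Dm by (simp_all add: lp_const.mat_hom_mult[of _ m r _ m, symmetric])
        (auto intro!: eq_matI simp: lp_const_hom)
    have e: "?Y * ?X = (s \<cdot>\<^sub>m ?f D) * (s \<cdot>\<^sub>m ?f C) - (s \<cdot>\<^sub>m ?f D) * (t \<cdot>\<^sub>m ?f (mat_adjoint D))
      - ((t \<cdot>\<^sub>m ?f (mat_adjoint C)) * (s \<cdot>\<^sub>m ?f C) - (t \<cdot>\<^sub>m ?f (mat_adjoint C)) * (t \<cdot>\<^sub>m ?f (mat_adjoint D)))"
    proof -
      have k: "s \<cdot>\<^sub>m ?f C \<in> carrier_mat r m" "t \<cdot>\<^sub>m ?f (mat_adjoint D) \<in> carrier_mat r m"
        "s \<cdot>\<^sub>m ?f D \<in> carrier_mat m r" "t \<cdot>\<^sub>m ?f (mat_adjoint C) \<in> carrier_mat m r"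
        using c by auto
      show ?thesis
        unfolding minus_mult_distrib_mat[OF k(3,4) XY(1)] mult_minus_distrib_mat[OF k(3) k(1,2)]
          mult_minus_distrib_mat[OF k(4) k(1,2)] ..
    qed
    have sm: "(a \<cdot>\<^sub>m K) * (b \<cdot>\<^sub>m K') = (a * b) \<cdot>\<^sub>m (K * K')" if "K \<in> carrier_mat m r" "K' \<in> carrier_mat r m"
      for a b :: line_poly and K K'
      using that by (simp add: mult_smult_distrib[of _ m r _ m] mult_smult_assoc_mat[of _ m r _ m])
        (auto intro!: eq_matI simp: mult_ac)
    have "a1 \<cdot>\<^sub>m E1 - b \<cdot>\<^sub>m E2 - (b \<cdot>\<^sub>m E3 - d \<cdot>\<^sub>m E4) = a1 \<cdot>\<^sub>m E1 + (- b) \<cdot>\<^sub>m (E3 + E2) + d \<cdot>\<^sub>m E4"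
      if "E1 \<in> carrier_mat m m" "E2 \<in> carrier_mat m m" "E3 \<in> carrier_mat m m" "E4 \<in> carrier_mat m m"
      for a1 b d :: line_poly and E1 E2 E3 E4
      using that by (intro eq_matI) (auto simp: algebra_simps)
    moreover have "?f D * ?f C \<in> carrier_mat m m" "?f (mat_adjoint C) * ?f C \<in> carrier_mat m m"
      "?f D * ?f (mat_adjoint D) \<in> carrier_mat m m" "?f (mat_adjoint C) * ?f (mat_adjoint D) \<in> carrier_mat m m"
      using c by auto
    ultimately show ?thesis unfolding e sm[OF c(2,1)] sm[OF c(2,4)] sm[OF c(3,1)] sm[OF c(3,4)] h mult.commute[of t s]
      by blast
  qed
  also have "Determinant.det ((lp_line \<alpha> * lp_line \<beta>) \<cdot>\<^sub>m 1\<^sub>m m - \<dots>)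
     = (\<Prod>j<m. lp_line \<alpha> * lp_line \<beta> - (s * s * lp_const (z j) + (- (s * t)) * lp_const (complex_of_real (h j)) + t * t * lp_const (cnj (z j))))"
  proof (rule diagonalize_linear_combination[where U = U])
    show "comm_ring_hom lp_const" by unfold_locales
    show "unitary_matrix m U" using U by (simp add: m_def)
    show "mat_adjoint U * ?Z * U = Matrix.mat m m (\<lambda>(i,j). if i = j then z i else 0)" using Zd by (simp add: m_def)
    then have "mat_adjoint (mat_adjoint U * ?Z * U) = mat_adjoint (Matrix.mat m m (\<lambda>(i,j). if i = j then z i else 0))" by simp
    also have "mat_adjoint (mat_adjoint U * ?Z * U) = mat_adjoint U * ?Z' * U"
    proof -
      have k: "?Z \<in> carrier_mat m m" "mat_adjoint U \<in> carrier_mat m m" "mat_adjoint U * ?Z \<in> carrier_mat m m"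
        "?Z' \<in> carrier_mat m m" using Uc Cm Dm by auto
      show ?thesis
        unfolding mat_adjoint_mult[OF k(3) Uc] mat_adjoint_mult[OF k(2,1)] mat_adjoint_adjoint
        by (rule assoc_mult_mat[OF k(2,4) Uc, symmetric])
    qed
    also have "mat_adjoint (Matrix.mat m m (\<lambda>(i,j). if i = j then z i else 0)) = Matrix.mat m m (\<lambda>(i,j). if i = j then cnj (z i) else 0)"
      by (rule eq_matI) auto
    finally show "mat_adjoint U * ?Z' * U = Matrix.mat m m (\<lambda>(i,j). if i = j then cnj (z i) else 0)" .
    show "mat_adjoint U * ?H * U = Matrix.mat m m (\<lambda>(i,j). if i = j then complex_of_real (h i) else 0)" using Hd by (simp add: m_def)
  qed (use Cm Dm in auto)
  also have "\<dots> = (\<Prod>j<m. lp_conic ((\<alpha> + \<beta>) / 2) (((\<alpha> - \<beta>) / 2)\<^sup>2 + z j) ((cmod ((\<alpha> - \<beta>) / 2))\<^sup>2 - h j / 2))"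
    using line_product_conic[of \<alpha> \<beta>] unfolding st power2_eq_square[of "_ * (_ + _)"] power2_eq_square[of "_ * (_ - _)"]
    by (intro prod.cong) simp_all
  finally show ?thesis using r unfolding m_def by (simp add: mult_2)
qed

section \<open>Convexity of the joint range of three Hermitian forms\<close>

text \<open>Regard $k_1$, $k_2$, $m$ as the entries of a Hermitian matrix $L$. The line $I + \<tau> L$ leaves the cone of positive
semidefinite matrices at $\<tau> = -1/\<mu>$, where $\<mu>$ is the eigenvalue of $L$ of largest modulus, and there the matrix has rank at most one.\<close>
lemma psd_line_meets_rank_one:
  fixes k1 k2 :: real and m :: complex
  assumes "(k1, k2, m) \<noteq> 0"
  shows "\<exists>\<tau> a b. (cmod a)\<^sup>2 = 1 + \<tau> * k1 \<and> (cmod b)\<^sup>2 = 1 + \<tau> * k2 \<and> a * cnj b = complex_of_real \<tau> * m"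
proof -
  have main: "\<exists>\<tau> a b. (cmod a)\<^sup>2 = 1 + \<tau> * k1 \<and> (cmod b)\<^sup>2 = 1 + \<tau> * k2 \<and> a * cnj b = complex_of_real \<tau> * m"
    if nz: "(k1, k2, m) \<noteq> 0" and tr: "0 \<le> k1 + k2" for k1 k2 :: real and m :: complex
  proof -
    \<comment> \<open>$\<mu>$ is the larger root of the characteristic polynomial; nonnegative trace makes it positive.\<close>
    define S where "S = sqrt ((k1 - k2)\<^sup>2 + 4 * (cmod m)\<^sup>2)"
    define \<mu> where "\<mu> = (k1 + k2 + S) / 2"
    have S2: "S\<^sup>2 = (k1 - k2)\<^sup>2 + 4 * (cmod m)\<^sup>2" by (simp add: S_def)
    have "\<bar>k1 - k2\<bar> \<le> S" unfolding S_def by (rule real_le_rsqrt) simp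
    then have ge: "k1 \<le> \<mu>" "k2 \<le> \<mu>" by (auto simp: \<mu>_def)
    have "\<mu> \<noteq> 0"
    proof
      assume "\<mu> = 0"
      then have "k1 + k2 = 0" "S = 0" using tr \<open>\<bar>k1 - k2\<bar> \<le> S\<close> by (auto simp: \<mu>_def)
      then have "(k1 - k2)\<^sup>2 = 0 \<and> (cmod m)\<^sup>2 = 0" using S2
        by (smt (verit) zero_le_power2 power_zero_numeral)
      then show False using nz \<open>k1 + k2 = 0\<close> by (auto simp: zero_prod_def)
    qed
    moreover have "0 \<le> \<mu>" using tr \<open>\<bar>k1 - k2\<bar> \<le> S\<close> by (auto simp: \<mu>_def)
    ultimately have \<mu>: "0 < \<mu>" by simp
    have det: "(\<mu> - k1) * (\<mu> - k2) = (cmod m)\<^sup>2"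
      using S2 unfolding \<mu>_def by (simp add: power2_eq_square field_simps)
    define \<tau> where "\<tau> = - 1 / \<mu>"
    define P1 P2 where P: "P1 = 1 + \<tau> * k1" "P2 = 1 + \<tau> * k2"
    have Pe: "P1 = (\<mu> - k1) / \<mu>" "P2 = (\<mu> - k2) / \<mu>" using \<mu> by (auto simp: P \<tau>_def field_simps)
    have P0: "0 \<le> P1" "0 \<le> P2" using ge \<mu> by (auto simp: Pe)
    have PP: "P1 * P2 = \<tau>\<^sup>2 * (cmod m)\<^sup>2" unfolding det[symmetric] using \<mu> by (simp add: Pe \<tau>_def power2_eq_square)
    show ?thesis
    proof (cases "P1 = 0")
      case True
      then have "complex_of_real \<tau> * m = 0" using PP by auto
      then show ?thesis using True P0 P
        by (intro exI[of _ \<tau>] exI[of _ 0] exI[of _ "complex_of_real (sqrt P2)"]) auto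
    next
      case False
      then have P1: "0 < P1" using P0 by simp
      define a b where ab: "a = complex_of_real (sqrt P1)" "b = cnj (complex_of_real \<tau> * m) / a"
      have "(cmod b)\<^sup>2 = \<tau>\<^sup>2 * (cmod m)\<^sup>2 / P1"
        using P1 by (simp add: ab norm_divide norm_mult power_divide power_mult_distrib)
      then have "(cmod b)\<^sup>2 = P2" using P1 by (simp add: PP[symmetric])
      moreover have "(cmod a)\<^sup>2 = P1" using P1 by (simp add: ab)
      moreover have "a * cnj b = complex_of_real \<tau> * m" using P1 by (simp add: ab)
      ultimately show ?thesis using P by blast
    qed
  qed
  show ?thesis
  proof (cases "0 \<le> k1 + k2")
    case True
    then show ?thesis using main assms by blast
  next
    case False
    have "(- k1, - k2, - m) \<noteq> 0" using assms by (auto simp: zero_prod_def)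
    then obtain \<tau> a b where "(cmod a)\<^sup>2 = 1 + \<tau> * - k1" "(cmod b)\<^sup>2 = 1 + \<tau> * - k2" "a * cnj b = complex_of_real \<tau> * - m"
      using main[of "- k1" "- k2" "- m"] False by auto
    then show ?thesis by (intro exI[of _ "- \<tau>"] exI[of _ a] exI[of _ b]) simp
  qed
qed

text \<open>A linear map from the four-dimensional space of Hermitian $2 \<times> 2$ matrices to a space of dimension three has a
kernel, and moving the identity along a kernel element up to a matrix of rank one does not change its image.\<close>
lemma three_forms_rank_one:
  fixes L :: "real \<times> real \<times> complex \<Rightarrow> complex \<times> real"
  assumes "linear L"
  shows "\<exists>a b. L ((cmod a)\<^sup>2, (cmod b)\<^sup>2, a * cnj b) = L (1, 1, 0)"
proof -
  have "\<not> inj L"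
  proof
    assume "inj L"
    then have "dim (range L) = dim (UNIV :: (real \<times> real \<times> complex) set)"
      using assms by (intro dim_image_eq) (auto simp: inj_on_def inj_def)
    moreover have "dim (range L) \<le> DIM(complex \<times> real)" by (rule dim_subset_UNIV)
    ultimately show False by simp
  qed
  then obtain k where k: "L k = 0" "k \<noteq> 0" using assms by (auto simp: linear_injective_0)
  obtain k1 k2 m where km: "k = (k1, k2, m)" by (cases k) auto
  then obtain \<tau> a b where t: "(cmod a)\<^sup>2 = 1 + \<tau> * k1" "(cmod b)\<^sup>2 = 1 + \<tau> * k2" "a * cnj b = complex_of_real \<tau> * m"
    using psd_line_meets_rank_one k by blast
  have "((cmod a)\<^sup>2, (cmod b)\<^sup>2, a * cnj b) = (1, 1, 0) + \<tau> *\<^sub>R k"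
    by (simp add: t km scaleR_conv_of_real)
  then have "L ((cmod a)\<^sup>2, (cmod b)\<^sup>2, a * cnj b) = L (1, 1, 0) + \<tau> *\<^sub>R L k"
    using assms by (simp add: linear_add linear_scale)
  then show ?thesis using k by auto
qed

lemma cscalar_prod_adjoint:
  fixes v w :: "complex Matrix.vec"
  assumes K: "K \<in> carrier_mat p q" and v: "v \<in> carrier_vec q" and w: "w \<in> carrier_vec p"
  shows "(K *\<^sub>v v) \<bullet>c w = v \<bullet>c (mat_adjoint K *\<^sub>v w)"
proof -
  have "(K *\<^sub>v v) \<bullet>c w = (\<Sum>i<p. (\<Sum>j<q. K $$ (i, j) * v $ j) * cnj (w $ i))"
    using assms by (simp add: scalar_prod_def atLeast0LessThan)
  also have "\<dots> = (\<Sum>j<q. v $ j * (\<Sum>i<p. K $$ (i, j) * cnj (w $ i)))"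
    unfolding sum_distrib_left sum_distrib_right by (subst sum.swap) (simp add: mult_ac)
  also have "\<dots> = v \<bullet>c (mat_adjoint K *\<^sub>v w)"
    using assms by (simp add: scalar_prod_def atLeast0LessThan)
  finally show ?thesis .
qed

lemma cscalar_prod_cnj:
  fixes v w :: "complex Matrix.vec"
  assumes "v \<in> carrier_vec p" "w \<in> carrier_vec p"
  shows "cnj (v \<bullet>c w) = w \<bullet>c v"
  using assms by (simp add: scalar_prod_def mult.commute)

lemma cscalar_prod_lin:
  fixes v w x :: "complex Matrix.vec"
  assumes "v \<in> carrier_vec p" "w \<in> carrier_vec p" "x \<in> carrier_vec p"
  shows "(v + w) \<bullet>c x = v \<bullet>c x + w \<bullet>c x" "x \<bullet>c (v + w) = x \<bullet>c v + x \<bullet>c w"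
    "(v - w) \<bullet>c x = v \<bullet>c x - w \<bullet>c x" "x \<bullet>c (v - w) = x \<bullet>c v - x \<bullet>c w"
    "(a \<cdot>\<^sub>v v) \<bullet>c x = a * (v \<bullet>c x)" "x \<bullet>c (a \<cdot>\<^sub>v v) = cnj a * (x \<bullet>c v)"
  using assms by (simp_all add: scalar_prod_def sum.distrib sum_subtractf sum_distrib_left algebra_simps)

definition vec_norm2 :: "complex Matrix.vec \<Rightarrow> real" where
  "vec_norm2 v = (\<Sum>i<dim_vec v. (cmod (v $ i))\<^sup>2)"

lemma cscalar_prod_self: "v \<bullet>c v = complex_of_real (vec_norm2 v)"
  unfolding vec_norm2_def of_real_sum complex_norm_square by (simp add: scalar_prod_def atLeast0LessThan)

lemma vec_norm2_nonneg: "0 \<le> vec_norm2 v"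
  by (simp add: vec_norm2_def sum_nonneg)

lemma vec_norm2_eq_0: "v \<in> carrier_vec p \<Longrightarrow> vec_norm2 v = 0 \<longleftrightarrow> v = 0\<^sub>v p"
  by (auto simp: vec_norm2_def sum_nonneg_eq_0_iff)

lemma J_mat_carrier: "r \<le> n \<Longrightarrow> J_mat n r \<in> carrier_mat n n"
  unfolding J_mat_def by (metis four_block_carrier_mat le_add_diff_inverse one_carrier_mat uminus_carrier_mat)

lemma J_mat_adjoint: "r \<le> n \<Longrightarrow> mat_adjoint (J_mat n r) = J_mat n r"
  by (intro eq_matI) (auto simp: J_mat_def)

lemma J_prod_lin:
  assumes "r \<le> n" "x \<in> carrier_vec n" "y \<in> carrier_vec n" "w \<in> carrier_vec n"
  shows "J_prod n r (x + y) w = J_prod n r x w + J_prod n r y w"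
    "J_prod n r w (x + y) = J_prod n r w x + J_prod n r w y"
    "J_prod n r (a \<cdot>\<^sub>v x) w = a * J_prod n r x w"
    "J_prod n r w (a \<cdot>\<^sub>v x) = cnj a * J_prod n r w x"
    "cnj (J_prod n r x y) = J_prod n r y x"
proof -
  note Jc = J_mat_carrier[OF assms(1)]
  have c: "J_mat n r *\<^sub>v x \<in> carrier_vec n" "J_mat n r *\<^sub>v y \<in> carrier_vec n" "J_mat n r *\<^sub>v w \<in> carrier_vec n"
    using Jc assms by auto
  show "J_prod n r (x + y) w = J_prod n r x w + J_prod n r y w"
    unfolding J_prod_def using Jc assms c by (simp add: mult_add_distrib_mat_vec[of _ n n] cscalar_prod_lin[of _ n])
  show "J_prod n r w (x + y) = J_prod n r w x + J_prod n r w y"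
    unfolding J_prod_def using assms c by (simp add: cscalar_prod_lin[of _ n])
  show "J_prod n r (a \<cdot>\<^sub>v x) w = a * J_prod n r x w"
    unfolding J_prod_def using Jc assms c by (simp add: mult_mat_vec[of _ n n] cscalar_prod_lin[of _ n])
  show "J_prod n r w (a \<cdot>\<^sub>v x) = cnj a * J_prod n r w x"
    unfolding J_prod_def using assms c by (simp add: cscalar_prod_lin[of _ n])
  show "cnj (J_prod n r x y) = J_prod n r y x"
    unfolding J_prod_def using assms c
    by (simp add: cscalar_prod_cnj[of _ n] cscalar_prod_adjoint[OF Jc] J_mat_adjoint)
qed

text \<open>The quotient $[Ax,x]/[x,x]$ in homogeneous coordinates, relative to the centre $c$.\<close>
definition krein_point :: "nat \<Rightarrow> nat \<Rightarrow> complex mat \<Rightarrow> complex \<Rightarrow> complex Matrix.vec \<Rightarrow> complex \<times> real" where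
  "krein_point n r A c x = (J_prod n r (A *\<^sub>v x) x - c * J_prod n r x x, Re (J_prod n r x x))"

definition krein_cone :: "nat \<Rightarrow> nat \<Rightarrow> complex mat \<Rightarrow> complex \<Rightarrow> (complex \<times> real) set" where
  "krein_cone n r A c = krein_point n r A c ` carrier_vec n"

lemma J_prod_self_real: "r \<le> n \<Longrightarrow> x \<in> carrier_vec n \<Longrightarrow> J_prod n r x x = complex_of_real (Re (J_prod n r x x))"
  using J_prod_lin(5)[of r n x x x] by (simp add: complex_eq_iff)

lemma krein_cone_scale:
  assumes r: "r \<le> n" and A: "A \<in> carrier_mat n n" and k: "k \<in> krein_cone n r A c" and t: "0 \<le> t"
  shows "t *\<^sub>R k \<in> krein_cone n r A c"
proof -
  obtain x where x: "x \<in> carrier_vec n" "k = krein_point n r A c x" using k by (auto simp: krein_cone_def)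
  let ?a = "complex_of_real (sqrt t)"
  have tt: "?a * cnj ?a = complex_of_real t" using t by (simp flip: of_real_mult)
  have Ax: "A *\<^sub>v x \<in> carrier_vec n" "?a \<cdot>\<^sub>v x \<in> carrier_vec n" "?a \<cdot>\<^sub>v (A *\<^sub>v x) \<in> carrier_vec n" using A x by auto
  have s: "J_prod n r (?a \<cdot>\<^sub>v x) (?a \<cdot>\<^sub>v x) = complex_of_real t * J_prod n r x x"
    unfolding J_prod_lin(3)[OF r x(1) x(1) Ax(2)] J_prod_lin(4)[OF r x(1) x(1) x(1)] tt[symmetric] by simp
  have w: "J_prod n r (A *\<^sub>v (?a \<cdot>\<^sub>v x)) (?a \<cdot>\<^sub>v x) = complex_of_real t * J_prod n r (A *\<^sub>v x) x"
    unfolding mult_mat_vec[OF A x(1)] J_prod_lin(3)[OF r Ax(1) Ax(1) Ax(2)] J_prod_lin(4)[OF r x(1) x(1) Ax(1)] tt[symmetric]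
    by simp
  have "krein_point n r A c (?a \<cdot>\<^sub>v x) = t *\<^sub>R k"
    unfolding x(2) krein_point_def s w by (simp add: scaleR_conv_of_real algebra_simps)
  then show ?thesis unfolding krein_cone_def using Ax(2) by (metis imageI)
qed

text \<open>The point of $ax + by$ depends linearly on $|a|^2$, $|b|^2$ and $a \bar b$, so a suitable linear combination of two
vectors realizes the sum of their points.\<close>
lemma krein_cone_add:
  assumes r: "r \<le> n" and A: "A \<in> carrier_mat n n" and k: "k \<in> krein_cone n r A c" "l \<in> krein_cone n r A c"
  shows "k + l \<in> krein_cone n r A c"
proof -
  obtain x where x: "x \<in> carrier_vec n" "k = krein_point n r A c x" using k by (auto simp: krein_cone_def)
  obtain y where y: "y \<in> carrier_vec n" "l = krein_point n r A c y" using k by (auto simp: krein_cone_def)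
  define S where "S u v = J_prod n r (A *\<^sub>v u) v - c * J_prod n r u v" for u v
  define L where "L = (\<lambda>t :: real \<times> real \<times> complex. fst t *\<^sub>R k + fst (snd t) *\<^sub>R l
     + (snd (snd t) * S x y + cnj (snd (snd t)) * S y x, 2 * Re (snd (snd t) * J_prod n r x y)))"
  have "linear L"
    by (rule linearI) (auto simp: L_def algebra_simps scaleR_conv_of_real)
  then obtain a b where ab: "L ((cmod a)\<^sup>2, (cmod b)\<^sup>2, a * cnj b) = L (1, 1, 0)"
    using three_forms_rank_one by blast
  define v where "v = a \<cdot>\<^sub>v x + b \<cdot>\<^sub>v y"
  have c: "A *\<^sub>v x \<in> carrier_vec n" "A *\<^sub>v y \<in> carrier_vec n" "a \<cdot>\<^sub>v x \<in> carrier_vec n" "b \<cdot>\<^sub>v y \<in> carrier_vec n"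
    "a \<cdot>\<^sub>v (A *\<^sub>v x) \<in> carrier_vec n" "b \<cdot>\<^sub>v (A *\<^sub>v y) \<in> carrier_vec n" "v \<in> carrier_vec n" using A x y by (auto simp: v_def)
  have exp: "J_prod n r (a \<cdot>\<^sub>v u + b \<cdot>\<^sub>v u') v = complex_of_real ((cmod a)\<^sup>2) * J_prod n r u x + complex_of_real ((cmod b)\<^sup>2) * J_prod n r u' y
      + a * cnj b * J_prod n r u y + cnj (a * cnj b) * J_prod n r u' x"
    if u: "u \<in> carrier_vec n" "u' \<in> carrier_vec n" for u u'
  proof -
    have "J_prod n r (a \<cdot>\<^sub>v u + b \<cdot>\<^sub>v u') v = a * J_prod n r u v + b * J_prod n r u' v"
      using u c by (simp add: J_prod_lin[OF r])
    also have "J_prod n r u v = cnj a * J_prod n r u x + cnj b * J_prod n r u y"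
      unfolding v_def J_prod_lin(2)[OF r c(3) c(4) u(1)] J_prod_lin(4)[OF r x(1) x(1) u(1)] J_prod_lin(4)[OF r y(1) y(1) u(1)] ..
    also have "J_prod n r u' v = cnj a * J_prod n r u' x + cnj b * J_prod n r u' y"
      unfolding v_def J_prod_lin(2)[OF r c(3) c(4) u(2)] J_prod_lin(4)[OF r x(1) x(1) u(2)] J_prod_lin(4)[OF r y(1) y(1) u(2)] ..
    finally show ?thesis unfolding complex_norm_square by (simp add: algebra_simps)
  qed
  have Av: "A *\<^sub>v v = a \<cdot>\<^sub>v (A *\<^sub>v x) + b \<cdot>\<^sub>v (A *\<^sub>v y)"
    unfolding v_def using A x y by (simp add: mult_add_distrib_mat_vec[of _ n n] mult_mat_vec[of _ n n])
  have vv: "J_prod n r v v = J_prod n r (a \<cdot>\<^sub>v x + b \<cdot>\<^sub>v y) v" by (simp add: v_def)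
  have sym: "J_prod n r y x = cnj (J_prod n r x y)" using J_prod_lin(5)[OF r x(1) y(1) x(1)] by simp
  have "krein_point n r A c v = L ((cmod a)\<^sup>2, (cmod b)\<^sup>2, a * cnj b)"
    unfolding krein_point_def Av exp[OF c(1,2)] vv exp[OF x(1) y(1)] L_def fst_conv snd_conv x(2) y(2) S_def sym
    by (simp add: scaleR_conv_of_real algebra_simps)
  also have "\<dots> = k + l" unfolding ab by (simp add: L_def flip: zero_prod_def)
  finally show ?thesis unfolding krein_cone_def using c(7) by (metis imageI)
qed

section \<open>The numerical cone of a matrix with scalar diagonal blocks\<close>

lemma smult_mat_mult_vec:
  fixes K :: "complex mat"
  assumes "K \<in> carrier_mat p q" "v \<in> carrier_vec q"
  shows "(a \<cdot>\<^sub>m K) *\<^sub>v v = a \<cdot>\<^sub>v (K *\<^sub>v v)"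
  using assms by (intro eq_vecI) (auto simp: scalar_prod_def sum_distrib_left mult_ac)

text \<open>Normality and commutation are used in the form of a simultaneous diagonalization, recorded entrywise.\<close>
locale scalar_block =
  fixes n r :: nat and \<alpha> \<beta> :: complex and C D A U :: "complex mat"
    and z :: "nat \<Rightarrow> complex" and h :: "nat \<Rightarrow> real"
  assumes r0: "0 < r" and rn: "r < n"
    and C: "C \<in> carrier_mat r (n - r)" and D: "D \<in> carrier_mat (n - r) r"
    and A: "A = four_block_mat (\<alpha> \<cdot>\<^sub>m 1\<^sub>m r) C D (\<beta> \<cdot>\<^sub>m 1\<^sub>m (n - r))"
    and U: "unitary_matrix (n - r) U"
    and Zd: "mat_adjoint U * (D * C) * U = Matrix.mat (n - r) (n - r) (\<lambda>(i,j). if i = j then z i else 0)"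
    and Hd: "mat_adjoint U * (mat_adjoint C * C + D * mat_adjoint D) * U
       = Matrix.mat (n - r) (n - r) (\<lambda>(i,j). if i = j then complex_of_real (h i) else 0)"
begin

definition ctr :: complex where "ctr = (\<alpha> + \<beta>) / 2"
definition \<delta> :: complex where "\<delta> = (\<alpha> - \<beta>) / 2"
text \<open>A quarter of $\<Delta>_j$, the square of the vector from the centre to a focus.\<close>
definition focal_sq :: "nat \<Rightarrow> complex" where "focal_sq j = \<delta>\<^sup>2 + z j"
text \<open>A quarter of $N_j^2 - M_j^2$.\<close>
definition axis_diff :: "nat \<Rightarrow> real" where "axis_diff j = (cmod \<delta>)\<^sup>2 - h j / 2"

abbreviation lform :: "nat \<Rightarrow> complex \<Rightarrow> real" where
  "lform j \<equiv> line_form (focal_sq j) (axis_diff j)"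
abbreviation lpolar :: "nat \<Rightarrow> complex \<Rightarrow> complex" where
  "lpolar j \<equiv> polar (focal_sq j) (axis_diff j)"

definition kcone :: "(complex \<times> real) set" where "kcone = krein_cone n r A ctr"

text \<open>The eigenvalue of $X^*X$ that belongs to the $j$-th column of $U$, where $X$ is the off-diagonal block \<open>mixed g\<close>.\<close>
definition coupling :: "nat \<Rightarrow> complex \<Rightarrow> real" where
  "coupling j g = ((cmod g)\<^sup>2 * h j - 2 * Re (z j * g\<^sup>2)) / 4"

lemma line_form_coupling: "lform j g = (Re (g * \<delta>))\<^sup>2 - coupling j g"
  unfolding line_form_def focal_sq_def axis_diff_def coupling_def cmod_power2
  by (simp add: power2_eq_square field_simps)

text \<open>For $g = u - \<i> v$ the upper right block of $u \<Re>^J(A) + v \<Im>^J(A)$; the lower left one is minus its adjoint.\<close>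
definition mixed :: "complex \<Rightarrow> complex mat" where
  "mixed g = (g / 2) \<cdot>\<^sub>m C - (cnj g / 2) \<cdot>\<^sub>m mat_adjoint D"

text \<open>The second component of the vector is given by its coefficients in the basis of columns of $U$.\<close>
definition block_point :: "complex Matrix.vec \<Rightarrow> complex Matrix.vec \<Rightarrow> complex \<times> real" where
  "block_point \<xi> y = krein_point n r A ctr (\<xi> @\<^sub>v (U *\<^sub>v y))"

lemma n_eq: "r + (n - r) = n" using rn by simp

lemma Uc: "U \<in> carrier_mat (n - r) (n - r)" using U by (simp add: unitary_matrix_def)

lemma A_carrier: "A \<in> carrier_mat n n"
proof -
  have "A \<in> carrier_mat (r + (n - r)) (r + (n - r))" unfolding A by (intro four_block_carrier_mat) simp_all
  then show ?thesis by (simp only: n_eq)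
qed

lemma mixed_carrier: "mixed g \<in> carrier_mat r (n - r)" 
  unfolding mixed_def by (intro minus_carrier_mat smult_carrier_mat mat_adjoint_carrier C D)

lemma append_carrier: "\<xi> \<in> carrier_vec r \<Longrightarrow> \<eta> \<in> carrier_vec (n - r) \<Longrightarrow> \<xi> @\<^sub>v \<eta> \<in> carrier_vec n"
  using append_carrier_vec[of \<xi> r \<eta> "n - r"] by (simp only: n_eq)

lemma mixed_U_carrier: "y \<in> carrier_vec (n - r) \<Longrightarrow> mixed g *\<^sub>v (U *\<^sub>v y) \<in> carrier_vec r"
  by (rule mult_mat_vec_carrier[OF mixed_carrier mult_mat_vec_carrier[OF Uc]])

lemma kcone_iff: "k \<in> kcone \<longleftrightarrow> (\<exists>\<xi> \<in> carrier_vec r. \<exists>y \<in> carrier_vec (n - r). k = block_point \<xi> y)"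
proof
  assume "k \<in> kcone"
  then obtain x where x: "x \<in> carrier_vec n" "k = krein_point n r A ctr x" by (auto simp: kcone_def krein_cone_def)
  define \<eta> where "\<eta> = vec_last x (n - r)"
  have x': "x \<in> carrier_vec (r + (n - r))" using x by (simp only: n_eq)
  then have s: "x = vec_first x r @\<^sub>v \<eta>" unfolding \<eta>_def by simp
  have \<eta>: "\<eta> \<in> carrier_vec (n - r)" by (simp add: \<eta>_def)
  have "U *\<^sub>v (mat_adjoint U *\<^sub>v \<eta>) = (U * mat_adjoint U) *\<^sub>v \<eta>"
    by (rule assoc_mult_mat_vec[symmetric]) (use Uc \<eta> in auto)
  also have "\<dots> = \<eta>" using U \<eta> by (simp add: unitary_matrix_def)
  finally have e: "U *\<^sub>v (mat_adjoint U *\<^sub>v \<eta>) = \<eta>" .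
  have "k = block_point (vec_first x r) (mat_adjoint U *\<^sub>v \<eta>)" unfolding block_point_def e using s x(2) by simp
  moreover have "mat_adjoint U *\<^sub>v \<eta> \<in> carrier_vec (n - r)"
    by (rule mult_mat_vec_carrier[OF mat_adjoint_carrier[OF Uc] \<eta>])
  ultimately show "\<exists>\<xi> \<in> carrier_vec r. \<exists>y \<in> carrier_vec (n - r). k = block_point \<xi> y"
    by (intro bexI[of _ "vec_first x r"] bexI[of _ "mat_adjoint U *\<^sub>v \<eta>"]) auto
next
  assume "\<exists>\<xi> \<in> carrier_vec r. \<exists>y \<in> carrier_vec (n - r). k = block_point \<xi> y"
  then obtain \<xi> y where "\<xi> \<in> carrier_vec r" "y \<in> carrier_vec (n - r)" "k = block_point \<xi> y" by blast
  then show "k \<in> kcone"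
    unfolding kcone_def krein_cone_def block_point_def using append_carrier[OF _ mult_mat_vec_carrier[OF Uc]] by blast
qed

lemma J_prod_append:
  assumes "\<xi> \<in> carrier_vec r" "\<eta> \<in> carrier_vec (n - r)" "\<xi>' \<in> carrier_vec r" "\<eta>' \<in> carrier_vec (n - r)"
  shows "J_prod n r (\<xi> @\<^sub>v \<eta>) (\<xi>' @\<^sub>v \<eta>') = \<xi> \<bullet>c \<xi>' - \<eta> \<bullet>c \<eta>'"
proof -
  have "J_mat n r *\<^sub>v (\<xi> @\<^sub>v \<eta>) = (1\<^sub>m r *\<^sub>v \<xi> + 0\<^sub>m r (n - r) *\<^sub>v \<eta>) @\<^sub>v (0\<^sub>m (n - r) r *\<^sub>v \<xi> + (- 1\<^sub>m (n - r)) *\<^sub>v \<eta>)"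
    unfolding J_mat_def by (rule four_block_mat_mult_vec) (use assms in auto)
  also have "\<dots> = \<xi> @\<^sub>v - \<eta>" 
  proof -
    have "(- 1\<^sub>m (n - r)) *\<^sub>v \<eta> = - \<eta>" using assms(2) by (intro eq_vecI) (auto simp: uminus_scalar_prod[symmetric])
    moreover have "0\<^sub>m r (n - r) *\<^sub>v \<eta> = 0\<^sub>v r" "0\<^sub>m (n - r) r *\<^sub>v \<xi> = 0\<^sub>v (n - r)"
      using assms by (auto intro!: eq_vecI)
    ultimately show ?thesis using assms by simp
  qed
  finally have Jx: "J_mat n r *\<^sub>v (\<xi> @\<^sub>v \<eta>) = \<xi> @\<^sub>v - \<eta>" .
  have "J_prod n r (\<xi> @\<^sub>v \<eta>) (\<xi>' @\<^sub>v \<eta>') = (\<xi> @\<^sub>v - \<eta>) \<bullet> (conjugate \<xi>' @\<^sub>v conjugate \<eta>')"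
  proof -
    have "conjugate (\<xi>' @\<^sub>v \<eta>') = conjugate \<xi>' @\<^sub>v conjugate \<eta>'" by (rule eq_vecI) auto
    then show ?thesis by (simp add: J_prod_def Jx)
  qed
  also have "\<dots> = \<xi> \<bullet>c \<xi>' + (- \<eta>) \<bullet>c \<eta>'"
    by (rule scalar_prod_append) (use assms in auto)
  also have "(- \<eta>) \<bullet>c \<eta>' = - (\<eta> \<bullet>c \<eta>')" using assms by simp
  finally show ?thesis by simp
qed

lemma block_point_eq:
  assumes \<xi>: "\<xi> \<in> carrier_vec r" and y: "y \<in> carrier_vec (n - r)"
  defines "\<eta> \<equiv> U *\<^sub>v y"
  shows "block_point \<xi> y = (\<delta> * complex_of_real (vec_norm2 \<xi> + vec_norm2 \<eta>) + (C *\<^sub>v \<eta>) \<bullet>c \<xi> - (D *\<^sub>v \<xi>) \<bullet>c \<eta>,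
     vec_norm2 \<xi> - vec_norm2 \<eta>)"
proof -
  have \<eta>: "\<eta> \<in> carrier_vec (n - r)" unfolding \<eta>_def by (rule mult_mat_vec_carrier[OF Uc y])
  have c: "C *\<^sub>v \<eta> \<in> carrier_vec r" "D *\<^sub>v \<xi> \<in> carrier_vec (n - r)" using C D \<xi> \<eta> by auto
  have "A *\<^sub>v (\<xi> @\<^sub>v \<eta>) = ((\<alpha> \<cdot>\<^sub>m 1\<^sub>m r) *\<^sub>v \<xi> + C *\<^sub>v \<eta>) @\<^sub>v (D *\<^sub>v \<xi> + (\<beta> \<cdot>\<^sub>m 1\<^sub>m (n - r)) *\<^sub>v \<eta>)"
    unfolding A by (rule four_block_mat_mult_vec) (use C D \<xi> \<eta> in auto)
  also have "(\<alpha> \<cdot>\<^sub>m 1\<^sub>m r) *\<^sub>v \<xi> = \<alpha> \<cdot>\<^sub>v \<xi>" using \<xi> by (simp add: smult_mat_mult_vec[of _ r r])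
  also have "(\<beta> \<cdot>\<^sub>m 1\<^sub>m (n - r)) *\<^sub>v \<eta> = \<beta> \<cdot>\<^sub>v \<eta>" using \<eta> by (simp add: smult_mat_mult_vec[of _ "n - r" "n - r"])
  finally have Ax: "A *\<^sub>v (\<xi> @\<^sub>v \<eta>) = (\<alpha> \<cdot>\<^sub>v \<xi> + C *\<^sub>v \<eta>) @\<^sub>v (D *\<^sub>v \<xi> + \<beta> \<cdot>\<^sub>v \<eta>)" .
  have "J_prod n r (A *\<^sub>v (\<xi> @\<^sub>v \<eta>)) (\<xi> @\<^sub>v \<eta>)
     = (\<alpha> \<cdot>\<^sub>v \<xi> + C *\<^sub>v \<eta>) \<bullet>c \<xi> - (D *\<^sub>v \<xi> + \<beta> \<cdot>\<^sub>v \<eta>) \<bullet>c \<eta>"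
    unfolding Ax by (rule J_prod_append) (use \<xi> \<eta> c in auto)
  also have "(\<alpha> \<cdot>\<^sub>v \<xi> + C *\<^sub>v \<eta>) \<bullet>c \<xi> = \<alpha> * complex_of_real (vec_norm2 \<xi>) + (C *\<^sub>v \<eta>) \<bullet>c \<xi>"
    using \<xi> c by (simp add: cscalar_prod_lin[of _ r] flip: cscalar_prod_self)
  also have "(D *\<^sub>v \<xi> + \<beta> \<cdot>\<^sub>v \<eta>) \<bullet>c \<eta> = (D *\<^sub>v \<xi>) \<bullet>c \<eta> + \<beta> * complex_of_real (vec_norm2 \<eta>)"
    using \<eta> c by (simp add: cscalar_prod_lin[of _ "n - r"] flip: cscalar_prod_self)
  finally have 1: "J_prod n r (A *\<^sub>v (\<xi> @\<^sub>v \<eta>)) (\<xi> @\<^sub>v \<eta>) = \<alpha> * complex_of_real (vec_norm2 \<xi>) + (C *\<^sub>v \<eta>) \<bullet>c \<xi>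
     - ((D *\<^sub>v \<xi>) \<bullet>c \<eta> + \<beta> * complex_of_real (vec_norm2 \<eta>))" .
  have 2: "J_prod n r (\<xi> @\<^sub>v \<eta>) (\<xi> @\<^sub>v \<eta>) = complex_of_real (vec_norm2 \<xi> - vec_norm2 \<eta>)"
    by (simp add: J_prod_append[OF \<xi> \<eta> \<xi> \<eta>] cscalar_prod_self)
  show ?thesis unfolding block_point_def \<eta>_def[symmetric] krein_point_def 1 2 Re_complex_of_real ctr_def \<delta>_def
    by (simp add: field_simps)
qed

lemma diagonal_form:
  assumes B: "B \<in> carrier_mat (n - r) (n - r)" and y: "y \<in> carrier_vec (n - r)"
    and Bd: "mat_adjoint U * B * U = Matrix.mat (n - r) (n - r) (\<lambda>(i,j). if i = j then b i else 0)"
  shows "(B *\<^sub>v (U *\<^sub>v y)) \<bullet>c (U *\<^sub>v y) = (\<Sum>j<n - r. b j * complex_of_real ((cmod (y $ j))\<^sup>2))"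
proof -
  let ?m = "n - r"
  have c: "U *\<^sub>v y \<in> carrier_vec ?m" "B *\<^sub>v (U *\<^sub>v y) \<in> carrier_vec ?m" using Uc B y by auto
  have Ua: "mat_adjoint U \<in> carrier_mat ?m ?m" using Uc by simp
  have "(B *\<^sub>v (U *\<^sub>v y)) \<bullet>c (U *\<^sub>v y) = (mat_adjoint U *\<^sub>v (B *\<^sub>v (U *\<^sub>v y))) \<bullet>c y"
    unfolding cscalar_prod_adjoint[OF Ua c(2) y] mat_adjoint_adjoint ..
  also have "mat_adjoint U *\<^sub>v (B *\<^sub>v (U *\<^sub>v y)) = (mat_adjoint U * B * U) *\<^sub>v y"
  proof -
    have Bc: "mat_adjoint U * B \<in> carrier_mat ?m ?m" using Ua B by auto
    show ?thesis unfolding assoc_mult_mat_vec[OF Bc Uc y] assoc_mult_mat_vec[OF Ua B c(1)] ..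
  qed
  also have "\<dots> = Matrix.vec ?m (\<lambda>i. b i * y $ i)"
    unfolding Bd using y
    by (intro eq_vecI) (simp_all add: scalar_prod_def if_distrib[of "\<lambda>x. x * _"] cong: if_cong)
  also have "\<dots> \<bullet>c y = (\<Sum>j<?m. b j * complex_of_real ((cmod (y $ j))\<^sup>2))"
    unfolding complex_norm_square using y by (simp add: scalar_prod_def atLeast0LessThan mult_ac)
  finally show ?thesis .
qed

lemma norm_U:
  assumes y: "y \<in> carrier_vec (n - r)"
  shows "vec_norm2 (U *\<^sub>v y) = (\<Sum>j<n - r. (cmod (y $ j))\<^sup>2)"
proof -
  have c: "U *\<^sub>v y \<in> carrier_vec (n - r)" using Uc y by auto
  have "mat_adjoint U * 1\<^sub>m (n - r) * U = Matrix.mat (n - r) (n - r) (\<lambda>(i,j). if i = j then 1 else 0)"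
  proof -
    have "Matrix.mat (n - r) (n - r) (\<lambda>(i,j). if i = j then 1 else 0) = (1\<^sub>m (n - r) :: complex mat)"
      by (rule eq_matI) auto
    moreover have "mat_adjoint U * 1\<^sub>m (n - r) = mat_adjoint U" using Uc by (intro right_mult_one_mat) auto
    ultimately show ?thesis using U by (simp add: unitary_matrix_def)
  qed
  from diagonal_form[OF one_carrier_mat y this]
  have "complex_of_real (vec_norm2 (U *\<^sub>v y)) = complex_of_real (\<Sum>j<n - r. (cmod (y $ j))\<^sup>2)"
    using c by (simp add: cscalar_prod_self)
  then show ?thesis by (simp only: of_real_eq_iff)
qed

text \<open>The only two ways in which $C$ and $D$ enter the computations below; both forms are diagonal in the basis $U$.\<close>
lemma norm_CD:
  assumes y: "y \<in> carrier_vec (n - r)"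
  defines "\<eta> \<equiv> U *\<^sub>v y"
  shows "vec_norm2 (C *\<^sub>v \<eta>) + vec_norm2 (mat_adjoint D *\<^sub>v \<eta>) = (\<Sum>j<n - r. h j * (cmod (y $ j))\<^sup>2)"
    and "(C *\<^sub>v \<eta>) \<bullet>c (mat_adjoint D *\<^sub>v \<eta>) = (\<Sum>j<n - r. z j * complex_of_real ((cmod (y $ j))\<^sup>2))"
proof -
  let ?m = "n - r"
  have \<eta>: "\<eta> \<in> carrier_vec ?m" using Uc y by (auto simp: \<eta>_def)
  have Ca: "mat_adjoint C \<in> carrier_mat ?m r" "mat_adjoint D \<in> carrier_mat r ?m" using C D by auto
  have c: "C *\<^sub>v \<eta> \<in> carrier_vec r" "mat_adjoint D *\<^sub>v \<eta> \<in> carrier_vec r" using C Ca \<eta> by auto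
  have "complex_of_real (vec_norm2 (C *\<^sub>v \<eta>) + vec_norm2 (mat_adjoint D *\<^sub>v \<eta>))
     = (mat_adjoint C *\<^sub>v (C *\<^sub>v \<eta>)) \<bullet>c \<eta> + (D *\<^sub>v (mat_adjoint D *\<^sub>v \<eta>)) \<bullet>c \<eta>"
    unfolding cscalar_prod_adjoint[OF Ca(1) c(1) \<eta>] mat_adjoint_adjoint cscalar_prod_adjoint[OF D c(2) \<eta>]
    by (simp add: cscalar_prod_self)
  also have "\<dots> = ((mat_adjoint C * C + D * mat_adjoint D) *\<^sub>v \<eta>) \<bullet>c \<eta>"
  proof -
    have "(mat_adjoint C * C + D * mat_adjoint D) *\<^sub>v \<eta> = mat_adjoint C *\<^sub>v (C *\<^sub>v \<eta>) + D *\<^sub>v (mat_adjoint D *\<^sub>v \<eta>)"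
    proof -
      have k: "mat_adjoint C * C \<in> carrier_mat ?m ?m" "D * mat_adjoint D \<in> carrier_mat ?m ?m" using Ca C D by auto
      show ?thesis unfolding add_mult_distrib_mat_vec[OF k \<eta>] assoc_mult_mat_vec[OF Ca(1) C \<eta>]
        assoc_mult_mat_vec[OF D Ca(2) \<eta>] ..
    qed
    moreover have "mat_adjoint C *\<^sub>v (C *\<^sub>v \<eta>) \<in> carrier_vec ?m" "D *\<^sub>v (mat_adjoint D *\<^sub>v \<eta>) \<in> carrier_vec ?m"
      using Ca D c by auto
    ultimately show ?thesis using \<eta> by (simp add: cscalar_prod_lin[of _ ?m])
  qed
  also have "\<dots> = (\<Sum>j<?m. complex_of_real (h j) * complex_of_real ((cmod (y $ j))\<^sup>2))"
    unfolding \<eta>_def by (rule diagonal_form[OF _ y Hd]) (use C D Ca in auto)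
  also have "\<dots> = complex_of_real (\<Sum>j<?m. h j * (cmod (y $ j))\<^sup>2)" by simp
  finally show "vec_norm2 (C *\<^sub>v \<eta>) + vec_norm2 (mat_adjoint D *\<^sub>v \<eta>) = (\<Sum>j<?m. h j * (cmod (y $ j))\<^sup>2)"
    by (simp only: of_real_eq_iff)
  have "(C *\<^sub>v \<eta>) \<bullet>c (mat_adjoint D *\<^sub>v \<eta>) = (D *\<^sub>v (C *\<^sub>v \<eta>)) \<bullet>c \<eta>"
    unfolding cscalar_prod_adjoint[OF D c(1) \<eta>] ..
  also have "D *\<^sub>v (C *\<^sub>v \<eta>) = (D * C) *\<^sub>v \<eta>" unfolding assoc_mult_mat_vec[OF D C \<eta>] ..
  also have "((D * C) *\<^sub>v \<eta>) \<bullet>c \<eta> = (\<Sum>j<?m. z j * complex_of_real ((cmod (y $ j))\<^sup>2))"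
    unfolding \<eta>_def by (rule diagonal_form[OF _ y Zd]) (use C D in auto)
  finally show "(C *\<^sub>v \<eta>) \<bullet>c (mat_adjoint D *\<^sub>v \<eta>) = (\<Sum>j<?m. z j * complex_of_real ((cmod (y $ j))\<^sup>2))" .
qed

lemma mixed_mult:
  assumes \<eta>: "\<eta> \<in> carrier_vec (n - r)"
  shows "mixed g *\<^sub>v \<eta> = (g / 2) \<cdot>\<^sub>v (C *\<^sub>v \<eta>) - (cnj g / 2) \<cdot>\<^sub>v (mat_adjoint D *\<^sub>v \<eta>)"
proof -
  have Da: "mat_adjoint D \<in> carrier_mat r (n - r)" using D by simp
  have "mixed g *\<^sub>v \<eta> = ((g / 2) \<cdot>\<^sub>m C) *\<^sub>v \<eta> - ((cnj g / 2) \<cdot>\<^sub>m mat_adjoint D) *\<^sub>v \<eta>"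
    unfolding mixed_def by (rule minus_mult_distrib_mat_vec) (use C Da \<eta> in auto)
  then show ?thesis unfolding smult_mat_mult_vec[OF C \<eta>] smult_mat_mult_vec[OF Da \<eta>] .
qed

lemma norm_mixed:
  assumes y: "y \<in> carrier_vec (n - r)"
  shows "vec_norm2 (mixed g *\<^sub>v (U *\<^sub>v y)) = (\<Sum>j<n - r. coupling j g * (cmod (y $ j))\<^sup>2)"
proof -
  let ?m = "n - r"
  define \<eta> where "\<eta> = U *\<^sub>v y"
  have \<eta>: "\<eta> \<in> carrier_vec ?m" using Uc y by (auto simp: \<eta>_def)
  define a b where ab: "a = C *\<^sub>v \<eta>" "b = mat_adjoint D *\<^sub>v \<eta>"
  have c: "a \<in> carrier_vec r" "b \<in> carrier_vec r"
    unfolding ab using mult_mat_vec_carrier[OF C \<eta>] mult_mat_vec_carrier[OF mat_adjoint_carrier[OF D] \<eta>] by auto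
  define q where "q = a \<bullet>c b"
  have ba: "b \<bullet>c a = cnj q" unfolding q_def cscalar_prod_cnj[OF c] ..
  let ?u = "(g / 2) \<cdot>\<^sub>v a" and ?v = "(cnj g / 2) \<cdot>\<^sub>v b"
  have uv: "?u \<in> carrier_vec r" "?v \<in> carrier_vec r" "?u - ?v \<in> carrier_vec r" using c by auto
  have "(?u - ?v) \<bullet>c (?u - ?v) = (g / 2) * cnj (g / 2) * (a \<bullet>c a) - (g / 2) * cnj (cnj g / 2) * (a \<bullet>c b)
      - (cnj g / 2) * cnj (g / 2) * (b \<bullet>c a) + (cnj g / 2) * cnj (cnj g / 2) * (b \<bullet>c b)"
    unfolding cscalar_prod_lin(3)[OF uv] cscalar_prod_lin(4)[OF uv(1,2,1)] cscalar_prod_lin(4)[OF uv(1,2,2)]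
      cscalar_prod_lin(5)[OF c(1) c(1) uv(1)] cscalar_prod_lin(5)[OF c(1) c(1) uv(2)]
      cscalar_prod_lin(5)[OF c(2) c(2) uv(1)] cscalar_prod_lin(5)[OF c(2) c(2) uv(2)]
      cscalar_prod_lin(6)[OF c(1) c(1) c(1)] cscalar_prod_lin(6)[OF c(1) c(1) c(2)]
      cscalar_prod_lin(6)[OF c(2) c(2) c(1)] cscalar_prod_lin(6)[OF c(2) c(2) c(2)]
    by (simp add: algebra_simps)
  also have "\<dots> = complex_of_real (((cmod g)\<^sup>2 * (vec_norm2 a + vec_norm2 b) - 2 * Re (q * g\<^sup>2)) / 4)"
    unfolding ba cscalar_prod_self q_def[symmetric] cmod_power2
    by (simp add: complex_eq_iff power2_eq_square field_simps)
  finally have "complex_of_real (vec_norm2 (mixed g *\<^sub>v \<eta>)) = complex_of_real (((cmod g)\<^sup>2 * (vec_norm2 a + vec_norm2 b) - 2 * Re (q * g\<^sup>2)) / 4)"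
    unfolding cscalar_prod_self[symmetric] mixed_mult[OF \<eta>] ab .
  then have "vec_norm2 (mixed g *\<^sub>v \<eta>) = ((cmod g)\<^sup>2 * (vec_norm2 a + vec_norm2 b) - 2 * Re (q * g\<^sup>2)) / 4"
    by (simp only: of_real_eq_iff)
  also have "vec_norm2 a + vec_norm2 b = (\<Sum>j<?m. h j * (cmod (y $ j))\<^sup>2)" unfolding ab \<eta>_def by (rule norm_CD[OF y])
  also have "q = (\<Sum>j<?m. z j * complex_of_real ((cmod (y $ j))\<^sup>2))" unfolding q_def ab \<eta>_def by (rule norm_CD[OF y])
  also have "((cmod g)\<^sup>2 * (\<Sum>j<?m. h j * (cmod (y $ j))\<^sup>2) - 2 * Re ((\<Sum>j<?m. z j * complex_of_real ((cmod (y $ j))\<^sup>2)) * g\<^sup>2)) / 4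
      = (\<Sum>j<?m. coupling j g * (cmod (y $ j))\<^sup>2)"
    unfolding sum_distrib_left sum_distrib_right Re_sum sum_subtractf[symmetric] sum_divide_distrib coupling_def
    by (intro sum.cong refl) (simp add: algebra_simps diff_divide_distrib)
  finally show ?thesis unfolding \<eta>_def .
qed

text \<open>The point of the vector $(-aX\<eta>, \<eta>)$, where $X$ is \<open>mixed g\<close> and $\<eta>$ is the $j$-th column of $U$.\<close>
abbreviation tangent_point :: "real \<Rightarrow> complex \<Rightarrow> nat \<Rightarrow> complex \<times> real" where
  "tangent_point a g j \<equiv>
     (\<delta> * complex_of_real (a\<^sup>2 * coupling j g + 1) + complex_of_real a * (g * z j - cnj g * complex_of_real (h j) / 2),
      a\<^sup>2 * coupling j g - 1)"

text \<open>Moving $D$ to the other side of the inner product and conjugating merges both off-diagonal terms into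
\<open>mixed g\<close>.\<close>
lemma functional_block_point:
  fixes g :: complex
  assumes \<xi>: "\<xi> \<in> carrier_vec r" and y: "y \<in> carrier_vec (n - r)"
  defines "\<eta> \<equiv> U *\<^sub>v y" and "p \<equiv> Re (g * \<delta>)"
  shows "Re (g * fst (block_point \<xi> y)) - \<mu> * snd (block_point \<xi> y)
    = (p - \<mu>) * vec_norm2 \<xi> + (p + \<mu>) * vec_norm2 \<eta> + 2 * Re ((mixed g *\<^sub>v \<eta>) \<bullet>c \<xi>)"
proof -
  have \<eta>: "\<eta> \<in> carrier_vec (n - r)" using Uc y by (auto simp: \<eta>_def)
  have Da: "mat_adjoint D \<in> carrier_mat r (n - r)" using D by simp
  have c: "C *\<^sub>v \<eta> \<in> carrier_vec r" "mat_adjoint D *\<^sub>v \<eta> \<in> carrier_vec r" "(g / 2) \<cdot>\<^sub>v (C *\<^sub>v \<eta>) \<in> carrier_vec r"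
    "(cnj g / 2) \<cdot>\<^sub>v (mat_adjoint D *\<^sub>v \<eta>) \<in> carrier_vec r" using C Da \<eta> by auto
  have mixed: "(mixed g *\<^sub>v \<eta>) \<bullet>c \<xi> = (g / 2) * ((C *\<^sub>v \<eta>) \<bullet>c \<xi>) - (cnj g / 2) * ((mat_adjoint D *\<^sub>v \<eta>) \<bullet>c \<xi>)"
    unfolding mixed_mult[OF \<eta>] cscalar_prod_lin(3)[OF c(3,4) \<xi>] cscalar_prod_lin(5)[OF c(1) c(1) \<xi>]
      cscalar_prod_lin(5)[OF c(2) c(2) \<xi>] ..
  have D': "(mat_adjoint D *\<^sub>v \<eta>) \<bullet>c \<xi> = cnj ((D *\<^sub>v \<xi>) \<bullet>c \<eta>)"
    unfolding cscalar_prod_adjoint[OF D \<xi> \<eta>] cscalar_prod_cnj[OF \<xi> c(2)] ..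
  show ?thesis unfolding block_point_eq[OF \<xi> y] \<eta>_def[symmetric] mixed D' p_def fst_conv snd_conv
    by (simp add: algebra_simps)
qed

text \<open>If the first component is a real multiple of \<open>mixed g\<close> applied to the second one, all inner products reduce to the
two forms of \<open>norm_CD\<close>. These are diagonal, and the point splits into one contribution for each $j$.\<close>
lemma block_point_tangent:
  fixes g :: complex
  assumes y: "y \<in> carrier_vec (n - r)"
  defines "\<eta> \<equiv> U *\<^sub>v y"
  shows "block_point (complex_of_real (- a) \<cdot>\<^sub>v (mixed g *\<^sub>v \<eta>)) y = (\<Sum>j<n - r. (cmod (y $ j))\<^sup>2 *\<^sub>R
     tangent_point a g j)"
proof -
  let ?m = "n - r"
  have \<eta>: "\<eta> \<in> carrier_vec ?m" using Uc y by (auto simp: \<eta>_def)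
  have Da: "mat_adjoint D \<in> carrier_mat r ?m" using D by simp
  define v where "v = mixed g *\<^sub>v \<eta>"
  have v: "v \<in> carrier_vec r" unfolding v_def by (rule mult_mat_vec_carrier[OF mixed_carrier \<eta>])
  define a1 b1 where ab: "a1 = C *\<^sub>v \<eta>" "b1 = mat_adjoint D *\<^sub>v \<eta>"
  have c: "a1 \<in> carrier_vec r" "b1 \<in> carrier_vec r" using C Da \<eta> by (auto simp: ab)
  define q where "q = a1 \<bullet>c b1"
  have ba: "b1 \<bullet>c a1 = cnj q" unfolding q_def cscalar_prod_cnj[OF c] ..
  let ?u = "(g / 2) \<cdot>\<^sub>v a1" and ?v = "(cnj g / 2) \<cdot>\<^sub>v b1"
  have uv: "?u \<in> carrier_vec r" "?v \<in> carrier_vec r" using c by auto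
  have vuv: "v = ?u - ?v" unfolding v_def mixed_mult[OF \<eta>] ab ..
  have Cv: "a1 \<bullet>c v = cnj (g / 2) * complex_of_real (vec_norm2 a1) - g / 2 * q"
    unfolding vuv cscalar_prod_lin(4)[OF uv c(1)] cscalar_prod_lin(6)[OF c(1) c(1) c(1)] cscalar_prod_lin(6)[OF c(2) c(2) c(1)]
      cscalar_prod_self q_def by simp
  have "(D *\<^sub>v v) \<bullet>c \<eta> = v \<bullet>c b1" unfolding cscalar_prod_adjoint[OF D v \<eta>] ab ..
  also have "\<dots> = g / 2 * q - cnj g / 2 * complex_of_real (vec_norm2 b1)"
    unfolding vuv cscalar_prod_lin(3)[OF uv c(2)] cscalar_prod_lin(5)[OF c(1) c(1) c(2)] cscalar_prod_lin(5)[OF c(2) c(2) c(2)]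
      cscalar_prod_self q_def ..
  finally have Dv: "(D *\<^sub>v v) \<bullet>c \<eta> = g / 2 * q - cnj g / 2 * complex_of_real (vec_norm2 b1)" .
  let ?\<xi> = "complex_of_real (- a) \<cdot>\<^sub>v v"
  have \<xi>: "?\<xi> \<in> carrier_vec r" using v by auto
  have n\<xi>: "vec_norm2 ?\<xi> = a\<^sup>2 * vec_norm2 v"
    by (simp add: vec_norm2_def norm_mult power_mult_distrib sum_distrib_left)
  have C\<xi>: "a1 \<bullet>c ?\<xi> = complex_of_real (- a) * (a1 \<bullet>c v)"
    unfolding cscalar_prod_lin(6)[OF v v c(1)] by simp
  have D\<xi>: "(D *\<^sub>v ?\<xi>) \<bullet>c \<eta> = complex_of_real (- a) * ((D *\<^sub>v v) \<bullet>c \<eta>)"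
  proof -
    have "D *\<^sub>v v \<in> carrier_vec ?m" using D v by auto
    then show ?thesis unfolding mult_mat_vec[OF D v] by (intro cscalar_prod_lin(5)[OF _ _ \<eta>])
  qed
  have "block_point ?\<xi> y = (\<delta> * complex_of_real (a\<^sup>2 * vec_norm2 v + vec_norm2 \<eta>)
     + complex_of_real a * (g * q - cnj g * complex_of_real (vec_norm2 a1 + vec_norm2 b1) / 2),
     a\<^sup>2 * vec_norm2 v - vec_norm2 \<eta>)"
    unfolding block_point_eq[OF \<xi> y] \<eta>_def[symmetric] ab(1)[symmetric] n\<xi> C\<xi> D\<xi> Cv Dv
    by (simp add: field_simps)
  also have "vec_norm2 v = (\<Sum>j<?m. coupling j g * (cmod (y $ j))\<^sup>2)" unfolding v_def \<eta>_def by (rule norm_mixed[OF y])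
  also have "vec_norm2 \<eta> = (\<Sum>j<?m. (cmod (y $ j))\<^sup>2)" unfolding \<eta>_def by (rule norm_U[OF y])
  also have "vec_norm2 a1 + vec_norm2 b1 = (\<Sum>j<?m. h j * (cmod (y $ j))\<^sup>2)" unfolding ab \<eta>_def by (rule norm_CD[OF y])
  also have "q = (\<Sum>j<?m. z j * complex_of_real ((cmod (y $ j))\<^sup>2))" unfolding q_def ab \<eta>_def by (rule norm_CD[OF y])
  finally have "block_point ?\<xi> y = (\<delta> * complex_of_real (a\<^sup>2 * (\<Sum>j<?m. coupling j g * (cmod (y $ j))\<^sup>2) + (\<Sum>j<?m. (cmod (y $ j))\<^sup>2))
     + complex_of_real a * (g * (\<Sum>j<?m. z j * complex_of_real ((cmod (y $ j))\<^sup>2)) - cnj g * complex_of_real (\<Sum>j<?m. h j * (cmod (y $ j))\<^sup>2) / 2),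
     a\<^sup>2 * (\<Sum>j<?m. coupling j g * (cmod (y $ j))\<^sup>2) - (\<Sum>j<?m. (cmod (y $ j))\<^sup>2))" .
  also have "\<dots> = (\<Sum>j<?m. (cmod (y $ j))\<^sup>2 *\<^sub>R
     tangent_point a g j)"
    unfolding prod_eq_iff fst_sum snd_sum
    by (simp add: sum_distrib_left sum_distrib_right sum.distrib sum_subtractf sum_divide_distrib
        scaleR_conv_of_real algebra_simps)
  finally show ?thesis unfolding v_def .
qed

definition pairing :: "complex \<Rightarrow> real \<Rightarrow> complex \<times> real \<Rightarrow> real" where
  "pairing g \<mu> \<kappa> = Re (g * fst \<kappa>) - \<mu> * snd \<kappa>"

lemma kcone_add: "\<kappa> \<in> kcone \<Longrightarrow> \<kappa>' \<in> kcone \<Longrightarrow> \<kappa> + \<kappa>' \<in> kcone"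
  unfolding kcone_def using krein_cone_add[OF less_imp_le[OF rn] A_carrier] .

lemma kcone_scale: "\<kappa> \<in> kcone \<Longrightarrow> 0 \<le> t \<Longrightarrow> t *\<^sub>R \<kappa> \<in> kcone"
  unfolding kcone_def using krein_cone_scale[OF less_imp_le[OF rn] A_carrier] .

lemma block_point_zero:
  assumes "\<xi> \<in> carrier_vec r"
  shows "block_point \<xi> (0\<^sub>v (n - r)) = vec_norm2 \<xi> *\<^sub>R (\<delta>, 1)"
proof -
  have U0: "U *\<^sub>v 0\<^sub>v (n - r) = 0\<^sub>v (n - r)" using Uc by (intro eq_vecI) auto
  have C0: "C *\<^sub>v 0\<^sub>v (n - r) = 0\<^sub>v r" using C by (intro eq_vecI) auto
  have "D *\<^sub>v \<xi> \<in> carrier_vec (n - r)" using D assms by auto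
  then have "(D *\<^sub>v \<xi>) \<bullet>c 0\<^sub>v (n - r) = 0" by (simp add: scalar_prod_def)
  moreover have "vec_norm2 (0\<^sub>v (n - r)) = 0" by (simp add: vec_norm2_def)
  ultimately show ?thesis using assms by (simp add: block_point_eq U0 C0 scaleR_conv_of_real mult.commute)
qed

lemma alpha_in_kcone: "(\<delta>, 1) \<in> kcone"
proof -
  have "vec_norm2 (unit_vec r 0) = (\<Sum>i<r. if i = 0 then 1 else 0)"
    unfolding vec_norm2_def by (intro sum.cong) auto
  then have "vec_norm2 (unit_vec r 0) = 1" using r0 by simp
  then have "(\<delta>, 1) = block_point (unit_vec r 0) (0\<^sub>v (n - r))" using block_point_zero[of "unit_vec r 0"] by simp
  then show ?thesis unfolding kcone_iff by (intro bexI[of _ "unit_vec r 0"] bexI[of _ "0\<^sub>v (n - r)"]) auto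
qed

lemma zero_in_kcone: "0 \<in> kcone"
  using kcone_scale[OF alpha_in_kcone, of 0] by (simp add: zero_prod_def)

text \<open>The gradient of the difference in \<open>line_form_coupling\<close>; the square contributes the first summand.\<close>
lemma polar_coupling:
  "lpolar j g = complex_of_real (2 * Re (g * \<delta>)) * \<delta> + (g * z j - cnj g * complex_of_real (h j) / 2)"
  unfolding polar_def focal_sq_def axis_diff_def cmod_power2
  by (simp add: complex_eq_iff power2_eq_square algebra_simps)

lemma sum_unit_vec:
  assumes "j < n - r"
  shows "(\<Sum>i<n - r. (cmod ((complex_of_real t \<cdot>\<^sub>v unit_vec (n - r) j) $ i))\<^sup>2 *\<^sub>R (f i :: 'a :: real_vector)) = t\<^sup>2 *\<^sub>R f j"
proof -
  have "(\<Sum>i<n - r. (cmod ((complex_of_real t \<cdot>\<^sub>v unit_vec (n - r) j) $ i))\<^sup>2 *\<^sub>R f i)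
     = (\<Sum>i<n - r. if i = j then t\<^sup>2 *\<^sub>R f j else 0)"
    by (intro sum.cong) (auto simp: unit_vec_def)
  then show ?thesis using assms by simp
qed

lemma coupling_vec:
  assumes "j < n - r"
  shows "vec_norm2 (mixed g *\<^sub>v (U *\<^sub>v unit_vec (n - r) j)) = coupling j g"
proof -
  have "vec_norm2 (mixed g *\<^sub>v (U *\<^sub>v (complex_of_real 1 \<cdot>\<^sub>v unit_vec (n - r) j))) = coupling j g"
    using sum_unit_vec[OF assms, of 1 "\<lambda>i. coupling i g"] by (subst norm_mixed) (auto simp: mult.commute)
  moreover have "complex_of_real 1 \<cdot>\<^sub>v unit_vec (n - r) j = unit_vec (n - r) j" by (intro eq_vecI) auto
  ultimately show ?thesis by simp
qed

lemma coupling_nonneg: "j < n - r \<Longrightarrow> 0 \<le> coupling j g"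
  using coupling_vec[of j g] vec_norm2_nonneg by metis

text \<open>On the conic the coupling equals $(p - \<mu>)(p + \<mu>)$ with $p = \<Re>(g \<delta>)$, and $a = 1/(p - \<mu>)$ is the multiple that makes
$(-aX\<eta>, \<eta>)$ a kernel vector of the Hermitian form.\<close>
lemma tangent_direction:
  assumes q: "lform j g = \<mu>\<^sup>2" and ne: "Re (g * \<delta>) \<noteq> \<mu>"
  defines "a \<equiv> 1 / (Re (g * \<delta>) - \<mu>)"
  shows "tangent_point a g j = a *\<^sub>R (lpolar j g, 2 * \<mu>)"
proof -
  define p where "p = Re (g * \<delta>)"
  have a: "a = 1 / (p - \<mu>)" "p \<noteq> \<mu>" using ne by (auto simp: a_def p_def)
  have "coupling j g = (p - \<mu>) * (p + \<mu>)" using q line_form_coupling[of j g] by (simp add: p_def power2_eq_square algebra_simps)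
  moreover have one: "a * (p - \<mu>) = 1" using a by simp
  ultimately have "a\<^sup>2 * coupling j g = a * (p + \<mu>)" by (simp add: power2_eq_square)
  then have "a\<^sup>2 * coupling j g + 1 = a * (p + \<mu>) + a * (p - \<mu>)" "a\<^sup>2 * coupling j g - 1 = a * (p + \<mu>) - a * (p - \<mu>)"
    by (simp_all only: one)
  then have "a\<^sup>2 * coupling j g + 1 = a * (2 * p)" "a\<^sup>2 * coupling j g - 1 = a * (2 * \<mu>)"
    by (simp_all add: algebra_simps)
  then show ?thesis unfolding polar_coupling p_def[symmetric] by (simp add: scaleR_conv_of_real algebra_simps)
qed

text \<open>The point is that of the kernel vector $(-X\<eta>, (p - \<mu>)\<eta>)$, where $\<eta>$ is the $j$-th column of $U$.\<close>
lemma tangent_in_kcone: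
  assumes j: "j < n - r" and q: "lform j g = \<mu>\<^sup>2"
  shows "(Re (g * \<delta>) - \<mu>) *\<^sub>R (lpolar j g, 2 * \<mu>) \<in> kcone"
proof (cases "Re (g * \<delta>) = \<mu>")
  case True
  then show ?thesis using zero_in_kcone by (simp add: zero_prod_def)
next
  case False
  define t where "t = Re (g * \<delta>) - \<mu>"
  have t: "t \<noteq> 0" using False by (simp add: t_def)
  let ?y = "complex_of_real t \<cdot>\<^sub>v unit_vec (n - r) j"
  let ?\<xi> = "complex_of_real (- (1 / t)) \<cdot>\<^sub>v (mixed g *\<^sub>v (U *\<^sub>v ?y))"
  have y: "?y \<in> carrier_vec (n - r)" by simp
  have \<xi>: "?\<xi> \<in> carrier_vec r"
    using mixed_U_carrier[OF y] by simp
  have "block_point ?\<xi> ?y = t\<^sup>2 *\<^sub>R ((1 / t) *\<^sub>R (lpolar j g, 2 * \<mu>))"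
    by (simp only: block_point_tangent[OF y] sum_unit_vec[OF j] tangent_direction[OF q False, folded t_def])
  also have "\<dots> = t *\<^sub>R (lpolar j g, 2 * \<mu>)" using t by (simp add: power2_eq_square)
  finally show ?thesis unfolding t_def[symmetric] kcone_iff using \<xi> y by (metis (no_types, lifting))
qed

text \<open>If the coupling is $0$, then \<open>mixed g\<close> annihilates the $j$-th column of $U$. The vector in \<open>block_point_tangent\<close> no longer
depends on $a$, and comparing $a = 0$ with $a = 1$ gives the claim.\<close>
lemma polar_uncoupled:
  assumes j: "j < n - r" and c: "coupling j g = 0"
  shows "lpolar j g = complex_of_real (2 * Re (g * \<delta>)) * \<delta>"
proof -
  let ?y = "complex_of_real 1 \<cdot>\<^sub>v unit_vec (n - r) j"
  have y: "?y \<in> carrier_vec (n - r)" by simp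
  have v: "mixed g *\<^sub>v (U *\<^sub>v ?y) \<in> carrier_vec r" by (rule mixed_U_carrier[OF y])
  have "complex_of_real 1 \<cdot>\<^sub>v unit_vec (n - r) j = unit_vec (n - r) j" by (intro eq_vecI) auto
  then have "mixed g *\<^sub>v (U *\<^sub>v ?y) = 0\<^sub>v r" using coupling_vec[OF j, of g] c vec_norm2_eq_0[OF v] by simp
  then have "complex_of_real (- a) \<cdot>\<^sub>v (mixed g *\<^sub>v (U *\<^sub>v ?y)) = 0\<^sub>v r" for a by (auto intro!: eq_vecI)
  then have "block_point (0\<^sub>v r) ?y = tangent_point a g j" for a
    using block_point_tangent[OF y, of a g] unfolding sum_unit_vec[OF j] by simp
  from this[of 0] this[of 1] have "g * z j - cnj g * complex_of_real (h j) / 2 = 0" by (simp add: c)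
  then show ?thesis by (simp add: polar_coupling)
qed

text \<open>Completing the square in the first component. The remainder is diagonal in the coefficients of the second one,
and its weights \<open>lform j g - \<mu>\<^sup>2\<close> are the values of the $n - r$ line equations.\<close>
lemma pairing_square:
  fixes g :: complex and \<mu> :: real
  assumes \<xi>: "\<xi> \<in> carrier_vec r" and y: "y \<in> carrier_vec (n - r)"
  defines "p \<equiv> Re (g * \<delta>)"
  shows "(p - \<mu>) * pairing g \<mu> (block_point \<xi> y)
    = vec_norm2 (complex_of_real (p - \<mu>) \<cdot>\<^sub>v \<xi> + mixed g *\<^sub>v (U *\<^sub>v y))
      + (\<Sum>j<n - r. (lform j g - \<mu>\<^sup>2) * (cmod (y $ j))\<^sup>2)"
proof -
  define v where "v = mixed g *\<^sub>v (U *\<^sub>v y)"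
  have v: "v \<in> carrier_vec r" unfolding v_def by (rule mixed_U_carrier[OF y])
  define e where "e = complex_of_real (p - \<mu>)"
  have e\<xi>: "e \<cdot>\<^sub>v \<xi> \<in> carrier_vec r" "e \<cdot>\<^sub>v \<xi> + v \<in> carrier_vec r" using \<xi> v by auto
  have "complex_of_real (vec_norm2 (e \<cdot>\<^sub>v \<xi> + v)) = complex_of_real ((p - \<mu>)\<^sup>2 * vec_norm2 \<xi> + 2 * (p - \<mu>) * Re (v \<bullet>c \<xi>) + vec_norm2 v)"
  proof -
    have "\<xi> \<bullet>c v = cnj (v \<bullet>c \<xi>)" using cscalar_prod_cnj[OF v \<xi>] by simp
    then have "complex_of_real (vec_norm2 (e \<cdot>\<^sub>v \<xi> + v)) = e * cnj e * complex_of_real (vec_norm2 \<xi>) + e * cnj (v \<bullet>c \<xi>) + cnj e * (v \<bullet>c \<xi>) + complex_of_real (vec_norm2 v)"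
      unfolding cscalar_prod_self[symmetric] cscalar_prod_lin(1)[OF e\<xi>(1) v e\<xi>(2)] cscalar_prod_lin(2)[OF e\<xi>(1) v e\<xi>(1)]
        cscalar_prod_lin(2)[OF e\<xi>(1) v v] cscalar_prod_lin(5)[OF \<xi> \<xi> e\<xi>(1)] cscalar_prod_lin(5)[OF \<xi> \<xi> v]
        cscalar_prod_lin(6)[OF \<xi> \<xi> \<xi>] cscalar_prod_lin(6)[OF \<xi> \<xi> v] by (simp add: algebra_simps)
    then show ?thesis by (simp add: e_def complex_eq_iff power2_eq_square algebra_simps)
  qed
  then have 1: "vec_norm2 (e \<cdot>\<^sub>v \<xi> + v) = (p - \<mu>)\<^sup>2 * vec_norm2 \<xi> + 2 * (p - \<mu>) * Re (v \<bullet>c \<xi>) + vec_norm2 v"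
    by (simp only: of_real_eq_iff)
  have 2: "(\<Sum>j<n - r. (lform j g - \<mu>\<^sup>2) * (cmod (y $ j))\<^sup>2) = (p\<^sup>2 - \<mu>\<^sup>2) * vec_norm2 (U *\<^sub>v y) - vec_norm2 v"
    unfolding v_def norm_mixed[OF y] norm_U[OF y] line_form_coupling p_def[symmetric] sum_distrib_left sum_subtractf[symmetric]
    by (intro sum.cong) (auto simp: algebra_simps)
  show ?thesis
    unfolding pairing_def functional_block_point[OF \<xi> y] p_def[symmetric] v_def[symmetric] e_def[symmetric] 1 2
    by (simp add: power2_eq_square algebra_simps)
qed

lemma pairing_uncoupled:
  assumes p: "Re (g * \<delta>) = \<mu>" and c: "\<And>j. j < n - r \<Longrightarrow> coupling j g \<le> 0"
    and \<xi>: "\<xi> \<in> carrier_vec r" and y: "y \<in> carrier_vec (n - r)"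
  shows "pairing g \<mu> (block_point \<xi> y) = 2 * \<mu> * vec_norm2 (U *\<^sub>v y)"
proof -
  define v where "v = mixed g *\<^sub>v (U *\<^sub>v y)"
  have v: "v \<in> carrier_vec r" unfolding v_def by (rule mixed_U_carrier[OF y])
  have "vec_norm2 v \<le> 0" unfolding v_def norm_mixed[OF y]
    by (intro sum_nonpos) (simp add: c mult_nonpos_nonneg)
  then have "v = 0\<^sub>v r" using vec_norm2_nonneg[of v] vec_norm2_eq_0[OF v] by simp
  then show ?thesis unfolding pairing_def functional_block_point[OF \<xi> y] p v_def[symmetric] using \<xi> by simp
qed

lemma pairing_nonnegI:
  assumes p: "\<bar>\<mu>\<bar> \<le> Re (g * \<delta>)" and q: "\<And>j. j < n - r \<Longrightarrow> \<mu>\<^sup>2 \<le> lform j g"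
    and k: "\<kappa> \<in> kcone"
  shows "0 \<le> pairing g \<mu> \<kappa>"
proof -
  obtain \<xi> y where x: "\<xi> \<in> carrier_vec r" "y \<in> carrier_vec (n - r)" "\<kappa> = block_point \<xi> y" using k by (auto simp: kcone_iff)
  show ?thesis
  proof (cases "Re (g * \<delta>) = \<mu>")
    case True
    have "coupling j g \<le> 0" if "j < n - r" for j using q[OF that] line_form_coupling[of j g] True by simp
    then have "pairing g \<mu> \<kappa> = 2 * \<mu> * vec_norm2 (U *\<^sub>v y)" unfolding x(3) using pairing_uncoupled[OF True _ x(1,2)] by blast
    moreover have "0 \<le> \<mu>" using True p by linarith
    ultimately show ?thesis by (simp add: vec_norm2_nonneg)
  next
    case False
    then have pos: "0 < Re (g * \<delta>) - \<mu>" using p by linarith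
    have "0 \<le> (Re (g * \<delta>) - \<mu>) * pairing g \<mu> \<kappa>"
      unfolding x(3) pairing_square[OF x(1,2)]
      by (intro add_nonneg_nonneg vec_norm2_nonneg sum_nonneg mult_nonneg_nonneg) (simp_all add: q)
    then show ?thesis using pos by (simp add: zero_le_mult_iff)
  qed
qed

text \<open>Testing with the minimizing first component shows that all weights in \<open>pairing_square\<close> are nonnegative. Hence both
summands vanish at the given point: the first one determines $\<xi>$, the second one allows only those indices whose
conic has the given line as a tangent.\<close>
lemma kernel_decomposition:
  assumes nn: "\<And>\<kappa>. \<kappa> \<in> kcone \<Longrightarrow> 0 \<le> pairing g \<mu> \<kappa>"
    and k: "\<kappa> \<in> kcone" and z0: "pairing g \<mu> \<kappa> = 0" and p: "\<mu> < Re (g * \<delta>)"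
  shows "\<exists>c. (\<forall>j<n - r. 0 \<le> c j \<and> (c j \<noteq> 0 \<longrightarrow> lform j g = \<mu>\<^sup>2))
    \<and> \<kappa> = (\<Sum>j<n - r. c j *\<^sub>R (lpolar j g, 2 * \<mu>))"
proof -
  define t where "t = Re (g * \<delta>) - \<mu>"
  have t: "0 < t" using p by (simp add: t_def)
  obtain \<xi> y where x: "\<xi> \<in> carrier_vec r" "y \<in> carrier_vec (n - r)" "\<kappa> = block_point \<xi> y" using k by (auto simp: kcone_iff)
  have q: "\<mu>\<^sup>2 \<le> lform j g" if j: "j < n - r" for j
  proof -
    let ?y = "complex_of_real 1 \<cdot>\<^sub>v unit_vec (n - r) j"
    let ?\<xi> = "complex_of_real (- (1 / t)) \<cdot>\<^sub>v (mixed g *\<^sub>v (U *\<^sub>v ?y))"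
    have y: "?y \<in> carrier_vec (n - r)" by simp
    have v: "mixed g *\<^sub>v (U *\<^sub>v ?y) \<in> carrier_vec r" by (rule mixed_U_carrier[OF y])
    have \<xi>: "?\<xi> \<in> carrier_vec r" using v by simp
    have "complex_of_real t \<cdot>\<^sub>v (complex_of_real (- (1 / t)) \<cdot>\<^sub>v v) + v = 0\<^sub>v r" if "v \<in> carrier_vec r" for v
      using that t by (intro eq_vecI) auto
    from this[OF v] have "complex_of_real t \<cdot>\<^sub>v ?\<xi> + mixed g *\<^sub>v (U *\<^sub>v ?y) = 0\<^sub>v r" .
    then have "t * pairing g \<mu> (block_point ?\<xi> ?y) = (\<Sum>j<n - r. (cmod (?y $ j))\<^sup>2 *\<^sub>R (lform j g - \<mu>\<^sup>2))"
      using pairing_square[OF \<xi> y, of g \<mu>] unfolding t_def[symmetric] by (simp add: vec_norm2_def mult.commute)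
    also have "\<dots> = lform j g - \<mu>\<^sup>2" unfolding sum_unit_vec[OF j] by simp
    finally have "lform j g - \<mu>\<^sup>2 = t * pairing g \<mu> (block_point ?\<xi> ?y)" by simp
    moreover have "0 \<le> pairing g \<mu> (block_point ?\<xi> ?y)" using nn kcone_iff \<xi> y by blast
    ultimately show ?thesis using t by (metis diff_ge_0_iff_ge less_imp_le mult_nonneg_nonneg)
  qed
  let ?v = "mixed g *\<^sub>v (U *\<^sub>v y)"
  have v: "?v \<in> carrier_vec r" by (rule mixed_U_carrier[OF x(2)])
  have e: "complex_of_real t \<cdot>\<^sub>v \<xi> + ?v \<in> carrier_vec r" using v x by simp
  have "0 = vec_norm2 (complex_of_real t \<cdot>\<^sub>v \<xi> + ?v) + (\<Sum>j<n - r. (lform j g - \<mu>\<^sup>2) * (cmod (y $ j))\<^sup>2)"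
    using pairing_square[OF x(1,2), of g \<mu>] z0 unfolding t_def[symmetric] x(3) by simp
  moreover have s: "0 \<le> (\<Sum>j<n - r. (lform j g - \<mu>\<^sup>2) * (cmod (y $ j))\<^sup>2)"
    using q by (intro sum_nonneg mult_nonneg_nonneg) auto
  ultimately have n0: "vec_norm2 (complex_of_real t \<cdot>\<^sub>v \<xi> + ?v) = 0"
    and s0: "(\<Sum>j<n - r. (lform j g - \<mu>\<^sup>2) * (cmod (y $ j))\<^sup>2) = 0"
    using vec_norm2_nonneg[of "complex_of_real t \<cdot>\<^sub>v \<xi> + ?v"] by linarith+
  have y0: "y $ j = 0 \<or> lform j g = \<mu>\<^sup>2" if "j < n - r" for j
    using s0 q that by (subst (asm) sum_nonneg_eq_0_iff) auto
  have \<xi>: "\<xi> = complex_of_real (- (1 / t)) \<cdot>\<^sub>v ?v"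
  proof -
    have z: "complex_of_real t \<cdot>\<^sub>v \<xi> + ?v = 0\<^sub>v r" using n0 vec_norm2_eq_0[OF e] by simp
    have "\<xi> = complex_of_real (- (1 / t)) \<cdot>\<^sub>v w" if w: "w \<in> carrier_vec r" and z: "complex_of_real t \<cdot>\<^sub>v \<xi> + w = 0\<^sub>v r" for w
    proof (rule eq_vecI)
      fix i assume "i < dim_vec (complex_of_real (- (1 / t)) \<cdot>\<^sub>v w)"
      then have i: "i < r" using w by simp
      then have "complex_of_real t * \<xi> $ i + w $ i = 0" using arg_cong[OF z, of "\<lambda>u. u $ i"] w x by simp
      then have "w $ i = - (complex_of_real t * \<xi> $ i)" by (simp add: eq_neg_iff_add_eq_0 add.commute)
      then show "\<xi> $ i = (complex_of_real (- (1 / t)) \<cdot>\<^sub>v w) $ i" using i w t by simp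
    qed (use w x in auto)
    from this[OF v z] show ?thesis .
  qed
  have "\<kappa> = (\<Sum>j<n - r. (cmod (y $ j))\<^sup>2 *\<^sub>R
     tangent_point (1 / t) g j)"
    unfolding x(3) by (subst \<xi>) (rule block_point_tangent[OF x(2)])
  also have "\<dots> = (\<Sum>j<n - r. ((cmod (y $ j))\<^sup>2 * (1 / t)) *\<^sub>R (lpolar j g, 2 * \<mu>))"
  proof (intro sum.cong refl)
    fix j assume "j \<in> {..<n - r}"
    then have "y $ j = 0 \<or> lform j g = \<mu>\<^sup>2" using y0 by simp
    then show "(cmod (y $ j))\<^sup>2 *\<^sub>R
     tangent_point (1 / t) g j = ((cmod (y $ j))\<^sup>2 * (1 / t)) *\<^sub>R (lpolar j g, 2 * \<mu>)"
    proof
      assume "lform j g = \<mu>\<^sup>2"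
      from tangent_direction[OF this] p show ?thesis unfolding t_def by simp
    qed (simp add: zero_prod_def)
  qed
  finally show ?thesis using y0 t by (intro exI[of _ "\<lambda>j. (cmod (y $ j))\<^sup>2 * (1 / t)"]) auto
qed

text \<open>The case of a line through $\<alpha>$. The coefficient of $|\<xi>|^2$ is $0$, so nonnegativity forces the mixed term to
vanish, and the form is $2\<mu>|\<eta>|^2$.\<close>
lemma kernel_uncoupled:
  assumes nn: "\<And>\<kappa>. \<kappa> \<in> kcone \<Longrightarrow> 0 \<le> pairing g \<mu> \<kappa>" and p: "Re (g * \<delta>) = \<mu>"
  shows "0 \<le> \<mu>" and "\<And>j. j < n - r \<Longrightarrow> coupling j g = 0"
    and "\<mu> = 0 \<Longrightarrow> \<kappa> \<in> kcone \<Longrightarrow> pairing g \<mu> \<kappa> = 0"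
    and "\<mu> \<noteq> 0 \<Longrightarrow> \<kappa> \<in> kcone \<Longrightarrow> pairing g \<mu> \<kappa> = 0 \<Longrightarrow> \<exists>\<rho>\<ge>0. \<kappa> = \<rho> *\<^sub>R (\<delta>, 1)"
proof -
  show c0: "coupling j g = 0" if j: "j < n - r" for j
  proof (rule ccontr)
    assume "coupling j g \<noteq> 0"
    then have c: "0 < coupling j g" using coupling_nonneg[OF j, of g] by simp
    let ?y = "unit_vec (n - r) j :: complex Matrix.vec"
    define v where "v = mixed g *\<^sub>v (U *\<^sub>v ?y)"
    have y: "?y \<in> carrier_vec (n - r)" by simp
    have v: "v \<in> carrier_vec r" unfolding v_def by (rule mixed_U_carrier[OF y])
    have vn: "vec_norm2 v = coupling j g" unfolding v_def by (rule coupling_vec[OF j])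
    \<comment> \<open>The mixed term is linear in $t$ and outweighs the constant term for this value.\<close>
    define t where "t = (\<bar>\<mu>\<bar> * vec_norm2 (U *\<^sub>v ?y) + 1) / coupling j g"
    let ?\<xi> = "complex_of_real (- t) \<cdot>\<^sub>v v"
    have \<xi>: "?\<xi> \<in> carrier_vec r" using v by simp
    have "v \<bullet>c ?\<xi> = complex_of_real (- t * coupling j g)"
      unfolding cscalar_prod_lin(6)[OF v v v] cscalar_prod_self vn by simp
    then have "pairing g \<mu> (block_point ?\<xi> ?y) = 2 * \<mu> * vec_norm2 (U *\<^sub>v ?y) + 2 * (- t * coupling j g)"
      unfolding pairing_def functional_block_point[OF \<xi> y] p v_def[symmetric] by simp
    also have "\<dots> = 2 * (\<mu> * vec_norm2 (U *\<^sub>v ?y) - \<bar>\<mu>\<bar> * vec_norm2 (U *\<^sub>v ?y)) - 2" using c by (simp add: t_def)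
    also have "\<dots> < 0"
      using mult_right_mono[OF abs_ge_self[of \<mu>] vec_norm2_nonneg[of "U *\<^sub>v ?y"]] by simp
    finally show False using nn kcone_iff \<xi> y by (metis not_le)
  qed
  have val: "pairing g \<mu> (block_point \<xi> y) = 2 * \<mu> * vec_norm2 (U *\<^sub>v y)" if "\<xi> \<in> carrier_vec r" "y \<in> carrier_vec (n - r)" for \<xi> y
    using pairing_uncoupled[OF p _ that] c0 by simp
  show "0 \<le> \<mu>"
  proof -
    let ?y = "complex_of_real 1 \<cdot>\<^sub>v unit_vec (n - r) 0 :: complex Matrix.vec"
    have "vec_norm2 (U *\<^sub>v ?y) = 1" using sum_unit_vec[of 0 1 "\<lambda>_. 1::real"] rn by (subst norm_U) auto
    moreover have "block_point (0\<^sub>v r) ?y \<in> kcone" unfolding kcone_iff by (intro bexI[of _ "0\<^sub>v r"] bexI[of _ ?y]) auto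
    ultimately show ?thesis using nn val[of "0\<^sub>v r" ?y] by fastforce
  qed
  show "pairing g \<mu> \<kappa> = 0" if "\<mu> = 0" "\<kappa> \<in> kcone" using that val by (auto simp: kcone_iff)
  show "\<exists>\<rho>\<ge>0. \<kappa> = \<rho> *\<^sub>R (\<delta>, 1)" if m: "\<mu> \<noteq> 0" "\<kappa> \<in> kcone" "pairing g \<mu> \<kappa> = 0"
  proof -
    obtain \<xi> y where x: "\<xi> \<in> carrier_vec r" "y \<in> carrier_vec (n - r)" "\<kappa> = block_point \<xi> y" using m by (auto simp: kcone_iff)
    have "vec_norm2 (U *\<^sub>v y) = 0" using val[OF x(1,2)] m x(3) by simp
    then have "(\<Sum>j<n - r. (cmod (y $ j))\<^sup>2) = 0" by (simp add: norm_U[OF x(2)])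
    then have "y = 0\<^sub>v (n - r)" using x(2) by (intro eq_vecI) (auto simp: sum_nonneg_eq_0_iff)
    then have "\<kappa> = vec_norm2 \<xi> *\<^sub>R (\<delta>, 1)" using block_point_zero[OF x(1)] x(3) by simp
    then show ?thesis using vec_norm2_nonneg by blast
  qed
qed

end

section \<open>The pseudo-convex hull of the hyperbolas\<close>

lemma quadratic_last_root:
  fixes a b c t0 :: real
  assumes a: "0 < a" and neg: "a * t0\<^sup>2 + b * t0 + c < 0"
  obtains t where "t0 < t" "a * t\<^sup>2 + b * t + c = 0" "0 < 2 * a * t + b"
    "\<And>s. t \<le> s \<Longrightarrow> 0 \<le> a * s\<^sup>2 + b * s + c"
proof -
  define d where "d = b\<^sup>2 - 4 * a * c"
  have sq: "4 * a * (a * s\<^sup>2 + b * s + c) = (2 * a * s + b)\<^sup>2 - d" for s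
    by (simp add: d_def power2_eq_square algebra_simps)
  have "4 * a * (a * t0\<^sup>2 + b * t0 + c) < 0" using a neg by (simp add: mult_pos_neg)
  then have lt: "(2 * a * t0 + b)\<^sup>2 < d" using sq[of t0] by simp
  then have d0: "0 < d" by (meson le_less_trans zero_le_power2)
  have sd: "(sqrt d)\<^sup>2 = d" using d0 by simp
  define t where "t = (- b + sqrt d) / (2 * a)"
  have t: "2 * a * t + b = sqrt d" using a by (simp add: t_def)
  have "\<bar>2 * a * t0 + b\<bar> < sqrt d" using lt by (simp add: real_less_rsqrt)
  then have "2 * a * t0 < 2 * a * t" using t by linarith
  then have "t0 < t" using a by simp
  moreover have "a * t\<^sup>2 + b * t + c = 0" using sq[of t] a t sd by simp
  moreover have "0 < 2 * a * t + b" using t d0 by simp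
  moreover have "0 \<le> a * s\<^sup>2 + b * s + c" if "t \<le> s" for s
  proof -
    have "sqrt d \<le> 2 * a * s + b" using that a t by (smt (verit) mult_left_mono mult_less_cancel_left_pos)
    then have "d \<le> (2 * a * s + b)\<^sup>2" using sd d0 by (metis power_mono real_sqrt_ge_zero less_imp_le)
    then have "0 \<le> 4 * a * (a * s\<^sup>2 + b * s + c)" unfolding sq by simp
    then show ?thesis using a by (simp add: zero_le_mult_iff)
  qed
  ultimately show ?thesis using that by blast
qed

text \<open>The line through the centre with direction given by $g_0$ is to separate the two branches of every hyperbola.\<close>
locale hyperbolic_block = scalar_block +
  fixes \<phi> :: "nat \<Rightarrow> complex" and g0 :: complex
  assumes foci: "\<And>j. j < n - r \<Longrightarrow> (\<phi> j)\<^sup>2 = focal_sq j"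
    and transverse: "\<And>j. j < n - r \<Longrightarrow> 0 < cmod (focal_sq j) + axis_diff j"
    and non_transverse: "\<And>j. j < n - r \<Longrightarrow> axis_diff j \<le> cmod (focal_sq j)"
    and separating: "0 < Re (g0 * \<delta>)" "\<And>j. j < n - r \<Longrightarrow> 0 < lform j g0"
begin

definition hyp :: "nat \<Rightarrow> complex set" where
  "hyp j = hyperbola (ctr + \<phi> j) (ctr - \<phi> j) (sqrt (2 * (cmod (focal_sq j) + axis_diff j))) (sqrt (2 * (cmod (focal_sq j) - axis_diff j)))"

lemma hyp_iff: "j < n - r \<Longrightarrow> w \<in> hyp j \<longleftrightarrow> (\<exists>g. lform j g = 1/4 \<and> w = ctr + lpolar j g)"
  using hyperbola_iff_polar[of "\<phi> j" "axis_diff j" w ctr] transverse[of j] non_transverse[of j]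
  unfolding hyp_def by (simp add: foci)

text \<open>Tangents are normalized to $\<mu> = 1/2$ in \<open>hyp_iff\<close>; all forms are homogeneous.\<close>
lemma polar_point_hyp:
  assumes "j < n - r" "lform j g = \<mu>\<^sup>2" "\<mu> \<noteq> 0"
  shows "ctr + complex_of_real (1 / (2 * \<mu>)) * lpolar j g \<in> hyp j"
  unfolding hyp_iff[OF assms(1)] using assms
  by (intro exI[of _ "complex_of_real (1 / (2 * \<mu>)) * g"])
    (simp only: line_form_scale polar_scale, simp add: power2_eq_square)

lemma kcone_nonneg: "\<kappa> \<in> kcone \<Longrightarrow> 0 \<le> Re (g0 * fst \<kappa>)"
  using pairing_nonnegI[of 0 g0 \<kappa>] separating by (simp add: pairing_def less_imp_le)

text \<open>Otherwise $g_0$ and $(g, \<mu>)$ are conjugate with respect to the line equation, and its value at $(g + t g_0, \<mu>)$ would be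
$t^2$ times the positive value at $g_0$. At the $t$ for which $\<Re>((g + t g_0)\<delta>) = 0$ this value is at most $-\<mu>^2$.\<close>
lemma center_line_misses_conic:
  assumes j: "j < n - r" and q: "lform j g = \<mu>\<^sup>2" and \<mu>: "\<mu> \<noteq> 0"
  shows "Re (g0 * lpolar j g) \<noteq> 0"
proof
  assume l: "Re (g0 * lpolar j g) = 0"
  \<comment> \<open>Chosen so that the form at $g + t g_0$ reduces to minus the coupling.\<close>
  define t where "t = - Re (g * \<delta>) / Re (g0 * \<delta>)"
  let ?g = "g + complex_of_real t * g0"
  have "lform j ?g = \<mu>\<^sup>2 + t * Re (g0 * lpolar j g) + t\<^sup>2 * lform j g0"
    unfolding line_form_add q line_form_scale by (simp add: mult.assoc)
  also have "\<dots> > 0" using l \<mu> separating(2)[OF j] by (simp add: add_pos_nonneg)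
  finally have "0 < lform j ?g" .
  moreover have "Re (?g * \<delta>) = Re (g * \<delta>) + t * Re (g0 * \<delta>)" by (simp add: algebra_simps)
  then have "Re (?g * \<delta>) = 0" using separating(1) by (simp add: t_def)
  then have "lform j ?g \<le> 0" using line_form_coupling[of j ?g] coupling_nonneg[OF j, of ?g] by simp
  ultimately show False by simp
qed

text \<open>By \<open>tangent_in_kcone\<close> the multiple by $p - \<mu>$ lies in the cone; positivity of the functional $g_0$ determines its
sign. For $p = \<mu>$ the point is a multiple of the one that belongs to $\<alpha>$.\<close>
lemma conic_point_in_kcone:
  assumes j: "j < n - r" and q: "lform j g = \<mu>\<^sup>2" and \<mu>: "\<mu> \<noteq> 0"
    and l: "0 < Re (g0 * lpolar j g)"
  shows "(lpolar j g, 2 * \<mu>) \<in> kcone"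
proof -
  define t where "t = Re (g * \<delta>) - \<mu>"
  have tk: "t *\<^sub>R (lpolar j g, 2 * \<mu>) \<in> kcone" unfolding t_def by (rule tangent_in_kcone[OF j q])
  from kcone_nonneg[OF this] have "0 \<le> t * Re (g0 * lpolar j g)" by simp
  then have "0 \<le> t" using l by (simp add: zero_le_mult_iff)
  show ?thesis
  proof (cases "t = 0")
    case True
    then have p: "Re (g * \<delta>) = \<mu>" by (simp add: t_def)
    then have c: "coupling j g = 0" using line_form_coupling[of j g] q by simp
    have pol: "lpolar j g = complex_of_real (2 * \<mu>) * \<delta>" using polar_uncoupled[OF j c] unfolding p .
    then have "0 < 2 * \<mu> * Re (g0 * \<delta>)" using l by (simp add: algebra_simps)
    then have "0 \<le> 2 * \<mu>" using separating(1) by (simp add: zero_less_mult_iff)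
    from kcone_scale[OF alpha_in_kcone this] show ?thesis by (simp add: pol scaleR_conv_of_real)
  next
    case False
    then have "0 < t" using \<open>0 \<le> t\<close> by simp
    from kcone_scale[OF tk, of "1 / t"] this show ?thesis by simp
  qed
qed

definition signed_base :: "(complex \<times> real) set" where
  "signed_base = {(w, s). w \<in> (\<Union>j<n - r. hyp j) \<and> s \<in> {1, - 1} \<and>
        (\<exists>x \<in> carrier_vec n. J_prod n r x x = complex_of_real s \<and>
           w = J_prod n r (A *\<^sub>v x) x / J_prod n r x x)}"

text \<open>Homogeneous coordinates of a point of the numerical range that is attained with sign $s$.\<close>
lemma realized_iff:
  assumes s: "s \<in> {1, - 1 :: real}"
  shows "(\<exists>x \<in> carrier_vec n. J_prod n r x x = complex_of_real s \<and> w = J_prod n r (A *\<^sub>v x) x / J_prod n r x x)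
    \<longleftrightarrow> s *\<^sub>R (w - ctr, 1) \<in> kcone"
proof
  assume "\<exists>x \<in> carrier_vec n. J_prod n r x x = complex_of_real s \<and> w = J_prod n r (A *\<^sub>v x) x / J_prod n r x x"
  then obtain x where x: "x \<in> carrier_vec n" "J_prod n r x x = complex_of_real s"
    "w = J_prod n r (A *\<^sub>v x) x / J_prod n r x x" by blast
  have "J_prod n r (A *\<^sub>v x) x = complex_of_real s * w" using x(2,3) s by auto
  then have "krein_point n r A ctr x = s *\<^sub>R (w - ctr, 1)"
    unfolding krein_point_def x(2) by (simp add: scaleR_conv_of_real algebra_simps)
  then show "s *\<^sub>R (w - ctr, 1) \<in> kcone" using x(1) unfolding kcone_def krein_cone_def by (metis imageI)
next
  assume "s *\<^sub>R (w - ctr, 1) \<in> kcone"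
  then obtain x where x: "x \<in> carrier_vec n" "krein_point n r A ctr x = s *\<^sub>R (w - ctr, 1)"
    unfolding kcone_def krein_cone_def by (metis imageE)
  have "Re (J_prod n r x x) = s" using x(2) by (simp add: krein_point_def)
  then have js: "J_prod n r x x = complex_of_real s" using J_prod_self_real[OF less_imp_le[OF rn] x(1)] by simp
  have "J_prod n r (A *\<^sub>v x) x - ctr * complex_of_real s = complex_of_real s * (w - ctr)"
    using x(2) by (simp add: krein_point_def js scaleR_conv_of_real)
  then have "J_prod n r (A *\<^sub>v x) x = complex_of_real s * w" by (simp add: algebra_simps)
  then have "w = J_prod n r (A *\<^sub>v x) x / J_prod n r x x" using s by (auto simp: js)
  then show "\<exists>x \<in> carrier_vec n. J_prod n r x x = complex_of_real s \<and> w = J_prod n r (A *\<^sub>v x) x / J_prod n r x x"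
    using x(1) js by blast
qed

lemma signed_base_iff:
  "(w, s) \<in> signed_base \<longleftrightarrow> w \<in> (\<Union>j<n - r. hyp j) \<and> s \<in> {1, - 1} \<and> s *\<^sub>R (w - ctr, 1) \<in> kcone"
  unfolding signed_base_def using realized_iff by blast

text \<open>Both rules are sums in the cone: a segment has the weights $t$ and $1 - t$, and a half-line has the weights $t$ and
$t - 1$ because the second point carries the opposite sign.\<close>
lemma signed_hull_in_kcone:
  "(w, s) \<in> signed_hull signed_base \<Longrightarrow> s \<in> {1, - 1} \<and> s *\<^sub>R (w - ctr, 1) \<in> kcone"
proof (induction w s rule: signed_hull.induct[split_format (complete)])
  case (base w s)
  then show ?case by (simp add: signed_base_iff)
next
  case (segment w1 s w2 t)
  have "s *\<^sub>R (complex_of_real t * w1 + complex_of_real (1 - t) * w2 - ctr, 1)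
    = t *\<^sub>R (s *\<^sub>R (w1 - ctr, 1)) + (1 - t) *\<^sub>R (s *\<^sub>R (w2 - ctr, 1))"
    by (simp add: scaleR_conv_of_real algebra_simps)
  also have "\<dots> \<in> kcone"
  proof -
    have "s *\<^sub>R (w1 - ctr, 1) \<in> kcone" "s *\<^sub>R (w2 - ctr, 1) \<in> kcone" using segment by blast+
    from kcone_add[OF kcone_scale[OF this(1)] kcone_scale[OF this(2)]] show ?thesis
      using segment(3,4) by (metis diff_ge_0_iff_ge)
  qed
  finally show ?case using segment by simp
next
  case (half_line w1 s w2 t)
  have "s *\<^sub>R (complex_of_real t * w1 + complex_of_real (1 - t) * w2 - ctr, 1)
    = t *\<^sub>R (s *\<^sub>R (w1 - ctr, 1)) + (t - 1) *\<^sub>R ((- s) *\<^sub>R (w2 - ctr, 1))"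
    by (simp add: scaleR_conv_of_real algebra_simps)
  also have "\<dots> \<in> kcone"
  proof -
    have "s *\<^sub>R (w1 - ctr, 1) \<in> kcone" "(- s) *\<^sub>R (w2 - ctr, 1) \<in> kcone" using half_line by blast+
    from kcone_add[OF kcone_scale[OF this(1)] kcone_scale[OF this(2)]] show ?thesis
      using half_line(3) by (metis diff_ge_0_iff_ge order_trans zero_le_one)
  qed
  finally show ?case using half_line by simp
qed

text \<open>A point of a hyperbola lies on one side of the line through the centre given by $g_0$, and the side determines
its sign.\<close>
lemma hyp_realized:
  assumes w: "w \<in> (\<Union>j<n - r. hyp j)"
  shows "\<exists>s. (w, s) \<in> signed_base"
proof -
  obtain j where j: "j < n - r" "w \<in> hyp j" using w by auto
  then obtain g where g: "lform j g = 1/4" "w = ctr + lpolar j g"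
    using hyp_iff by blast
  have q: "lform j g = (1/2)\<^sup>2" using g by (simp add: power2_eq_square)
  have q': "lform j (complex_of_real (- 1) * g) = (- 1/2)\<^sup>2" unfolding line_form_scale using g by (simp add: power2_eq_square)
  have ne: "Re (g0 * lpolar j g) \<noteq> 0" by (rule center_line_misses_conic[OF j(1) q]) simp
  show ?thesis
  proof (cases "0 < Re (g0 * lpolar j g)")
    case True
    from conic_point_in_kcone[OF j(1) q _ this] have "1 *\<^sub>R (w - ctr, 1) \<in> kcone" using g by simp
    then show ?thesis using w by (intro exI[of _ 1]) (simp add: signed_base_iff)
  next
    case False
    then have "0 < Re (g0 * lpolar j (complex_of_real (- 1) * g))" unfolding polar_scale using ne by simp
    from conic_point_in_kcone[OF j(1) q' _ this] have "(- 1) *\<^sub>R (w - ctr, 1) \<in> kcone" unfolding polar_scale using g by simp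
    then show ?thesis using w by (intro exI[of _ "- 1"]) (simp add: signed_base_iff)
  qed
qed

definition ray_cone :: "real \<Rightarrow> (complex \<times> real) set" where
  "ray_cone s = insert 0 {\<rho> *\<^sub>R (s *\<^sub>R (w - ctr, 1)) | \<rho> w. 0 < \<rho> \<and> (w, s) \<in> signed_hull signed_base}"

text \<open>The cone generated by the signed hull. One ray of each sign is enough because the signed hull is closed under segments.\<close>
definition hull_cone :: "(complex \<times> real) set" where
  "hull_cone = {a + b | a b. a \<in> ray_cone 1 \<and> b \<in> ray_cone (- 1)}"

lemma ray_coneI: "0 < \<rho> \<Longrightarrow> (w, s) \<in> signed_hull signed_base \<Longrightarrow> \<rho> *\<^sub>R (s *\<^sub>R (w - ctr, 1)) \<in> ray_cone s"
  unfolding ray_cone_def by blast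

lemma ray_cone_scale: "\<kappa> \<in> ray_cone s \<Longrightarrow> 0 \<le> t \<Longrightarrow> t *\<^sub>R \<kappa> \<in> ray_cone s"
proof (cases "t = 0 \<or> \<kappa> = 0")
  case False
  assume "\<kappa> \<in> ray_cone s" "0 \<le> t"
  then obtain \<rho> w where "\<kappa> = \<rho> *\<^sub>R (s *\<^sub>R (w - ctr, 1))" "0 < \<rho>" "(w, s) \<in> signed_hull signed_base"
    using False unfolding ray_cone_def by blast
  moreover have "t *\<^sub>R (\<rho> *\<^sub>R (s *\<^sub>R (w - ctr, 1))) = (t * \<rho>) *\<^sub>R (s *\<^sub>R (w - ctr, 1))" by simp
  moreover have "0 < t * \<rho>" using False \<open>0 \<le> t\<close> \<open>0 < \<rho>\<close> by simp
  ultimately show ?thesis unfolding ray_cone_def by blast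
qed (auto simp: ray_cone_def)

lemma ray_cone_add: "\<kappa> \<in> ray_cone s \<Longrightarrow> \<kappa>' \<in> ray_cone s \<Longrightarrow> \<kappa> + \<kappa>' \<in> ray_cone s"
proof (cases "\<kappa> = 0 \<or> \<kappa>' = 0")
  case True
  then show "\<kappa> \<in> ray_cone s \<Longrightarrow> \<kappa>' \<in> ray_cone s \<Longrightarrow> \<kappa> + \<kappa>' \<in> ray_cone s" by auto
next
  case False
  assume k: "\<kappa> \<in> ray_cone s" "\<kappa>' \<in> ray_cone s"
  then obtain \<rho> w where 1: "\<kappa> = \<rho> *\<^sub>R (s *\<^sub>R (w - ctr, 1))" "0 < \<rho>" "(w, s) \<in> signed_hull signed_base"
    using False unfolding ray_cone_def by blast
  from k obtain \<rho>' w' where 2: "\<kappa>' = \<rho>' *\<^sub>R (s *\<^sub>R (w' - ctr, 1))" "0 < \<rho>'" "(w', s) \<in> signed_hull signed_base"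
    using False unfolding ray_cone_def by blast
  define t where "t = \<rho> / (\<rho> + \<rho>')"
  have t: "0 \<le> t" "t \<le> 1" "(\<rho> + \<rho>') * t = \<rho>" "(\<rho> + \<rho>') * (1 - t) = \<rho>'" using 1 2 by (auto simp: t_def field_simps)
  let ?w = "complex_of_real t * w + complex_of_real (1 - t) * w'"
  have "?w - ctr = complex_of_real t * (w - ctr) + complex_of_real (1 - t) * (w' - ctr)" by (simp add: algebra_simps)
  then have "(\<rho> + \<rho>') *\<^sub>R (?w - ctr) = complex_of_real ((\<rho> + \<rho>') * t) * (w - ctr) + complex_of_real ((\<rho> + \<rho>') * (1 - t)) * (w' - ctr)"
    by (simp add: scaleR_conv_of_real algebra_simps)
  then have "(\<rho> + \<rho>') *\<^sub>R (?w - ctr) = \<rho> *\<^sub>R (w - ctr) + \<rho>' *\<^sub>R (w' - ctr)" unfolding t(3,4) by (simp add: scaleR_conv_of_real)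
  then have "\<kappa> + \<kappa>' = s *\<^sub>R ((\<rho> + \<rho>') *\<^sub>R (?w - ctr), \<rho> + \<rho>')" unfolding 1(1) 2(1)
    by (simp add: scaleR_right_distrib algebra_simps)
  also have "\<dots> = (\<rho> + \<rho>') *\<^sub>R (s *\<^sub>R (?w - ctr, 1))" by simp
  finally show ?thesis using signed_hull.segment[OF 1(3) 2(3) t(1,2)] 1(2) 2(2) unfolding ray_cone_def
    by (metis (mono_tags, lifting) add_pos_pos insertI2 mem_Collect_eq)
qed

lemma hull_cone_scale:
  assumes "\<kappa> \<in> hull_cone" "0 \<le> t" shows "t *\<^sub>R \<kappa> \<in> hull_cone"
proof -
  obtain a b where ab: "\<kappa> = a + b" "a \<in> ray_cone 1" "b \<in> ray_cone (- 1)"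
    using assms unfolding hull_cone_def by blast
  have "t *\<^sub>R \<kappa> = t *\<^sub>R a + t *\<^sub>R b" by (simp add: ab scaleR_right_distrib)
  then show ?thesis using ray_cone_scale ab assms(2) unfolding hull_cone_def by blast
qed

lemma hull_cone_add:
  assumes "\<kappa> \<in> hull_cone" "\<kappa>' \<in> hull_cone" shows "\<kappa> + \<kappa>' \<in> hull_cone"
proof -
  obtain a b a' b' where ab: "\<kappa> = a + b" "\<kappa>' = a' + b'" "a \<in> ray_cone 1" "a' \<in> ray_cone 1" "b \<in> ray_cone (- 1)" "b' \<in> ray_cone (- 1)"
    using assms unfolding hull_cone_def by blast
  have "\<kappa> + \<kappa>' = (a + a') + (b + b')" by (simp add: ab)
  then show ?thesis using ray_cone_add ab unfolding hull_cone_def by blast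
qed

lemma zero_in_hull_cone: "0 \<in> hull_cone"
proof -
  have "0 \<in> ray_cone s" for s by (simp add: ray_cone_def)
  moreover have "(0 :: complex \<times> real) = 0 + 0" by simp
  ultimately show ?thesis unfolding hull_cone_def by blast
qed

lemma convex_hull_cone: "convex hull_cone"
  unfolding convex_def using hull_cone_add hull_cone_scale by blast

lemma sum_in_hull_cone: "finite I \<Longrightarrow> (\<And>i. i \<in> I \<Longrightarrow> f i \<in> hull_cone) \<Longrightarrow> sum f I \<in> hull_cone"
  by (induction I rule: finite_induct) (auto simp: zero_in_hull_cone hull_cone_add)

lemma ray_cone_subset: "ray_cone s \<subseteq> kcone"
proof
  fix \<kappa> assume "\<kappa> \<in> ray_cone s"
  then consider "\<kappa> = 0" | \<rho> w where "\<kappa> = \<rho> *\<^sub>R (s *\<^sub>R (w - ctr, 1))" "0 < \<rho>" "(w, s) \<in> signed_hull signed_base"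
    unfolding ray_cone_def by blast
  then show "\<kappa> \<in> kcone"
  proof cases
    case 2
    then show ?thesis using signed_hull_in_kcone kcone_scale less_imp_le by metis
  qed (simp add: zero_in_kcone)
qed

lemma hull_cone_subset: "hull_cone \<subseteq> kcone"
  unfolding hull_cone_def using ray_cone_subset[of 1] ray_cone_subset[of "- 1"] kcone_add by blast

lemma ray_in_hull_cone:
  assumes "(w, s) \<in> signed_base" "0 \<le> \<rho>" shows "\<rho> *\<^sub>R (s *\<^sub>R (w - ctr, 1)) \<in> hull_cone"
proof -
  have s: "s \<in> {1, - 1}" using assms(1) by (simp add: signed_base_iff)
  have m: "s *\<^sub>R (w - ctr, 1) \<in> ray_cone s"
    using ray_coneI[of 1, OF _ signed_hull.base[OF assms(1)]] by (simp only: scaleR_one zero_less_one)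
  have z: "0 \<in> ray_cone s'" for s' by (simp add: ray_cone_def)
  have "s *\<^sub>R (w - ctr, 1) \<in> hull_cone"
  proof (cases "s = 1")
    case True
    have "s *\<^sub>R (w - ctr, 1) = s *\<^sub>R (w - ctr, 1) + 0" by simp
    then show ?thesis using m z[of "- 1"] unfolding hull_cone_def True by blast
  next
    case False
    then have s1: "s = - 1" using s by simp
    have "s *\<^sub>R (w - ctr, 1) = 0 + s *\<^sub>R (w - ctr, 1)" by simp
    then show ?thesis using m z[of 1] unfolding hull_cone_def s1 by blast
  qed
  then show ?thesis using hull_cone_scale assms(2) by blast
qed

text \<open>After the rays of equal sign have been merged, a single half-line step produces the point.\<close>
lemma hull_cone_finite_point:
  assumes k: "\<kappa> \<in> hull_cone" and s: "s \<in> {1, - 1}" "0 < s * snd \<kappa>"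
  shows "(ctr + fst \<kappa> / complex_of_real (snd \<kappa>), s) \<in> signed_hull signed_base"
proof -
  obtain a' b' where ab': "\<kappa> = a' + b'" "a' \<in> ray_cone 1" "b' \<in> ray_cone (- 1)"
    using k unfolding hull_cone_def by blast
  obtain a b where ab: "\<kappa> = a + b" "a \<in> ray_cone s" "b \<in> ray_cone (- s)"
  proof (cases "s = 1")
    case True
    then show ?thesis using that ab' by blast
  next
    case False
    then have s1: "s = - 1" using s by simp
    show ?thesis using that[of b' a'] ab' unfolding s1 by (simp add: add.commute)
  qed
  have sn: "s * snd a \<ge> 0 \<and> s * snd b \<le> 0"
    using ab s by (auto simp: ray_cone_def)
  have "a \<noteq> 0" using s(2) sn ab by (auto simp: algebra_simps)
  then obtain \<rho> w where a: "a = \<rho> *\<^sub>R (s *\<^sub>R (w - ctr, 1))" "0 < \<rho>" "(w, s) \<in> signed_hull signed_base"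
    using ab unfolding ray_cone_def by blast
  have s2: "s * s = 1" "s \<noteq> 0" using s by auto
  show ?thesis
  proof (cases "b = 0")
    case True
    then have "fst \<kappa> / complex_of_real (snd \<kappa>) = w - ctr" using a ab s2 by (simp add: scaleR_conv_of_real)
    then show ?thesis using a by simp
  next
    case False
    then obtain \<rho>' w' where b: "b = \<rho>' *\<^sub>R ((- s) *\<^sub>R (w' - ctr, 1))" "0 < \<rho>'" "(w', - s) \<in> signed_hull signed_base"
      using ab unfolding ray_cone_def by blast
    have sk: "snd \<kappa> = s * (\<rho> - \<rho>')" using a b ab by (simp add: algebra_simps)
    have d: "0 < \<rho> - \<rho>'" using s(2) s2 unfolding sk by (simp add: mult.assoc[symmetric])
    define t where "t = \<rho> / (\<rho> - \<rho>')"
    have t: "1 \<le> t" using d b(2) by (simp add: t_def field_simps)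
    have t': "1 - t = - \<rho>' / (\<rho> - \<rho>')" using d by (simp add: t_def field_simps)
    have fk: "fst \<kappa> = complex_of_real s * (complex_of_real \<rho> * (w - ctr) - complex_of_real \<rho>' * (w' - ctr))"
      using a b ab by (simp add: scaleR_conv_of_real algebra_simps)
    have cd: "complex_of_real (\<rho> - \<rho>') \<noteq> 0" using d by (metis less_irrefl of_real_eq_0_iff)
    have "fst \<kappa> / complex_of_real (snd \<kappa>) = (complex_of_real \<rho> * (w - ctr) - complex_of_real \<rho>' * (w' - ctr)) / complex_of_real (\<rho> - \<rho>')"
      unfolding fk sk of_real_mult using s2 by simp
    also have "\<dots> = complex_of_real t * (w - ctr) + complex_of_real (1 - t) * (w' - ctr)"
    proof -
      have ct: "complex_of_real (1 - t) = - (complex_of_real \<rho>' / complex_of_real (\<rho> - \<rho>'))" unfolding t' by simp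
      show ?thesis unfolding ct unfolding t_def by (simp add: diff_divide_distrib)
    qed
    also have "\<dots> = complex_of_real t * w + complex_of_real (1 - t) * w' - ctr" by (simp add: algebra_simps)
    finally have "ctr + fst \<kappa> / complex_of_real (snd \<kappa>) = complex_of_real t * w + complex_of_real (1 - t) * w'" by simp
    then show ?thesis using signed_hull.half_line[OF a(3) b(3) t] by simp
  qed
qed

lemma conic_point_in_hull_cone:
  assumes j: "j < n - r" and q: "lform j g = \<mu>\<^sup>2" and \<mu>: "\<mu> \<noteq> 0"
    and l: "0 < Re (g0 * lpolar j g)"
  shows "(lpolar j g, 2 * \<mu>) \<in> hull_cone"
proof -
  let ?\<kappa> = "(lpolar j g, 2 * \<mu>)"
  define w where "w = ctr + complex_of_real (1 / (2 * \<mu>)) * lpolar j g"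
  have wh: "w \<in> hyp j" unfolding w_def by (rule polar_point_hyp[OF j q \<mu>])
  have e: "?\<kappa> = (2 * \<bar>\<mu>\<bar>) *\<^sub>R (sgn \<mu> *\<^sub>R (w - ctr, 1))"
  proof -
    have "2 * \<bar>\<mu>\<bar> * sgn \<mu> = 2 * \<mu>" by (simp add: abs_mult_sgn)
    then have "(2 * \<bar>\<mu>\<bar>) *\<^sub>R (sgn \<mu> *\<^sub>R (w - ctr, 1)) = (2 * \<mu>) *\<^sub>R (w - ctr, 1)" by (simp only: scaleR_scaleR)
    also have "\<dots> = ?\<kappa>" using \<mu> by (simp add: w_def scaleR_conv_of_real)
    finally show ?thesis by (rule sym)
  qed
  have "sgn \<mu> *\<^sub>R (w - ctr, 1) = (1 / (2 * \<bar>\<mu>\<bar>)) *\<^sub>R ?\<kappa>" unfolding e using \<mu> by simp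
  moreover have "(1 / (2 * \<bar>\<mu>\<bar>)) *\<^sub>R ?\<kappa> \<in> kcone" by (rule kcone_scale[OF conic_point_in_kcone[OF j q \<mu> l]]) simp
  ultimately have "sgn \<mu> *\<^sub>R (w - ctr, 1) \<in> kcone" by (simp only:)
  then have "(w, sgn \<mu>) \<in> signed_base" unfolding signed_base_iff using wh j \<mu> by (auto simp: sgn_if)
  from ray_in_hull_cone[OF this, of "2 * \<bar>\<mu>\<bar>"] show ?thesis unfolding e by simp
qed

text \<open>Suppose that the functional fails for the block of $j$, and move it in the direction of $g_0$ up to the last
position $t > 0$ in which it is tangent to the conic. Because of $\<mu> \<noteq> 0$ the tangency point is finite, so it
lies in the hull cone, and there the original functional has the value $-t \<Re>(g_0 w) < 0$.\<close>
lemma dual_nonneg_off_infinity: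
  assumes nn: "\<And>\<kappa>. \<kappa> \<in> hull_cone \<Longrightarrow> 0 \<le> pairing g \<mu> \<kappa>" and \<mu>: "\<mu> \<noteq> 0" and k: "\<kappa> \<in> kcone"
  shows "0 \<le> pairing g \<mu> \<kappa>"
proof -
  have main: "\<mu>\<^sup>2 \<le> lform j g \<and> 0 < Re (g * \<delta>)" if j: "j < n - r" for j
  proof -
    let ?P = "lpolar j" and ?Q = "lform j"
    define a b c where abc: "a = ?Q g0" "b = Re (g0 * ?P g)" "c = ?Q g - \<mu>\<^sup>2"
    have Qt: "?Q (g + complex_of_real t * g0) - \<mu>\<^sup>2 = a * t\<^sup>2 + b * t + c" for t
      unfolding line_form_add line_form_scale abc by (simp add: mult.assoc algebra_simps)
    \<comment> \<open>The form at $g + t_0 g_0$ reduces to minus the coupling, which makes the quadratic polynomial negative there.\<close>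
    define t0 where "t0 = - Re (g * \<delta>) / Re (g0 * \<delta>)"
    have "Re ((g + complex_of_real t0 * g0) * \<delta>) = Re (g * \<delta>) + t0 * Re (g0 * \<delta>)" by (simp add: algebra_simps)
    then have "Re ((g + complex_of_real t0 * g0) * \<delta>) = 0" using separating(1) by (simp add: t0_def)
    then have "?Q (g + complex_of_real t0 * g0) \<le> 0" using line_form_coupling coupling_nonneg[OF j] by simp
    then have "a * t0\<^sup>2 + b * t0 + c < 0" using Qt[of t0] \<mu> by (smt (verit) zero_less_power2)
    then obtain t where t: "t0 < t" "a * t\<^sup>2 + b * t + c = 0" "0 < 2 * a * t + b"
      "\<And>s. t \<le> s \<Longrightarrow> 0 \<le> a * s\<^sup>2 + b * s + c"
      using quadratic_last_root[of a t0 b c] separating(2)[OF j] abc by blast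
    have "t \<le> 0"
    proof (rule ccontr)
      assume tpos: "\<not> t \<le> 0"
      let ?g = "g + complex_of_real t * g0"
      have q: "?Q ?g = \<mu>\<^sup>2" using Qt[of t] t(2) by simp
      have P: "?P ?g = ?P g + complex_of_real t * ?P g0" by (simp add: polar_def algebra_simps)
      have l: "Re (g0 * ?P ?g) = 2 * a * t + b"
        using Re_mult_polar[of g0 "focal_sq j" "axis_diff j"] unfolding P abc by (simp add: algebra_simps)
      then have lp: "0 < Re (g0 * ?P ?g)" using t(3) by simp
      have "pairing g \<mu> (?P ?g, 2 * \<mu>) = Re (?g * ?P ?g) - t * Re (g0 * ?P ?g) - 2 * \<mu>\<^sup>2"
        unfolding pairing_def by (simp add: power2_eq_square algebra_simps)
      also have "\<dots> = - t * Re (g0 * ?P ?g)" unfolding Re_mult_polar q by simp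
      also have "\<dots> < 0" using tpos lp by simp
      finally show False using nn[OF conic_point_in_hull_cone[OF j q \<mu> lp]] by simp
    qed
    then have "\<mu>\<^sup>2 \<le> ?Q g" using t(4)[of 0] by (simp add: abc)
    moreover have "t0 < 0" using t(1) \<open>t \<le> 0\<close> by simp
    then have "0 < Re (g * \<delta>)" using separating(1) by (simp add: t0_def divide_less_0_iff)
    ultimately show ?thesis by blast
  qed
  show ?thesis
  proof (rule pairing_nonnegI[OF _ _ k])
    have j0: "0 < n - r" using rn by simp
    have "\<mu>\<^sup>2 \<le> (Re (g * \<delta>))\<^sup>2"
      using main[OF j0] line_form_coupling[of 0 g] coupling_nonneg[OF j0, of g] by linarith
    then show "\<bar>\<mu>\<bar> \<le> Re (g * \<delta>)" using main[OF j0] by (simp add: abs_le_square_iff[symmetric])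
  qed (use main in blast)
qed

text \<open>For $\<mu> = 0$ the tangency point may be at infinity. Adding small multiples of a functional $(g_0, c)$ that is
nonnegative on the whole cone makes $\<mu>$ nonzero.\<close>
lemma dual_nonneg:
  assumes nn: "\<And>\<kappa>. \<kappa> \<in> hull_cone \<Longrightarrow> 0 \<le> pairing g \<mu> \<kappa>" and k: "\<kappa> \<in> kcone"
  shows "0 \<le> pairing g \<mu> \<kappa>"
proof (cases "\<mu> = 0")
  case False
  then show ?thesis using dual_nonneg_off_infinity nn k by blast
next
  case True
  \<comment> \<open>$c^2$ is at most every \<open>lform j g0\<close>, and therefore $c$ is at most $\<Re>(g_0 \<delta>)$.\<close>
  define m0 where "m0 = Min ((\<lambda>j. lform j g0) ` {..<n - r})"
  have ne: "(\<lambda>j. lform j g0) ` {..<n - r} \<noteq> {}" using rn by (auto simp: lessThan_empty_iff)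
  have m0: "0 < m0" "\<And>j. j < n - r \<Longrightarrow> m0 \<le> lform j g0"
    unfolding m0_def using ne separating(2) by (auto simp: Min_gr_iff)
  define c where "c = sqrt m0"
  have c: "0 < c" "c\<^sup>2 = m0" using m0 by (auto simp: c_def)
  have j0: "0 < n - r" using rn by simp
  have "c\<^sup>2 \<le> (Re (g0 * \<delta>))\<^sup>2"
    using m0(2)[OF j0] line_form_coupling[of 0 g0] coupling_nonneg[OF j0, of g0] c by linarith
  then have cp: "\<bar>c\<bar> \<le> Re (g0 * \<delta>)" using separating(1) by (simp add: abs_le_square_iff[symmetric])
  have pc: "0 \<le> pairing g0 c \<kappa>" if "\<kappa> \<in> kcone" for \<kappa>
    using pairing_nonnegI[OF cp _ that] m0(2) c by simp
  have lin: "pairing (g + complex_of_real \<epsilon> * g0) (\<epsilon> * c) \<kappa> = pairing g \<mu> \<kappa> + \<epsilon> * pairing g0 c \<kappa>" for \<epsilon> \<kappa>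
    using True by (simp add: pairing_def algebra_simps)
  have pos: "0 \<le> pairing g \<mu> \<kappa> + \<epsilon> * pairing g0 c \<kappa>" if "0 < \<epsilon>" for \<epsilon>
  proof -
    have "0 \<le> pairing (g + complex_of_real \<epsilon> * g0) (\<epsilon> * c) \<kappa>"
    proof (rule dual_nonneg_off_infinity[OF _ _ k])
      show "\<epsilon> * c \<noteq> 0" using that c by simp
      fix \<kappa>' assume k': "\<kappa>' \<in> hull_cone"
      then have "0 \<le> pairing g0 c \<kappa>'" using pc hull_cone_subset by blast
      then show "0 \<le> pairing (g + complex_of_real \<epsilon> * g0) (\<epsilon> * c) \<kappa>'"
        unfolding lin using nn[OF k'] that by simp
    qed
    then show ?thesis unfolding lin .
  qed
  show ?thesis
  proof (rule ccontr)
    assume "\<not> ?thesis"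
    then have neg: "pairing g \<mu> \<kappa> < 0" by simp
    define e where "e = - pairing g \<mu> \<kappa> / (2 * (pairing g0 c \<kappa> + 1))"
    have p0: "0 \<le> pairing g0 c \<kappa>" by (rule pc[OF k])
    have "0 < e" unfolding e_def by (intro divide_pos_pos) (use neg p0 in auto)
    moreover have "e * pairing g0 c \<kappa> \<le> e * (pairing g0 c \<kappa> + 1)" using \<open>0 < e\<close> by simp
    moreover have "e * (pairing g0 c \<kappa> + 1) = - pairing g \<mu> \<kappa> / 2" using p0 by (simp add: e_def field_simps)
    ultimately show False using pos[of e] neg by simp
  qed
qed

text \<open>Points of the relative boundary are separated as well. The last alternative excludes functionals that vanish on
the whole hull cone, which exist when all hyperbolas are degenerate and lie on one line.\<close>
lemma exists_separating_functional:
  assumes "\<kappa> \<notin> hull_cone"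
  shows "\<exists>g \<mu>. (\<forall>\<kappa>' \<in> hull_cone. 0 \<le> pairing g \<mu> \<kappa>') \<and> pairing g \<mu> \<kappa> \<le> 0
    \<and> (pairing g \<mu> \<kappa> < 0 \<or> (\<exists>\<kappa>' \<in> hull_cone. 0 < pairing g \<mu> \<kappa>'))"
proof -
  have rep: "inner a \<kappa> = pairing (cnj (fst a)) (- snd a) \<kappa>" for a \<kappa> :: "complex \<times> real"
    by (simp add: inner_prod_def pairing_def inner_complex_def)
  have bounded: "0 \<le> inner a x" if b: "\<And>y. y \<in> hull_cone \<Longrightarrow> b \<le> inner a y" and x: "x \<in> hull_cone" for a x b
  proof (rule ccontr)
    assume "\<not> 0 \<le> inner a x"
    then have n: "inner a x < 0" by simp
    define t where "t = (\<bar>b\<bar> + 1) / (- inner a x)"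
    have "0 \<le> t" unfolding t_def by (intro divide_nonneg_pos) (use n in auto)
    then have "b \<le> inner a (t *\<^sub>R x)" using b hull_cone_scale x by blast
    also have "\<dots> = - (\<bar>b\<bar> + 1)" using n by (simp add: t_def)
    finally show False by simp
  qed
  show ?thesis
  proof (cases "\<kappa> \<in> closure hull_cone")
    case False
    then obtain a b where ab: "inner a \<kappa> < b" "\<And>x. x \<in> closure hull_cone \<Longrightarrow> b < inner a x"
      using separating_hyperplane_closed_point[of "closure hull_cone" \<kappa>] convex_hull_cone convex_closure by blast
    have sub: "\<And>x. x \<in> hull_cone \<Longrightarrow> b \<le> inner a x" using ab(2) closure_subset less_imp_le by blast
    have "inner a \<kappa> < 0" using ab(1) sub[OF zero_in_hull_cone] by simp
    moreover have "\<forall>x \<in> hull_cone. 0 \<le> inner a x" using bounded[OF sub] by blast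
    ultimately show ?thesis unfolding rep by (metis less_imp_le)
  next
    case True
    have "\<kappa> \<notin> rel_interior hull_cone" using assms rel_interior_subset by blast
    then obtain a where a: "\<And>y. y \<in> closure hull_cone \<Longrightarrow> inner a \<kappa> \<le> inner a y"
      "\<And>y. y \<in> rel_interior hull_cone \<Longrightarrow> inner a \<kappa> < inner a y"
      using supporting_hyperplane_relative_frontier[OF convex_hull_cone True] by metis
    have sub: "\<And>x. x \<in> hull_cone \<Longrightarrow> inner a \<kappa> \<le> inner a x" using a(1) closure_subset by blast
    have le: "inner a \<kappa> \<le> 0" using sub[OF zero_in_hull_cone] by simp
    have nn: "\<forall>x \<in> hull_cone. 0 \<le> inner a x" using bounded[OF sub] by blast
    have "rel_interior hull_cone \<noteq> {}" using rel_interior_eq_empty[OF convex_hull_cone] zero_in_hull_cone by blast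
    then obtain y where y: "y \<in> rel_interior hull_cone" by blast
    then have "y \<in> hull_cone" "inner a \<kappa> < inner a y" using a(2) rel_interior_subset by blast+
    then have "inner a \<kappa> < 0 \<or> (\<exists>x \<in> hull_cone. 0 < inner a x)" using le by fastforce
    then show ?thesis using le nn unfolding rep by blast
  qed
qed

text \<open>A functional that separates the point from the hull cone is nonnegative on $K$, hence vanishes at the point, which
then decomposes into tangency points $(w, 2\<mu>)$. Since $s \<noteq> 0$ forces $\<mu> \<noteq> 0$, these are finite points of the
hyperbolas and belong to the hull cone.\<close>
lemma finite_point_in_hull_cone:
  assumes k: "\<kappa> \<in> kcone" and s: "snd \<kappa> \<noteq> 0"
  shows "\<kappa> \<in> hull_cone"
proof (rule ccontr)
  assume nk: "\<kappa> \<notin> hull_cone"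
  then obtain g \<mu> where g: "\<And>\<kappa>'. \<kappa>' \<in> hull_cone \<Longrightarrow> 0 \<le> pairing g \<mu> \<kappa>'" "pairing g \<mu> \<kappa> \<le> 0"
    "pairing g \<mu> \<kappa> < 0 \<or> (\<exists>\<kappa>' \<in> hull_cone. 0 < pairing g \<mu> \<kappa>')"
    using exists_separating_functional by blast
  have nn: "0 \<le> pairing g \<mu> \<kappa>'" if "\<kappa>' \<in> kcone" for \<kappa>' using dual_nonneg[OF g(1) that] by blast
  have z0: "pairing g \<mu> \<kappa> = 0" using nn[OF k] g(2) by simp
  then obtain \<kappa>1 where k1: "\<kappa>1 \<in> hull_cone" "0 < pairing g \<mu> \<kappa>1" using g(3) by auto
  have "0 \<le> pairing g \<mu> (\<delta>, 1)" by (rule nn[OF alpha_in_kcone])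
  then consider (strict) "\<mu> < Re (g * \<delta>)" | (eq) "Re (g * \<delta>) = \<mu>" by (fastforce simp: pairing_def)
  then show False
  proof cases
    case strict
    obtain c where c: "\<And>j. j < n - r \<Longrightarrow> 0 \<le> c j \<and> (c j \<noteq> 0 \<longrightarrow> lform j g = \<mu>\<^sup>2)"
      "\<kappa> = (\<Sum>j<n - r. c j *\<^sub>R (lpolar j g, 2 * \<mu>))"
      using kernel_decomposition[OF nn k z0 strict] by blast
    have \<mu>: "\<mu> \<noteq> 0" using s by (auto simp: c(2) snd_sum)
    have "c j *\<^sub>R (lpolar j g, 2 * \<mu>) \<in> hull_cone" if j: "j < n - r" for j
    proof (cases "c j = 0")
      case True
      then show ?thesis using zero_in_hull_cone by (simp add: zero_prod_def)
    next
      case False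
      then have q: "lform j g = \<mu>\<^sup>2" using c(1)[OF j] by blast
      from kcone_nonneg[OF tangent_in_kcone[OF j q]]
      have "0 \<le> (Re (g * \<delta>) - \<mu>) * Re (g0 * lpolar j g)" by simp
      then have "0 \<le> Re (g0 * lpolar j g)" using strict by (simp add: zero_le_mult_iff)
      then have "0 < Re (g0 * lpolar j g)" using center_line_misses_conic[OF j q \<mu>] by simp
      from conic_point_in_hull_cone[OF j q \<mu> this] show ?thesis using hull_cone_scale c(1)[OF j] by blast
    qed
    then have "\<kappa> \<in> hull_cone" unfolding c(2) by (intro sum_in_hull_cone) auto
    then show False using nk by simp
  next
    case eq
    have "\<kappa>1 \<in> kcone" using k1 hull_cone_subset by blast
    then have \<mu>: "\<mu> \<noteq> 0" using kernel_uncoupled(3)[of g \<mu> \<kappa>1] nn eq k1 by auto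
    have "0 \<le> \<mu>" by (rule kernel_uncoupled(1)[OF _ eq]) (rule nn)
    then have \<mu>p: "0 < \<mu>" using \<mu> by simp
    have "\<exists>\<rho>\<ge>0. \<kappa> = \<rho> *\<^sub>R (\<delta>, 1)" by (rule kernel_uncoupled(4)[OF _ eq \<mu> k z0]) (rule nn)
    then obtain \<rho> where \<rho>: "0 \<le> \<rho>" "\<kappa> = \<rho> *\<^sub>R (\<delta>, 1)" by blast
    have j: "0 < n - r" using rn by simp
    have c0: "coupling 0 g = 0" by (rule kernel_uncoupled(2)[OF _ eq j]) (rule nn)
    have q: "lform 0 g = \<mu>\<^sup>2" using line_form_coupling[of 0 g] c0 eq by simp
    have P: "lpolar 0 g = complex_of_real (2 * \<mu>) * \<delta>" using polar_uncoupled[OF j c0] unfolding eq .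
    have "Re (g0 * lpolar 0 g) = 2 * \<mu> * Re (g0 * \<delta>)" unfolding P by (simp add: algebra_simps)
    then have "0 < Re (g0 * lpolar 0 g)" using \<mu>p separating(1) by simp
    from conic_point_in_hull_cone[OF j q \<mu> this] have "(2 * \<mu>) *\<^sub>R (\<delta>, 1) \<in> hull_cone"
      unfolding P by (simp add: scaleR_conv_of_real)
    from hull_cone_scale[OF this, of "\<rho> / (2 * \<mu>)"] have "\<kappa> \<in> hull_cone" using \<rho> \<mu>p by simp
    then show False using nk by simp
  qed
qed

lemma J_num_range_iff: "w \<in> J_num_range n r A \<longleftrightarrow> (\<exists>s \<in> {1, - 1}. s *\<^sub>R (w - ctr, 1) \<in> kcone)"
proof -
  have "w \<in> J_num_range n r A \<longleftrightarrow> (\<exists>s \<in> {1, - 1 :: real}. \<exists>x \<in> carrier_vec n. J_prod n r x x = complex_of_real s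
      \<and> w = J_prod n r (A *\<^sub>v x) x / J_prod n r x x)"
    unfolding J_num_range_def J_num_range_sgn_def by (auto simp: image_iff)
  then show ?thesis using realized_iff by simp
qed

theorem J_num_range_eq_hull: "J_num_range n r A = pseudo_convex_hull n r A (\<Union>j<n - r. hyp j)"
proof -
  have hull: "pseudo_convex_hull n r A (\<Union>j<n - r. hyp j) = (\<Union>j<n - r. hyp j) \<union> fst ` signed_hull signed_base"
    unfolding pseudo_convex_hull_def signed_base_def ..
  show ?thesis
  proof (intro subset_antisym subsetI)
    fix w assume "w \<in> J_num_range n r A"
    then obtain s where s: "s \<in> {1, - 1}" "s *\<^sub>R (w - ctr, 1) \<in> kcone" unfolding J_num_range_iff by blast
    then have "s *\<^sub>R (w - ctr, 1) \<in> hull_cone" by (intro finite_point_in_hull_cone) auto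
    from hull_cone_finite_point[OF this s(1)] have "(w, s) \<in> signed_hull signed_base"
      using s(1) by (auto simp: scaleR_conv_of_real)
    then show "w \<in> pseudo_convex_hull n r A (\<Union>j<n - r. hyp j)" unfolding hull by force
  next
    fix w assume "w \<in> pseudo_convex_hull n r A (\<Union>j<n - r. hyp j)"
    then have "\<exists>s. (w, s) \<in> signed_hull signed_base"
      unfolding hull using hyp_realized signed_hull.base by fastforce
    then show "w \<in> J_num_range n r A" unfolding J_num_range_iff using signed_hull_in_kcone by blast
  qed
qed

end

section \<open>Real spectra and the characterization\<close>

text \<open>Evaluation is a ring homomorphism and commutes with the determinant.\<close>
lemma lp_eval_kippenhahn:
  assumes A: "A \<in> carrier_mat n n" and JA: "J_adjoint n r A \<in> carrier_mat n n"
  shows "lp_eval (kippenhahn_poly n r A) (complex_of_real (cos \<theta>), complex_of_real (sin \<theta>), - x)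
    = Determinant.det (char_matrix (J_H n r A \<theta>) x)"
proof -
  let ?l = "(complex_of_real (cos \<theta>), complex_of_real (sin \<theta>), - x)"
  interpret ev: comm_ring_hom "\<lambda>G. lp_eval G ?l" by unfold_locales simp_all
  have c: "J_Re n r A \<in> carrier_mat n n" "J_Im n r A \<in> carrier_mat n n"
    using A JA by (auto simp: J_Re_def J_Im_def)
  have "map_mat (\<lambda>G. lp_eval G ?l) (lp_u \<cdot>\<^sub>m map_mat lp_const (J_Re n r A) + lp_v \<cdot>\<^sub>m map_mat lp_const (J_Im n r A) + lp_w \<cdot>\<^sub>m 1\<^sub>m n)
     = char_matrix (J_H n r A \<theta>) x"
    unfolding char_matrix_def J_H_def using c by (intro eq_matI) auto
  then show ?thesis unfolding kippenhahn_poly_def ev.hom_det[symmetric] by simp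
qed

context scalar_block
begin

text \<open>The value is a quarter of the discriminant of the $j$-th quadratic factor of the characteristic polynomial, so
a negative value produces a nonreal eigenvalue with real part $\<Re>(c e^{-\<i>\<theta>})$.\<close>
lemma real_spectrum_nonneg:
  assumes n2: "n \<le> 2 * r" and j: "j < n - r"
    and cp: "char_poly (J_H n r A \<theta>) = (\<Prod>i = 1..n. [:- complex_of_real (ev i), 1:])"
  shows "0 \<le> lform j (cis (- \<theta>))"
proof (rule ccontr)
  define Q where "Q = lform j (cis (- \<theta>))"
  assume "\<not> 0 \<le> lform j (cis (- \<theta>))"
  then have neg: "Q < 0" by (simp add: Q_def)
  define p where "p = Re ctr * cos \<theta> + Im ctr * sin \<theta>"
  define x where "x = Complex p (sqrt (- Q))"
  let ?l = "(complex_of_real (cos \<theta>), complex_of_real (sin \<theta>), - x)"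
  have JA: "J_adjoint n r A \<in> carrier_mat n n"
  proof -
    have "J_adjoint n r A \<in> carrier_mat (r + (n - r)) (r + (n - r))"
      unfolding J_adjoint_block[OF rn C D A] by (intro four_block_carrier_mat) simp_all
    then show ?thesis by (simp only: n_eq)
  qed
  have Hc: "J_H n r A \<theta> \<in> carrier_mat n n" unfolding J_H_def J_Re_def J_Im_def using A_carrier JA by auto
  have quad: "lp_eval (lp_quad (focal_sq j) (axis_diff j)) ?l = complex_of_real Q"
  proof -
    have "(axis_diff j + Re (focal_sq j)) / 2 * (cos \<theta>)\<^sup>2 + Im (focal_sq j) * cos \<theta> * sin \<theta> + (axis_diff j - Re (focal_sq j)) / 2 * (sin \<theta>)\<^sup>2 = Q"
    proof -
      have "(e + f) / 2 * c\<^sup>2 + i * c * s + (e - f) / 2 * s\<^sup>2 = (f * (c\<^sup>2 - s\<^sup>2) + 2 * i * c * s + e * (s\<^sup>2 + c\<^sup>2)) / 2"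
        for e f i c s :: real by (simp add: field_simps)
      note this[of "axis_diff j" "Re (focal_sq j)" "cos \<theta>" "Im (focal_sq j)" "sin \<theta>", unfolded sin_cos_squared_add]
      also have "(Re (focal_sq j) * ((cos \<theta>)\<^sup>2 - (sin \<theta>)\<^sup>2) + 2 * Im (focal_sq j) * cos \<theta> * sin \<theta> + axis_diff j * 1) / 2 = Q"
        unfolding Q_def line_form_def by (simp add: power2_eq_square algebra_simps)
      finally show ?thesis .
    qed
    then show ?thesis unfolding lp_eval_quad
      by (simp only: of_real_add[symmetric] of_real_mult[symmetric] of_real_power[symmetric])
  qed
  have "lp_eval (lp_line ctr) ?l = complex_of_real p - x" by (simp add: lp_eval_line p_def)
  also have "\<dots> = - (\<i> * complex_of_real (sqrt (- Q)))" by (simp add: x_def complex_eq_iff)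
  finally have "(lp_eval (lp_line ctr) ?l)\<^sup>2 = - ((complex_of_real (sqrt (- Q)))\<^sup>2)" by (simp add: power_mult_distrib)
  also have "\<dots> = complex_of_real Q" using neg by (simp flip: of_real_power)
  finally have "lp_eval (lp_conic ctr (focal_sq j) (axis_diff j)) ?l = 0"
    by (simp only: lp_conic_def lp_eval_hom quad) simp
  then have "lp_eval (\<Prod>j<n - r. lp_conic ctr (focal_sq j) (axis_diff j)) ?l = 0"
  proof -
    have "lp_conic ctr (focal_sq j) (axis_diff j) dvd (\<Prod>j<n - r. lp_conic ctr (focal_sq j) (axis_diff j))"
      by (rule dvd_prodI) (use j in auto)
    then obtain G where "(\<Prod>j<n - r. lp_conic ctr (focal_sq j) (axis_diff j)) = lp_conic ctr (focal_sq j) (axis_diff j) * G" by (rule dvdE)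
    then show ?thesis using \<open>lp_eval (lp_conic ctr (focal_sq j) (axis_diff j)) ?l = 0\<close> by (simp only: lp_eval_hom mult_zero_left)
  qed
  then have "lp_eval (kippenhahn_poly n r A) ?l = 0"
    unfolding kippenhahn_poly_factorization[OF rn n2 C D A U Zd Hd] ctr_def focal_sq_def axis_diff_def \<delta>_def
    by (simp only: lp_eval_hom mult_zero_right)
  then have "Determinant.det (char_matrix (J_H n r A \<theta>) x) = 0"
    unfolding lp_eval_kippenhahn[OF A_carrier JA] .
  then have "poly (char_poly (J_H n r A \<theta>)) x = 0"
    using eigenvalue_det[OF Hc] eigenvalue_root_char_poly[OF Hc] by blast
  then obtain i where "x = complex_of_real (ev i)" unfolding cp poly_prod by auto
  then have "Im x = 0" by simp
  then show False using neg by (simp add: x_def)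
qed

text \<open>With $y = e^{-2\<i>\<theta>}$ the equation reads $F y^2 + 2ky + \bar F = 0$, and this polynomial is not zero. On an interval of
length at most $1 < \<pi>$ the map from $\<theta>$ to $y$ is injective.\<close>
lemma finite_zero_angles:
  assumes N: "0 < cmod (focal_sq j) + axis_diff j" and b: "b \<le> a + 1"
  shows "finite {\<theta> \<in> {a<..<b}. lform j (cis (- \<theta>)) = 0}" (is "finite ?Z")
proof -
  define P where "P = [:cnj (focal_sq j), complex_of_real (2 * axis_diff j), focal_sq j:]"
  have "P \<noteq> 0" using N by (auto simp: P_def)
  then have fin: "finite {y. poly P y = 0}" by (rule poly_roots_finite)
  have "(\<lambda>\<theta>. cis (- 2 * \<theta>)) ` ?Z \<subseteq> {y. poly P y = 0}"
  proof
    fix y assume "y \<in> (\<lambda>\<theta>. cis (- 2 * \<theta>)) ` ?Z"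
    then obtain \<theta> where y: "y = cis (- 2 * \<theta>)" and q: "lform j (cis (- \<theta>)) = 0" by blast
    have "(cis (- \<theta>))\<^sup>2 = y" unfolding y by (simp add: power2_eq_square cis_mult)
    then have re: "Re (focal_sq j * y) + axis_diff j = 0" using q by (simp add: line_form_def)
    have yy: "cnj y * y = 1" unfolding y by (simp add: cis_cnj cis_mult)
    have "focal_sq j * y + cnj (focal_sq j * y) = complex_of_real (2 * Re (focal_sq j * y))" by (rule complex_add_cnj)
    then have "focal_sq j * y + cnj (focal_sq j) * cnj y + complex_of_real (2 * axis_diff j) = complex_of_real (2 * (Re (focal_sq j * y) + axis_diff j))" by simp
    then have "focal_sq j * y + cnj (focal_sq j) * cnj y + complex_of_real (2 * axis_diff j) = 0" unfolding re by simp
    then have "(focal_sq j * y + cnj (focal_sq j) * cnj y + complex_of_real (2 * axis_diff j)) * y = 0" by simp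
    then have "focal_sq j * y * y + cnj (focal_sq j) * (cnj y * y) + complex_of_real (2 * axis_diff j) * y = 0" by (simp add: algebra_simps)
    then show "y \<in> {y. poly P y = 0}" unfolding yy by (simp add: P_def algebra_simps)
  qed
  moreover have "inj_on (\<lambda>\<theta>. cis (- 2 * \<theta>)) ?Z"
  proof (rule inj_onI)
    fix s t assume st: "s \<in> ?Z" "t \<in> ?Z" and e: "cis (- 2 * s) = cis (- 2 * t)"
    have "cis (2 * (s - t)) = cis (2 * s) * cis (- 2 * t)" by (simp add: cis_mult algebra_simps)
    also have "\<dots> = 1" unfolding e[symmetric] by (simp add: cis_mult)
    finally have "cos (2 * (s - t)) = 1" by (metis cis.sel(1) one_complex.sel(1))
    then have "sin (s - t) = 0" unfolding cos_double_sin by simp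
    moreover have "- pi < s - t" "s - t < pi" using st b pi_ge_two by auto
    ultimately show "s = t" using sin_eq_0_pi by fastforce
  qed
  ultimately show ?thesis using fin by (meson finite_imageD finite_subset)
qed

text \<open>The forms are nonnegative on the whole interval of angles, and only finitely many angles are zeros of one of
them. At any other angle $\<Re>(g\<delta>)^2$ exceeds the nonnegative coupling; the sign of $\<Re>(g\<delta>)$ is adjusted by passing to
$-g$.\<close>
lemma class_J_separating:
  assumes n2: "n \<le> 2 * r" and cl: "class_J n r A"
    and N: "\<And>j. j < n - r \<Longrightarrow> 0 < cmod (focal_sq j) + axis_diff j"
  shows "\<exists>g0. 0 < Re (g0 * \<delta>) \<and> (\<forall>j<n - r. 0 < lform j g0)"
proof -
  obtain a b :: real where ab: "a < b" and ev: "\<And>\<theta>. \<theta> \<in> {a<..<b} \<Longrightarrow>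
      \<exists>ev :: nat \<Rightarrow> real. char_poly (J_H n r A \<theta>) = (\<Prod>i = 1..n. [:- complex_of_real (ev i), 1:])"
    using cl unfolding class_J_def by meson
  \<comment> \<open>Shrinking the interval makes \<open>finite_zero_angles\<close> applicable.\<close>
  define b' where "b' = min b (a + 1)"
  have ab': "a < b'" "b' \<le> a + 1" "b' \<le> b" using ab by (auto simp: b'_def)
  have "finite (\<Union>j<n - r. {\<theta> \<in> {a<..<b'}. lform j (cis (- \<theta>)) = 0})"
    using finite_zero_angles[OF N ab'(2)] by auto
  moreover have "infinite {a<..<b'}" using ab' by (simp add: infinite_Ioo)
  ultimately obtain \<theta> where \<theta>: "\<theta> \<in> {a<..<b'}" "\<And>j. j < n - r \<Longrightarrow> lform j (cis (- \<theta>)) \<noteq> 0"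
  proof -
    assume fin: "finite (\<Union>j<n - r. {\<theta> \<in> {a<..<b'}. lform j (cis (- \<theta>)) = 0})" and inf: "infinite {a<..<b'}"
    have "\<not> {a<..<b'} \<subseteq> (\<Union>j<n - r. {\<theta> \<in> {a<..<b'}. lform j (cis (- \<theta>)) = 0})"
      using finite_subset fin inf by blast
    then show ?thesis using that by blast
  qed
  then have "\<theta> \<in> {a<..<b}" using ab' by auto
  then have pos: "0 < lform j (cis (- \<theta>))" if "j < n - r" for j
    using ev real_spectrum_nonneg[OF n2 that] \<theta>(2)[OF that] by (metis order_le_less)
  have j0: "0 < n - r" using rn by simp
  have "0 < (Re (cis (- \<theta>) * \<delta>))\<^sup>2"
    using pos[OF j0] line_form_coupling[of 0 "cis (- \<theta>)"] coupling_nonneg[OF j0, of "cis (- \<theta>)"] by linarith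
  then have "Re (cis (- \<theta>) * \<delta>) \<noteq> 0" by (metis less_irrefl power_zero_numeral)
  then consider "0 < Re (cis (- \<theta>) * \<delta>)" | "0 < Re (complex_of_real (- 1) * cis (- \<theta>) * \<delta>)" by fastforce
  then show ?thesis
  proof cases
    case 2
    then show ?thesis using pos by (intro exI[of _ "complex_of_real (- 1) * cis (- \<theta>)"]) (simp only: line_form_scale, simp)
  qed (use pos in blast)
qed

end

theorem theorem3p1:
  fixes n r :: nat and \<alpha> \<beta> :: complex and A C D U :: "complex mat"
    and z \<Delta> fp fm :: "nat \<Rightarrow> complex" and h N M :: "nat \<Rightarrow> real"
  assumes "0 < r" and "r < n" and "n \<le> 2 * r" and "\<alpha> \<noteq> \<beta>"
    and "C \<in> carrier_mat r (n - r)" and "D \<in> carrier_mat (n - r) r"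
    and "A = four_block_mat (\<alpha> \<cdot>\<^sub>m 1\<^sub>m r) C D (\<beta> \<cdot>\<^sub>m 1\<^sub>m (n - r))"
    and "\<exists>i < n. \<exists>j < n. i \<noteq> j \<and> A $$ (i, j) \<noteq> 0"
    and "class_J n r A"
    and "normal_matrix (D * C)"
    and "(D * C) * (mat_adjoint C * C + D * mat_adjoint D)
           = (mat_adjoint C * C + D * mat_adjoint D) * (D * C)"
    and "unitary_matrix (n - r) U"
    and "diagonal_mat (mat_adjoint U * (D * C) * U)"
    and "diagonal_mat (mat_adjoint U * (mat_adjoint C * C + D * mat_adjoint D) * U)"
    and "\<And>j. j < n - r \<Longrightarrow> z j = (mat_adjoint U * (D * C) * U) $$ (j, j)"
    and "\<And>j. j < n - r \<Longrightarrow> complex_of_real (h j)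
           = (mat_adjoint U * (mat_adjoint C * C + D * mat_adjoint D) * U) $$ (j, j)"
    and "\<And>j. \<Delta> j = (\<alpha> - \<beta>)\<^sup>2 + 4 * z j"
    and "\<And>j. fp j = (\<alpha> + \<beta>) / 2 + csqrt (\<Delta> j) / 2"
    and "\<And>j. fm j = (\<alpha> + \<beta>) / 2 - csqrt (\<Delta> j) / 2"
    and "\<And>j. N j = sqrt (cmod (\<Delta> j) / 2 + (cmod (\<alpha> - \<beta>))\<^sup>2 / 2 - h j)"
    and "\<And>j. M j = sqrt (cmod (\<Delta> j) / 2 - (cmod (\<alpha> - \<beta>))\<^sup>2 / 2 + h j)"
  defines "a \<equiv> (\<forall>j < n - r. hyperbola_makes_sense (N j) (M j)) \<and>
             kippenhahn_components n r A =
               (\<Union>j < n - r. hyperbola_components (fp j) (fm j) (N j) (M j))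
                 \<union> (if n < 2 * r then {{\<alpha>}} else {})"
    and "b \<equiv> \<forall>j < n - r. (cmod (\<alpha> - \<beta>))\<^sup>2 - cmod (\<Delta> j) \<le> 2 * h j
               \<and> 2 * h j < (cmod (\<alpha> - \<beta>))\<^sup>2 + cmod (\<Delta> j)"
  shows "(a \<longleftrightarrow> b) \<and>
     (b \<longrightarrow>
        J_num_range n r A =
          pseudo_convex_hull n r A (\<Union>j < n - r. hyperbola (fp j) (fm j) (N j) (M j)) \<and>
        (\<forall>j < n - r. hyperbola_nondegenerate (N j) (M j)
             \<longleftrightarrow> (cmod (\<alpha> - \<beta>))\<^sup>2 - cmod (\<Delta> j) < 2 * h j))"
proof -
  note C = assms(5) and D = assms(6)
  let ?Z = "D * C" and ?H = "mat_adjoint C * C + D * mat_adjoint D"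
  have Uc: "U \<in> carrier_mat (n - r) (n - r)" using assms(12) by (simp add: unitary_matrix_def)
  have diag: "mat_adjoint U * B * U = Matrix.mat (n - r) (n - r) (\<lambda>(i,j). if i = j then d i else 0)"
    if B: "B \<in> carrier_mat (n - r) (n - r)" and dg: "diagonal_mat (mat_adjoint U * B * U)"
      and d: "\<And>j. j < n - r \<Longrightarrow> d j = (mat_adjoint U * B * U) $$ (j, j)" for B d
  proof -
    define K where "K = mat_adjoint U * B * U"
    have K: "dim_row K = n - r" "dim_col K = n - r" using Uc B by (auto simp: K_def)
    show ?thesis unfolding K_def[symmetric]
      by (rule eq_matI) (use K d dg in \<open>auto simp: diagonal_mat_def K_def[symmetric]\<close>)
  qed
  interpret scalar_block n r \<alpha> \<beta> C D A U z h
  proof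
    show "mat_adjoint U * ?Z * U = Matrix.mat (n - r) (n - r) (\<lambda>(i,j). if i = j then z i else 0)"
      by (rule diag[OF _ assms(13) assms(15)]) (use C D in auto)
    show "mat_adjoint U * ?H * U = Matrix.mat (n - r) (n - r) (\<lambda>(i,j). if i = j then complex_of_real (h i) else 0)"
      by (rule diag[OF _ assms(14) assms(16)]) (use C D in auto)
  qed (use assms in auto)
  define \<phi> where "\<phi> j = csqrt (\<Delta> j) / 2" for j
  have \<Delta>: "\<Delta> j = 4 * focal_sq j" for j by (simp add: assms(17) focal_sq_def \<delta>_def power_divide)
  have \<phi>: "(\<phi> j)\<^sup>2 = focal_sq j" for j by (simp add: \<phi>_def power_divide \<Delta>)
  have ab: "(cmod (\<alpha> - \<beta>))\<^sup>2 = 4 * axis_diff j + 2 * h j" for j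
    by (simp add: axis_diff_def \<delta>_def norm_divide power_divide)
  have N: "N j = sqrt (2 * (cmod (focal_sq j) + axis_diff j))" for j
    unfolding assms(20) \<Delta> ab[of j] by (simp add: norm_mult)
  have M: "M j = sqrt (2 * (cmod (focal_sq j) - axis_diff j))" for j
    unfolding assms(21) \<Delta> ab[of j] by (simp add: norm_mult algebra_simps)
  have f: "fp j = ctr + \<phi> j" "fm j = ctr - \<phi> j" for j by (simp_all add: assms(18,19) ctr_def \<phi>_def)
  \<comment> \<open>The radicands of $N_j$ and $M_j$ are $2(|F_j| + k_j)$ and $2(|F_j| - k_j)$.\<close>
  have b_iff: "b \<longleftrightarrow> (\<forall>j<n - r. 0 < cmod (focal_sq j) + axis_diff j \<and> axis_diff j \<le> cmod (focal_sq j))"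
  proof -
    have "(cmod (\<alpha> - \<beta>))\<^sup>2 - cmod (\<Delta> j) \<le> 2 * h j \<and> 2 * h j < (cmod (\<alpha> - \<beta>))\<^sup>2 + cmod (\<Delta> j)
      \<longleftrightarrow> 0 < cmod (focal_sq j) + axis_diff j \<and> axis_diff j \<le> cmod (focal_sq j)" for j
      unfolding \<Delta> ab[of j] by (auto simp: norm_mult)
    then show ?thesis unfolding b_def by blast
  qed
  have sense: "hyperbola_makes_sense (N j) (M j) \<longleftrightarrow> 0 < cmod (focal_sq j) + axis_diff j \<and> axis_diff j \<le> cmod (focal_sq j)" for j
    by (auto simp: hyperbola_makes_sense_def N M)
  have comps: "kippenhahn_components n r A = (\<Union>j < n - r. hyperbola_components (fp j) (fm j) (N j) (M j))
                 \<union> (if n < 2 * r then {{\<alpha>}} else {})" if b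
  proof -
    have cj: "lp_components (lp_conic ctr (focal_sq j) (axis_diff j)) = hyperbola_components (fp j) (fm j) (N j) (M j)" if "j < n - r" for j
      using lp_components_conic[of "\<phi> j" "axis_diff j" ctr] \<open>b\<close> that unfolding b_iff \<phi> f N M by blast
    have kp: "kippenhahn_poly n r A = lp_line \<alpha> ^ (2 * r - n) * (\<Prod>j<n - r. lp_conic ctr (focal_sq j) (axis_diff j))"
      unfolding kippenhahn_poly_factorization[OF rn assms(3) C D A U Zd Hd] ctr_def focal_sq_def axis_diff_def \<delta>_def ..
    have "kippenhahn_components n r A = lp_components (kippenhahn_poly n r A)"
      by (simp add: kippenhahn_components_def lp_components_def)
    also have "\<dots> = (if 2 * r - n = 0 then {} else {{\<alpha>}}) \<union> (\<Union>j<n - r. lp_components (lp_conic ctr (focal_sq j) (axis_diff j)))"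
      unfolding kp lp_components_mult lp_components_power lp_components_prod[OF finite_lessThan]
        lp_components_irreducible[OF irreducible_lp_line] envelope_lp_line ..
    also have "(\<Union>j<n - r. lp_components (lp_conic ctr (focal_sq j) (axis_diff j))) = (\<Union>j<n - r. hyperbola_components (fp j) (fm j) (N j) (M j))"
      using cj by simp
    finally show ?thesis by auto
  qed
  have "a \<longleftrightarrow> b" unfolding a_def using comps by (auto simp: b_iff sense)
  moreover have "J_num_range n r A = pseudo_convex_hull n r A (\<Union>j < n - r. hyperbola (fp j) (fm j) (N j) (M j))" if b
  proof -
    obtain g0 where g0: "0 < Re (g0 * \<delta>)" "\<And>j. j < n - r \<Longrightarrow> 0 < lform j g0"
      using class_J_separating[OF assms(3,9)] \<open>b\<close> unfolding b_iff by blast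
    interpret hyperbolic_block n r \<alpha> \<beta> C D A U z h \<phi> g0
      by unfold_locales (use \<phi> g0 \<open>b\<close> in \<open>auto simp: b_iff\<close>)
    have "hyp j = hyperbola (fp j) (fm j) (N j) (M j)" for j unfolding hyp_def f N M ..
    then show ?thesis using J_num_range_eq_hull by simp
  qed
  moreover have "hyperbola_nondegenerate (N j) (M j) \<longleftrightarrow> (cmod (\<alpha> - \<beta>))\<^sup>2 - cmod (\<Delta> j) < 2 * h j"
    if b "j < n - r" for j
  proof -
    have "hyperbola_nondegenerate (N j) (M j) \<longleftrightarrow> axis_diff j < cmod (focal_sq j)"
    proof -
      have "M j \<noteq> 0 \<longleftrightarrow> axis_diff j \<noteq> cmod (focal_sq j)" by (auto simp: M)
      then show ?thesis using that unfolding hyperbola_nondegenerate_def sense b_iff by auto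
    qed
    then show ?thesis unfolding \<Delta> ab[of j] by (auto simp: norm_mult)
  qed
  ultimately show ?thesis by blast
qed

end
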